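(* For each positive integer $m$ let $e_m$ denote the infimum of $\eta(P)$ over all convex polyhedra $P$ in $3$-dimensional Euclidean space that are inscribed in a unit sphere and have exactly $m$ faces, all of which are triangles, where $\eta(P)$ is the quotient (length of the longest edge of $P$)/(length of the shortest edge of $P$). Then $$\liminf_{m\to\infty} e_m = 2\sin 36^\circ = 1.1756\ldots .$$
   Context: A convex polyhedron is inscribed in a sphere if all its vertices lie on the sphere (the centre of the sphere need not lie in the polyhedron). Edge lengths are Euclidean lengths. For values of $m$ for which no such polyhedron exists (e.g. odd $m$), the infimum over the empty set is $+\infty$; equivalently the limit inferior is taken over those $m$ for which such polyhedra exist. *)

theory Defs
  imports "HOL-Analysis.Analysis"
begin

text \<open>The library's \<^const>\<open>polyhedron\<close> may be unbounded and lower-dimensional; a convex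
  polyhedron here is a bounded solid.\<close>

definition convex_polyhedron :: "(real^3) set \<Rightarrow> bool" where
  "convex_polyhedron P \<longleftrightarrow> polytope P \<and> aff_dim P = 3"

definition inscribed_in_unit_sphere :: "(real^3) set \<Rightarrow> bool" where
  "inscribed_in_unit_sphere P \<longleftrightarrow> (\<exists>c. {v. v extreme_point_of P} \<subseteq> sphere c 1)"

definition has_triangular_faces :: "nat \<Rightarrow> (real^3) set \<Rightarrow> bool" where
  "has_triangular_faces m P \<longleftrightarrow>
     card {F. F facet_of P} = m \<and> (\<forall>F. F facet_of P \<longrightarrow> 2 simplex F)"

text \<open>An edge is a line segment, so its length is its diameter.\<close>

definition edge_lengths :: "(real^3) set \<Rightarrow> real set" where
  "edge_lengths P = diameter ` {e. e edge_of P}"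

definition edge_ratio :: "(real^3) set \<Rightarrow> real" where
  "edge_ratio P = Max (edge_lengths P) / Min (edge_lengths P)"

text \<open>In \<^typ>\<open>ereal\<close> the infimum over the empty set is \<open>\<infinity>\<close>.\<close>

definition inf_edge_ratio :: "nat \<Rightarrow> ereal" where
  "inf_edge_ratio m =
     (INF P \<in> {P. convex_polyhedron P \<and> inscribed_in_unit_sphere P \<and> has_triangular_faces m P}.
        ereal (edge_ratio P))"

end

theory Submission
  imports Defs
begin

text \<open>Lower bound. Let \<open>s\<close> and \<open>L\<close> be the extreme edge lengths and \<open>L \<le> \<rho> s\<close> with \<open>\<rho> < 2 sin 36\<degree>\<close>. The closest
  two vertices span an edge, so the vertices are \<open>s\<close>-separated; hence their number is bounded unless \<open>s\<close> is
  small and the centre is interior. In that case the solid angles of the cones over the faces show that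
  some vertex lies in at most five faces, so one of its face angles, projected to the tangent plane, is at
  least 72 degrees; up to an error \<open>L\<^sup>4/2\<close> in the squares, the third side of that face is then at least
  \<open>2 s sin 36\<degree>\<close>, which exceeds \<open>L\<close> when \<open>s\<close> is small.

  Upper bound. Subdivide each face of the regular icosahedron by the lattice of barycentric coordinates with
  denominator \<open>n\<close>, and send \<open>p\<close> to the direction of \<open>\<Sum>i. prof (p$i) T$i\<close> on the sphere. The cubic profile
  is chosen such that the speed of this map in the three edge directions varies at most by the factor
  \<open>2 sin 36\<degree>\<close>. For large \<open>n\<close> every supporting plane of the convex hull of the image points meets it in at
  most three points, which are images of neighbouring lattice points.\<close>

section \<open>Polynomials over the integers with the square root of five adjoined\<close>

text \<open>The constant is forced at the icosahedral vertices: five faces with angles of 72 degrees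
  meet there, so in the tangent plane the three edge directions of a face have speeds in the ratio 1
  : 1 : 2 sin 36 degrees. Both speed inequalities are therefore equalities at the vertices and leave
  no room for numerical approximation; hence the exact coefficient arithmetic.

  The same bounds make neighbouring lattice directions enclose an acute angle. On a sphere this lets
  the hull reproduce the lattice triangulation: of the parallelogram between two non-adjacent
  lattice points, the other two corners stick out further, so no supporting plane touches both
  points.

  The hull is never described globally. Its proper faces are exposed, so only the maximisers of
  linear functionals are studied, and the reflections of the icosahedron confine these to one face.
  Likewise, no Euler formula enters the lower bound: the angle excess of spherical triangles takes
  its place.\<close>

text \<open>The pair \<open>(a, b)\<close> stands for \<open>a + b sqrt 5\<close>; coefficient lists, constant term first, over such pairs
  represent polynomials in \<open>y\<close>, and lists of these represent polynomials in \<open>x\<close> and \<open>y\<close>.\<close>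

type_synonym zq = "int \<times> int"

definition zval :: "zq \<Rightarrow> real" where
  "zval c = of_int (fst c) + of_int (snd c) * sqrt 5"

definition zadd :: "zq \<Rightarrow> zq \<Rightarrow> zq" where
  "zadd c d = (fst c + fst d, snd c + snd d)"

definition zmul :: "zq \<Rightarrow> zq \<Rightarrow> zq" where
  "zmul c d = (fst c * fst d + 5 * (snd c * snd d), fst c * snd d + snd c * fst d)"

text \<open>Comparing squares eliminates \<open>sqrt 5\<close>, which leaves a test on integers that
  \<open>code_simp\<close> can evaluate.\<close>

definition znn :: "zq \<Rightarrow> bool" where
  "znn c \<longleftrightarrow> (0 \<le> fst c \<and> 0 \<le> snd c) \<or> (0 \<le> fst c \<and> 5 * (snd c * snd c) \<le> fst c * fst c)
      \<or> (0 \<le> snd c \<and> fst c * fst c \<le> 5 * (snd c * snd c))"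

lemma zval_add: "zval (zadd c d) = zval c + zval d"
  by (simp add: zval_def zadd_def algebra_simps)

lemma zval_mul: "zval (zmul c d) = zval c * zval d"
proof -
  have "sqrt 5 * sqrt 5 = (5::real)" by simp
  then show ?thesis
    unfolding zval_def zmul_def by (simp add: algebra_simps)
qed

lemma zval_nonneg:
  assumes "znn c" shows "0 \<le> zval c"
proof -
  define a b where "a = real_of_int (fst c)" and "b = real_of_int (snd c)"
  have q: "sqrt 5 * sqrt 5 = (5::real)" "sqrt 5 > 0" by simp_all
  have "(0 \<le> a \<and> 0 \<le> b) \<or> (0 \<le> a \<and> 5 * (b * b) \<le> a * a) \<or> (0 \<le> b \<and> a * a \<le> 5 * (b * b))"
    using assms unfolding znn_def a_def b_def
    by (metis of_int_0_le_iff of_int_le_iff of_int_mult of_int_numeral)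
  then have "0 \<le> a + b * sqrt 5"
  proof (elim disjE conjE)
    assume "0 \<le> a" "5 * (b * b) \<le> a * a"
    then have "(b * sqrt 5)\<^sup>2 \<le> a\<^sup>2" by (simp add: power2_eq_square algebra_simps)
    then have "\<bar>b * sqrt 5\<bar> \<le> a" using \<open>0 \<le> a\<close> by (metis abs_le_square_iff abs_of_nonneg)
    then show ?thesis by linarith
  next
    assume "0 \<le> b" "a * a \<le> 5 * (b * b)"
    then have "a\<^sup>2 \<le> (b * sqrt 5)\<^sup>2" by (simp add: power2_eq_square algebra_simps)
    then have "\<bar>a\<bar> \<le> b * sqrt 5" using \<open>0 \<le> b\<close> q
      by (metis abs_le_square_iff abs_of_nonneg mult_nonneg_nonneg less_imp_le)
    then show ?thesis by linarith
  qed simp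
  then show ?thesis by (simp add: zval_def a_def b_def)
qed

fun p1add :: "zq list \<Rightarrow> zq list \<Rightarrow> zq list" where
  "p1add [] ds = ds"
| "p1add cs [] = cs"
| "p1add (c # cs) (d # ds) = zadd c d # p1add cs ds"

fun p1mul :: "zq list \<Rightarrow> zq list \<Rightarrow> zq list" where
  "p1mul [] ds = []"
| "p1mul (c # cs) ds = p1add (map (zmul c) ds) ((0, 0) # p1mul cs ds)"

fun p1ev :: "zq list \<Rightarrow> real \<Rightarrow> real" where
  "p1ev [] y = 0"
| "p1ev (c # cs) y = zval c + y * p1ev cs y"

fun p2add :: "zq list list \<Rightarrow> zq list list \<Rightarrow> zq list list" where
  "p2add [] ds = ds"
| "p2add cs [] = cs"
| "p2add (c # cs) (d # ds) = p1add c d # p2add cs ds"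

fun p2mul :: "zq list list \<Rightarrow> zq list list \<Rightarrow> zq list list" where
  "p2mul [] ds = []"
| "p2mul (c # cs) ds = p2add (map (p1mul c) ds) ([] # p2mul cs ds)"

fun p2ev :: "zq list list \<Rightarrow> real \<Rightarrow> real \<Rightarrow> real" where
  "p2ev [] x y = 0"
| "p2ev (c # cs) x y = p1ev c y + x * p2ev cs x y"

lemma p1ev_add: "p1ev (p1add cs ds) y = p1ev cs y + p1ev ds y"
  by (induction cs ds rule: p1add.induct) (auto simp: zval_add algebra_simps)

lemma p1ev_scale: "p1ev (map (zmul c) ds) y = zval c * p1ev ds y"
  by (induction ds) (auto simp: zval_mul algebra_simps)

lemma p1ev_mul: "p1ev (p1mul cs ds) y = p1ev cs y * p1ev ds y"
proof (induction cs)
  case (Cons c cs)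
  have "zval (0, 0) = 0" by (simp add: zval_def)
  with Cons show ?case by (simp add: p1ev_add p1ev_scale algebra_simps)
qed simp

lemma p2ev_add: "p2ev (p2add cs ds) x y = p2ev cs x y + p2ev ds x y"
  by (induction cs ds rule: p2add.induct) (auto simp: p1ev_add algebra_simps)

lemma p2ev_scale: "p2ev (map (p1mul c) ds) x y = p1ev c y * p2ev ds x y"
  by (induction ds) (auto simp: p1ev_mul algebra_simps)

lemma p2ev_mul: "p2ev (p2mul cs ds) x y = p2ev cs x y * p2ev ds x y"
  by (induction cs) (auto simp: p2ev_add p2ev_scale algebra_simps)

lemma p1ev_nonneg: "list_all znn cs \<Longrightarrow> 0 \<le> y \<Longrightarrow> 0 \<le> p1ev cs y"
  by (induction cs) (auto simp: zval_nonneg)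

lemma p2ev_nonneg: "list_all (list_all znn) cs \<Longrightarrow> 0 \<le> x \<Longrightarrow> 0 \<le> y \<Longrightarrow> 0 \<le> p2ev cs x y"
  by (induction cs) (auto simp: p1ev_nonneg)

definition pcon :: "int \<Rightarrow> int \<Rightarrow> zq list list" where
  "pcon a b = [[(a, b)]]"

lemma p2ev_con: "p2ev (pcon a b) x y = of_int a + of_int b * sqrt 5"
  by (simp add: pcon_def zval_def)

text \<open>The profile \<open>1800 v - 216 v\<^sup>2 - (409 - 125 sqrt 5) v\<^sup>3\<close> and its derivative, homogenised by \<open>s\<close>.\<close>

definition prof_p :: "zq list list \<Rightarrow> zq list list \<Rightarrow> zq list list" where
  "prof_p v s = p2mul v (p2add (p2mul s (p2add (p2mul (pcon 1800 0) s) (p2mul (pcon (-216) 0) v)))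
      (p2mul (pcon (-409) 125) (p2mul v v)))"

definition dprof_p :: "zq list list \<Rightarrow> zq list list \<Rightarrow> zq list list" where
  "dprof_p v s = p2add (p2mul s (p2add (p2mul (pcon 1800 0) s) (p2mul (pcon (-432) 0) v)))
      (p2mul (pcon (-1227) 375) (p2mul v v))"

definition hprof :: "real \<Rightarrow> real \<Rightarrow> real" where
  "hprof v s = v * (s * (1800 * s - 216 * v) + (125 * sqrt 5 - 409) * (v * v))"

definition hdprof :: "real \<Rightarrow> real \<Rightarrow> real" where
  "hdprof v s = s * (1800 * s - 432 * v) + (375 * sqrt 5 - 1227) * (v * v)"

lemma p2ev_prof: "p2ev (prof_p v s) x y = hprof (p2ev v x y) (p2ev s x y)"
  by (simp add: prof_p_def hprof_def p2ev_mul p2ev_add p2ev_con)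

lemma p2ev_dprof: "p2ev (dprof_p v s) x y = hdprof (p2ev v x y) (p2ev s x y)"
  by (simp add: dprof_p_def hdprof_def p2ev_mul p2ev_add p2ev_con)

definition nrm_p :: "zq list list \<Rightarrow> zq list list \<Rightarrow> zq list list \<Rightarrow> zq list list" where
  "nrm_p f g h = p2add (p2mul (pcon 0 1) (p2add (p2mul f f) (p2add (p2mul g g) (p2mul h h))))
     (p2mul (pcon 2 0) (p2add (p2mul f g) (p2mul h (p2add f g))))"

text \<open>This is \<open>sqrt 5\<close> times the squared norm of the combination of the three
  vertices of a face with coefficients \<open>f\<close>, \<open>g\<close>, \<open>h\<close>; the
  factor clears the denominator of their inner products \<open>1 / sqrt 5\<close>.\<close>

definition hnrm :: "real \<Rightarrow> real \<Rightarrow> real \<Rightarrow> real" where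
  "hnrm f g h = sqrt 5 * (f * f + (g * g + h * h)) + 2 * (f * g + h * (f + g))"

definition wedge_p :: "zq list list \<Rightarrow> zq list list \<Rightarrow> zq list list \<Rightarrow> zq list list \<Rightarrow> zq list list \<Rightarrow> zq list list" where
  "wedge_p f g h p q = (let m = p2add (p2mul f q) (p2mul g p); pq = p2mul p q; h2 = p2mul h h; pp = p2add p q in
     p2add (p2mul (pcon 2 0) (p2add (p2mul m m) (p2mul h2 (p2add (p2mul p p) (p2mul q q)))))
      (p2mul (pcon (-1) 1) (p2add (p2mul m (p2mul h pp)) (p2mul (pcon (-1) 0) (p2mul h2 pq)))))"

text \<open>Five halves of the Gram determinant of two combinations of the vertices of a face: the
  image vector with coefficients \<open>f\<close>, \<open>g\<close>, \<open>h\<close>, and its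
  derivative in the first edge direction with coefficients \<open>- p\<close>, \<open>q\<close>,
  \<open>0\<close> (see \<open>gram_hwedge\<close>).\<close>

definition hwedge :: "real \<Rightarrow> real \<Rightarrow> real \<Rightarrow> real \<Rightarrow> real \<Rightarrow> real" where
  "hwedge f g h p q = 2 * ((f * q + g * p) * (f * q + g * p) + (h * h) * (p * p + q * q))
     + (sqrt 5 - 1) * ((f * q + g * p) * (h * (p + q)) - (h * h) * (p * q))"

lemma p2ev_nrm: "p2ev (nrm_p f g h) x y = hnrm (p2ev f x y) (p2ev g x y) (p2ev h x y)"
  by (simp add: nrm_p_def hnrm_def p2ev_mul p2ev_add p2ev_con)

lemma p2ev_wedge: "p2ev (wedge_p f g h p q) x y =
    hwedge (p2ev f x y) (p2ev g x y) (p2ev h x y) (p2ev p x y) (p2ev q x y)"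
  by (simp add: wedge_p_def hwedge_def Let_def p2ev_mul p2ev_add p2ev_con)

text \<open>In the homogeneous barycentric coordinates \<open>(u, v, 1)\<close>, nonnegativity of these two polynomials says that
  the squared speed in the first edge direction lies between \<open>sig\<^sup>2\<close> and \<open>(2 sin 36\<degree>)\<^sup>2 sig\<^sup>2\<close>; by
  symmetry the upper bound is only needed for \<open>v \<le> u\<close>, where it has nonnegative coefficients in \<open>u - v\<close>, \<open>v\<close>.\<close>

definition lower_p :: "zq list list \<Rightarrow> zq list list \<Rightarrow> zq list list" where
  "lower_p u v = (let s = p2add (pcon 1 0) (p2add u v); f = prof_p u s; g = prof_p v s; h = prof_p (pcon 1 0) s;
     n = nrm_p f g h in
    p2add (p2mul (p2mul s s) (p2mul (pcon 5835 1175) (wedge_p f g h (dprof_p u s) (dprof_p v s))))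
      (p2mul (pcon (-5184) 0) (p2mul n n)))"

definition upper_p :: "zq list list \<Rightarrow> zq list list \<Rightarrow> zq list list" where
  "upper_p u v = (let s = p2add (pcon 1 0) (p2add u v); f = prof_p u s; g = prof_p v s; h = prof_p (pcon 1 0) s;
     n = nrm_p f g h in
    p2add (p2mul (p2mul s s) (p2mul (pcon (-5835) (-1175)) (wedge_p f g h (dprof_p u s) (dprof_p v s))))
      (p2mul (pcon 12960 (-2592)) (p2mul n n)))"

abbreviation "varx \<equiv> [[], [(1, 0)]] :: zq list list"
abbreviation "vary \<equiv> [[(0, 0), (1, 0)]] :: zq list list"

lemma lower_p_nonneg: "list_all (list_all znn) (lower_p varx vary)"
  by code_simp

lemma upper_p_nonneg: "list_all (list_all znn) (upper_p (p2add varx vary) vary)"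
  by code_simp

lemma hprof_scale: "hprof (r * v) (r * s) = r ^ 3 * hprof v s"
  by (simp add: hprof_def algebra_simps power3_eq_cube)

lemma hdprof_scale: "hdprof (r * v) (r * s) = r\<^sup>2 * hdprof v s"
  by (simp add: hdprof_def algebra_simps power2_eq_square)

lemma hnrm_scale: "hnrm (r * f) (r * g) (r * h) = r\<^sup>2 * hnrm f g h"
  by (simp add: hnrm_def algebra_simps power2_eq_square)

lemma hwedge_scale: "hwedge (r * f) (r * g) (r * h) (t * p) (t * q) = (r * t)\<^sup>2 * hwedge f g h p q"
  by (simp add: hwedge_def algebra_simps power2_eq_square)

lemma hnrm_swap: "hnrm f g h = hnrm g f h"
  by (simp add: hnrm_def algebra_simps)

lemma hwedge_swap: "hwedge f g h p q = hwedge g f h q p"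
  by (simp add: hwedge_def algebra_simps)

lemma p2ev_lower:
  "p2ev (lower_p a b) x y = (let u = p2ev a x y; v = p2ev b x y; s = 1 + (u + v) in
     s\<^sup>2 * ((5835 + 1175 * sqrt 5) * hwedge (hprof u s) (hprof v s) (hprof 1 s) (hdprof u s) (hdprof v s))
     - 5184 * (hnrm (hprof u s) (hprof v s) (hprof 1 s))\<^sup>2)"
  by (simp add: lower_p_def Let_def p2ev_add p2ev_mul p2ev_wedge p2ev_nrm p2ev_prof p2ev_dprof p2ev_con
      power2_eq_square)

lemma p2ev_upper:
  "p2ev (upper_p a b) x y = (let u = p2ev a x y; v = p2ev b x y; s = 1 + (u + v) in
     (12960 - 2592 * sqrt 5) * (hnrm (hprof u s) (hprof v s) (hprof 1 s))\<^sup>2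
     - s\<^sup>2 * ((5835 + 1175 * sqrt 5) * hwedge (hprof u s) (hprof v s) (hprof 1 s) (hdprof u s) (hdprof v s)))"
  by (simp add: upper_p_def Let_def p2ev_add p2ev_mul p2ev_wedge p2ev_nrm p2ev_prof p2ev_dprof p2ev_con
      power2_eq_square) (simp add: algebra_simps)

lemma lower_chart:
  assumes "0 \<le> u" "0 \<le> v"
  defines "s \<equiv> 1 + (u + v)"
  shows "5184 * (hnrm (hprof u s) (hprof v s) (hprof 1 s))\<^sup>2
    \<le> s\<^sup>2 * ((5835 + 1175 * sqrt 5) * hwedge (hprof u s) (hprof v s) (hprof 1 s) (hdprof u s) (hdprof v s))"
proof -
  have "0 \<le> p2ev (lower_p varx vary) u v"
    by (intro p2ev_nonneg lower_p_nonneg assms)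
  moreover have e: "p2ev varx u v = u" "p2ev vary u v = v" by (simp_all add: zval_def)
  ultimately show ?thesis
    unfolding s_def p2ev_lower Let_def e by linarith
qed

lemma upper_chart:
  assumes "0 \<le> u" "0 \<le> v"
  defines "s \<equiv> 1 + (u + v)"
  shows "s\<^sup>2 * ((5835 + 1175 * sqrt 5) * hwedge (hprof u s) (hprof v s) (hprof 1 s) (hdprof u s) (hdprof v s))
    \<le> (12960 - 2592 * sqrt 5) * (hnrm (hprof u s) (hprof v s) (hprof 1 s))\<^sup>2"
proof -
  have *: "s\<^sup>2 * ((5835 + 1175 * sqrt 5) * hwedge (hprof u s) (hprof v s) (hprof 1 s) (hdprof u s) (hdprof v s))
    \<le> (12960 - 2592 * sqrt 5) * (hnrm (hprof u s) (hprof v s) (hprof 1 s))\<^sup>2"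
    if "0 \<le> v" "v \<le> u" "s = 1 + (u + v)" for u v s
  proof -
    have "0 \<le> p2ev (upper_p (p2add varx vary) vary) (u - v) v"
      using that by (intro p2ev_nonneg upper_p_nonneg) auto
    moreover have e: "p2ev (p2add varx vary) (u - v) v = u" "p2ev vary (u - v) v = v"
      by (simp_all only: p2ev_add) (simp_all add: zval_def)
    ultimately show ?thesis
      unfolding that(3) p2ev_upper Let_def e by linarith
  qed
  show ?thesis
  proof (cases "v \<le> u")
    case True
    then show ?thesis using * assms by blast
  next
    case False
    then have "u \<le> v" by simp
    from *[OF assms(1) this, of s] show ?thesis
      by (simp add: s_def add.commute hnrm_swap[of "hprof v _"] hwedge_swap[of "hprof v _"])
  qed
qed

section \<open>The cubic profile on the unit interval\<close>

definition prof :: "real \<Rightarrow> real" where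
  "prof v = hprof v 1"

definition dprof :: "real \<Rightarrow> real" where
  "dprof v = hdprof v 1"

lemma prof_eq: "prof v = 1800 * v - 216 * v ^ 2 - (409 - 125 * sqrt 5) * v ^ 3"
  by (simp add: prof_def hprof_def power2_eq_square power3_eq_cube algebra_simps)

lemma dprof_eq: "dprof v = 1800 - 432 * v - (1227 - 375 * sqrt 5) * v ^ 2"
  by (simp add: dprof_def hdprof_def power2_eq_square algebra_simps)

text \<open>After homogenisation both sides have degree 12, so a point with \<open>z > 0\<close> may
  be rescaled to \<open>(x / z, y / z, 1)\<close>, where the polynomial inequalities are known.
  Points with \<open>z = 0\<close> follow by continuity.\<close>

lemma prof_bounds:
  assumes "0 \<le> x" "0 \<le> y" "0 \<le> z" "x + y + z = 1"
  shows "5184 * (hnrm (prof x) (prof y) (prof z))\<^sup>2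
     \<le> (5835 + 1175 * sqrt 5) * hwedge (prof x) (prof y) (prof z) (dprof x) (dprof y)" (is ?L)
   and "(5835 + 1175 * sqrt 5) * hwedge (prof x) (prof y) (prof z) (dprof x) (dprof y)
     \<le> (12960 - 2592 * sqrt 5) * (hnrm (prof x) (prof y) (prof z))\<^sup>2" (is ?U)
proof -
  define W where "W x y z = (5835 + 1175 * sqrt 5) * hwedge (prof x) (prof y) (prof z) (dprof x) (dprof y)" for x y z
  define N where "N x y z = (hnrm (prof x) (prof y) (prof z))\<^sup>2" for x y z
  have pos: "5184 * N x y z \<le> W x y z \<and> W x y z \<le> (12960 - 2592 * sqrt 5) * N x y z"
    if h: "0 \<le> x" "0 \<le> y" "0 < z" "x + y + z = 1" for x y z
  proof -
    \<comment> \<open>The homogenising variable \<open>s\<close> is the coordinate sum of the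
      rescaled point. The wedge has degree 10 only, whence the extra factor
      \<open>s\<^sup>2\<close>.\<close>
    define u v s where "u = x / z" and "v = y / z" and "s = 1 + (u + v)"
    have s: "s = 1 / z" using h unfolding s_def u_def v_def by (simp add: field_simps)
    have uv: "0 \<le> u" "0 \<le> v" using h by (auto simp: u_def v_def)
    have p: "prof x = z ^ 3 * hprof u s" "prof y = z ^ 3 * hprof v s" "prof z = z ^ 3 * hprof 1 s"
      using hprof_scale[of z u s] hprof_scale[of z v s] hprof_scale[of z 1 s] h
      by (simp_all add: prof_def s u_def v_def)
    have d: "dprof x = z\<^sup>2 * hdprof u s" "dprof y = z\<^sup>2 * hdprof v s"
      using hdprof_scale[of z u s] hdprof_scale[of z v s] h
      by (simp_all add: dprof_def s u_def v_def)
    have N: "N x y z = z ^ 12 * (hnrm (hprof u s) (hprof v s) (hprof 1 s))\<^sup>2"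
      unfolding N_def p hnrm_scale by (simp add: power_mult_distrib flip: power_mult)
    have "W x y z = z ^ 12 * (s\<^sup>2 * ((5835 + 1175 * sqrt 5) *
       hwedge (hprof u s) (hprof v s) (hprof 1 s) (hdprof u s) (hdprof v s)))"
      unfolding W_def p d hwedge_scale using h by (simp add: s power_divide power_mult_distrib field_simps flip: power_mult power_add)
    moreover have "z ^ 12 \<ge> 0" using h by simp
    ultimately show ?thesis
      unfolding N
      using mult_left_mono[OF lower_chart[OF uv, folded s_def], of "z ^ 12"]
        mult_left_mono[OF upper_chart[OF uv, folded s_def], of "z ^ 12"]
      by (simp add: mult.left_commute)
  qed
  have "5184 * N x y z \<le> W x y z \<and> W x y z \<le> (12960 - 2592 * sqrt 5) * N x y z"
  proof (cases "z = 0")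
    case False
    then show ?thesis using pos assms by auto
  next
    case True
    \<comment> \<open>The segment from the side point \<open>(x, y, 0)\<close> towards the vertex
      \<open>(0, 0, 1)\<close> has positive last coordinate for \<open>t > 0\<close>.\<close>
    define a b c where "a t = (1 - t) * x" and "b t = (1 - t) * y" and "c t = t" for t :: real
    have ev: "\<forall>\<^sub>F t in at_right 0. 5184 * N (a t) (b t) (c t) \<le> W (a t) (b t) (c t)
        \<and> W (a t) (b t) (c t) \<le> (12960 - 2592 * sqrt 5) * N (a t) (b t) (c t)"
      unfolding eventually_at_right_field
    proof (intro exI[of _ 1] conjI allI impI)
      fix t :: real assume t: "0 < t" "t < 1"
      have "a t + b t + c t = 1"
        using assms True by (simp add: a_def b_def c_def flip: distrib_left)
      moreover have "0 \<le> a t" "0 \<le> b t" "0 < c t" using assms t by (auto simp: a_def b_def c_def)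
      ultimately show "5184 * N (a t) (b t) (c t) \<le> W (a t) (b t) (c t)"
        "W (a t) (b t) (c t) \<le> (12960 - 2592 * sqrt 5) * N (a t) (b t) (c t)"
        using pos by blast+
    qed simp
    have "isCont (\<lambda>t. N (a t) (b t) (c t)) 0" "isCont (\<lambda>t. W (a t) (b t) (c t)) 0"
      unfolding N_def W_def a_def b_def c_def hnrm_def hwedge_def prof_eq dprof_eq
      by (intro continuous_intros)+
    then have lim: "((\<lambda>t. N (a t) (b t) (c t)) \<longlongrightarrow> N x y z) (at_right 0)"
      "((\<lambda>t. W (a t) (b t) (c t)) \<longlongrightarrow> W x y z) (at_right 0)"
      unfolding isCont_def using True
      by (auto simp: a_def b_def c_def intro: filterlim_mono[OF _ order_refl at_le])
    have "5184 * N x y z \<le> W x y z"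
      by (rule tendsto_le[OF _ lim(2) tendsto_mult_left[OF lim(1)]]) (use ev in \<open>auto elim: eventually_mono\<close>)
    moreover have "W x y z \<le> (12960 - 2592 * sqrt 5) * N x y z"
      by (rule tendsto_le[OF _ tendsto_mult_left[OF lim(1)] lim(2)]) (use ev in \<open>auto elim: eventually_mono\<close>)
    ultimately show ?thesis by simp
  qed
  then show ?L ?U by (simp_all add: W_def N_def)
qed

lemma sqrt5_bounds: "2.236 < sqrt 5" "sqrt 5 < 2.2361"
  by (rule real_less_rsqrt, simp add: power2_eq_square) (rule real_less_lsqrt, auto simp: power2_eq_square)

lemma dprof_pos:
  assumes "0 \<le> v" "v \<le> 1" shows "900 < dprof v"
proof -
  have "(1227 - 375 * sqrt 5) * v\<^sup>2 \<le> 389 * 1"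
    by (rule mult_mono) (use assms sqrt5_bounds in \<open>auto simp: power_le_one\<close>)
  then show ?thesis using assms unfolding dprof_eq by linarith
qed

lemma prof_deriv: "(prof has_real_derivative dprof v) (at v within S)"
  unfolding prof_eq[abs_def] dprof_eq
  by (auto intro!: derivative_eq_intros simp: algebra_simps)

lemma prof_strict_mono:
  assumes "0 \<le> u" "u < v" "v \<le> 1" shows "prof u < prof v"
proof (rule DERIV_pos_imp_increasing[OF assms(2)])
  fix t assume "u \<le> t" "t \<le> v"
  then have "0 < dprof t" using dprof_pos[of t] assms by linarith
  then show "\<exists>d. (prof has_real_derivative d) (at t) \<and> 0 < d" using prof_deriv by blast
qed

lemma prof_0 [simp]: "prof 0 = 0"
  by (simp add: prof_eq)

lemma prof_pos: "0 < v \<Longrightarrow> v \<le> 1 \<Longrightarrow> 0 < prof v"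
  using prof_strict_mono[of 0 v] by simp

lemma prof_nonneg: "0 \<le> v \<Longrightarrow> v \<le> 1 \<Longrightarrow> 0 \<le> prof v"
  using prof_pos[of v] by (cases "v = 0") auto

lemma prof_le:
  assumes "0 \<le> v" shows "prof v \<le> 1800 * v"
proof -
  have "0 \<le> (409 - 125 * sqrt 5) * v ^ 3"
    using assms sqrt5_bounds by (intro mult_nonneg_nonneg) auto
  moreover have "0 \<le> v\<^sup>2" by simp
  ultimately show ?thesis unfolding prof_eq by linarith
qed

lemma prof_ge:
  assumes "0 \<le> v" "v \<le> 1" shows "900 * v \<le> prof v"
proof -
  have "prof 0 - 900 * 0 \<le> prof v - 900 * v"
  proof (rule DERIV_nonneg_imp_nondecreasing[OF assms(1)])
    fix t assume "0 \<le> t" "t \<le> v"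
    then have "0 \<le> dprof t - 900" using dprof_pos[of t] assms by linarith
    moreover have "((\<lambda>t. prof t - 900 * t) has_real_derivative dprof t - 900) (at t)"
      by (auto intro!: derivative_eq_intros prof_deriv)
    ultimately show "\<exists>d. ((\<lambda>t. prof t - 900 * t) has_real_derivative d) (at t) \<and> 0 \<le> d"
      by blast
  qed
  then show ?thesis by simp
qed

lemma prof_less_iff: "0 \<le> u \<Longrightarrow> u \<le> 1 \<Longrightarrow> 0 \<le> v \<Longrightarrow> v \<le> 1 \<Longrightarrow> prof u < prof v \<longleftrightarrow> u < v"
  by (metis linorder_neqE_linordered_idom order_less_asym prof_strict_mono)

lemma prof_le_iff: "0 \<le> u \<Longrightarrow> u \<le> 1 \<Longrightarrow> 0 \<le> v \<Longrightarrow> v \<le> 1 \<Longrightarrow> prof u \<le> prof v \<longleftrightarrow> u \<le> v"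
  by (meson linorder_not_less prof_less_iff)

section \<open>Bounded Lipschitz functions\<close>

definition bdlip :: "'a::metric_space set \<Rightarrow> ('a \<Rightarrow> 'b::real_normed_vector) \<Rightarrow> bool" where
  "bdlip S F \<longleftrightarrow> (\<exists>B. (\<forall>x\<in>S. norm (F x) \<le> B) \<and> (\<forall>x\<in>S. \<forall>y\<in>S. norm (F x - F y) \<le> B * dist x y))"

lemma bdlipE:
  assumes "bdlip S F"
  obtains B where "0 \<le> B" "\<And>x. x \<in> S \<Longrightarrow> norm (F x) \<le> B"
    "\<And>x y. x \<in> S \<Longrightarrow> y \<in> S \<Longrightarrow> norm (F x - F y) \<le> B * dist x y"
proof -
  obtain B where B: "\<And>x. x \<in> S \<Longrightarrow> norm (F x) \<le> B"
    "\<And>x y. x \<in> S \<Longrightarrow> y \<in> S \<Longrightarrow> norm (F x - F y) \<le> B * dist x y"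
    using assms unfolding bdlip_def by blast
  have "norm (F x) \<le> max 0 B" if "x \<in> S" for x using B(1)[OF that] by simp
  moreover have "norm (F x - F y) \<le> max 0 B * dist x y" if "x \<in> S" "y \<in> S" for x y
    using B(2)[OF that] by (meson max.cobounded2 mult_right_mono order_trans zero_le_dist)
  ultimately show ?thesis using that[of "max 0 B"] by simp
qed

lemma bdlipI:
  assumes "\<And>x. x \<in> S \<Longrightarrow> norm (F x) \<le> B"
    "\<And>x y. x \<in> S \<Longrightarrow> y \<in> S \<Longrightarrow> norm (F x - F y) \<le> C * dist x y"
  shows "bdlip S F"
  unfolding bdlip_def
proof (intro exI[of _ "max B C"] conjI ballI)
  fix x assume "x \<in> S" then show "norm (F x) \<le> max B C" using assms(1)[of x] by simp
next
  fix x y assume "x \<in> S" "y \<in> S"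
  then have "norm (F x - F y) \<le> C * dist x y" by (rule assms(2))
  also have "\<dots> \<le> max B C * dist x y" by (intro mult_right_mono) auto
  finally show "norm (F x - F y) \<le> max B C * dist x y" .
qed

lemma bdlip_const: "bdlip S (\<lambda>x. c)"
  by (rule bdlipI[of _ _ "norm c" 0]) auto

lemma bdlip_add:
  assumes "bdlip S F" "bdlip S G" shows "bdlip S (\<lambda>x. F x + G x)"
proof -
  obtain B where B: "\<And>x. x \<in> S \<Longrightarrow> norm (F x) \<le> B" "\<And>x y. x \<in> S \<Longrightarrow> y \<in> S \<Longrightarrow> norm (F x - F y) \<le> B * dist x y"
    using bdlipE[OF assms(1)] by metis
  obtain C where C: "\<And>x. x \<in> S \<Longrightarrow> norm (G x) \<le> C" "\<And>x y. x \<in> S \<Longrightarrow> y \<in> S \<Longrightarrow> norm (G x - G y) \<le> C * dist x y"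
    using bdlipE[OF assms(2)] by metis
  show ?thesis
  proof (rule bdlipI[of _ _ "B + C" "B + C"])
    fix x y assume xy: "x \<in> S" "y \<in> S"
    show "norm (F x + G x) \<le> B + C" using B(1) C(1) xy by (meson add_mono norm_triangle_ineq order_trans)
    have "norm (F x + G x - (F y + G y)) \<le> norm (F x - F y) + norm (G x - G y)"
      by (metis add_diff_add norm_triangle_ineq)
    then show "norm (F x + G x - (F y + G y)) \<le> (B + C) * dist x y"
      using B(2)[OF xy] C(2)[OF xy] by (simp add: distrib_right)
  qed
qed

text \<open>As in the product rule, the bound of one factor multiplies the Lipschitz constant of the
  other; this is why \<open>bdlip\<close> keeps both properties. The closure rules make the
  derivative of \<open>smap\<close> Lipschitz by inspection of its formula, without second
  derivatives.\<close>

lemma bdlip_prod: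
  assumes "bounded_bilinear prd" "bdlip S F" "bdlip S G" shows "bdlip S (\<lambda>x. prd (F x) (G x))"
proof -
  interpret bounded_bilinear prd by fact
  obtain K where K: "0 \<le> K" "\<And>a b. norm (prd a b) \<le> norm a * norm b * K" using nonneg_bounded by blast
  obtain B where B: "0 \<le> B" "\<And>x. x \<in> S \<Longrightarrow> norm (F x) \<le> B" "\<And>x y. x \<in> S \<Longrightarrow> y \<in> S \<Longrightarrow> norm (F x - F y) \<le> B * dist x y"
    using bdlipE[OF assms(2)] by metis
  obtain C where C: "0 \<le> C" "\<And>x. x \<in> S \<Longrightarrow> norm (G x) \<le> C" "\<And>x y. x \<in> S \<Longrightarrow> y \<in> S \<Longrightarrow> norm (G x - G y) \<le> C * dist x y"
    using bdlipE[OF assms(3)] by metis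
  show ?thesis
  proof (rule bdlipI[of _ _ "B * C * K" "2 * (B * C * K)"])
    fix x y assume xy: "x \<in> S" "y \<in> S"
    have "norm (F x) * norm (G x) * K \<le> B * C * K"
      using B C K xy by (intro mult_mono) auto
    then show "norm (prd (F x) (G x)) \<le> B * C * K" using K(2) order_trans by blast
    have "prd (F x) (G x) - prd (F y) (G y) = prd (F x - F y) (G x) + prd (F y) (G x - G y)"
      by (simp add: diff_left diff_right)
    then have "norm (prd (F x) (G x) - prd (F y) (G y))
        \<le> norm (F x - F y) * norm (G x) * K + norm (F y) * norm (G x - G y) * K"
      using K(2) by (metis norm_triangle_mono)
    also have "\<dots> \<le> (B * dist x y) * C * K + B * (C * dist x y) * K"
      using B C K xy by (intro add_mono mult_mono mult_nonneg_nonneg) auto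
    finally show "norm (prd (F x) (G x) - prd (F y) (G y)) \<le> 2 * (B * C * K) * dist x y"
      by (simp add: algebra_simps)
  qed
qed

lemmas bdlip_scaleR = bdlip_prod[OF bounded_bilinear_scaleR]
lemmas bdlip_mult = bdlip_prod[OF bounded_bilinear_mult]
lemmas bdlip_inner = bdlip_prod[OF bounded_bilinear_inner]

lemma bdlip_minus: "bdlip S F \<Longrightarrow> bdlip S (\<lambda>x. - F x)"
  using bdlip_scaleR[OF bdlip_const[of S "-1::real"], of F] by simp

lemma bdlip_diff: "bdlip S F \<Longrightarrow> bdlip S G \<Longrightarrow> bdlip S (\<lambda>x. F x - G x)"
  using bdlip_add[OF _ bdlip_minus, of S F G] by simp

lemma bdlip_norm:
  assumes "bdlip S F" shows "bdlip S (\<lambda>x. norm (F x))"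
proof -
  obtain B where B: "\<And>x. x \<in> S \<Longrightarrow> norm (F x) \<le> B" "\<And>x y. x \<in> S \<Longrightarrow> y \<in> S \<Longrightarrow> norm (F x - F y) \<le> B * dist x y"
    using bdlipE[OF assms(1)] by metis
  then show ?thesis
    by (intro bdlipI[of _ _ B B]) (auto intro: order_trans[OF norm_triangle_ineq3])
qed

lemma bdlip_inverse:
  fixes F :: "'a::metric_space \<Rightarrow> real"
  assumes "bdlip S F" "0 < m" "\<And>x. x \<in> S \<Longrightarrow> m \<le> F x" shows "bdlip S (\<lambda>x. inverse (F x))"
proof -
  obtain B where B: "0 \<le> B" "\<And>x y. x \<in> S \<Longrightarrow> y \<in> S \<Longrightarrow> norm (F x - F y) \<le> B * dist x y"
    using bdlipE[OF assms(1)] by metis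
  show ?thesis
  proof (rule bdlipI[of _ _ "inverse m" "inverse m * inverse m * B"])
    fix x y assume xy: "x \<in> S" "y \<in> S"
    note m = assms(3)[OF xy(1)] assms(3)[OF xy(2)] assms(2)
    have i: "0 \<le> inverse (F x)" "inverse (F x) \<le> inverse m" "0 \<le> inverse (F y)" "inverse (F y) \<le> inverse m"
      using m by (auto intro: le_imp_inverse_le)
    then show "norm (inverse (F x)) \<le> inverse m" by simp
    have "inverse (F x) - inverse (F y) = inverse (F x) * inverse (F y) * (F y - F x)"
      using m by (simp add: field_simps)
    then have "norm (inverse (F x) - inverse (F y)) = inverse (F x) * inverse (F y) * norm (F x - F y)"
      using i by (simp add: abs_mult abs_minus_commute)
    also have "\<dots> \<le> inverse m * inverse m * (B * dist x y)"
      using i B m xy by (intro mult_mono) auto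
    finally show "norm (inverse (F x) - inverse (F y)) \<le> inverse m * inverse m * B * dist x y"
      by (simp add: mult.assoc)
  qed
qed

section \<open>The map onto a spherical triangle\<close>

definition simp3 :: "(real^3) set" where
  "simp3 = {p. (\<forall>i. 0 \<le> p$i) \<and> p$1 + p$2 + p$3 = 1}"

lemma simp3_le: "p \<in> simp3 \<Longrightarrow> p$i \<le> 1"
  using exhaust_3[of i] by (auto simp: simp3_def forall_3)

lemma simp3_nonneg: "p \<in> simp3 \<Longrightarrow> 0 \<le> p$i"
  by (simp add: simp3_def)

lemma convex_simp3: "convex simp3"
  unfolding convex_def simp3_def
proof (intro ballI allI impI CollectI conjI; clarsimp)
  fix x y :: "real^3" and u v :: real
  assume "u + v = 1" "x$1 + x$2 + x$3 = 1" "y$1 + y$2 + y$3 = 1"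
  then show "u * x$1 + v * y$1 + (u * x$2 + v * y$2) + (u * x$3 + v * y$3) = 1"
    by (metis (no_types, opaque_lifting) add.assoc add.left_commute distrib_left mult.right_neutral)
qed

lemma compact_simp3: "compact simp3"
proof -
  have "bounded simp3"
  proof (rule boundedI)
    fix p assume p: "p \<in> simp3"
    have "norm p \<le> (\<Sum>i\<in>UNIV. \<bar>p$i\<bar>)" by (rule norm_le_l1_cart)
    also have "\<dots> = 1" using p by (simp add: sum_3 simp3_def)
    finally show "norm p \<le> 1" .
  qed
  moreover have "closed simp3"
    unfolding simp3_def
    by (intro closed_Collect_conj closed_Collect_all closed_Collect_le closed_Collect_eq continuous_intros)
  ultimately show ?thesis by (simp add: compact_eq_bounded_closed)
qed

lemma bdlip_component: "bdlip simp3 (\<lambda>p. p$i)"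
  by (rule bdlipI[of _ _ 1 1])
    (auto simp: simp3_le simp3_nonneg dist_norm simp flip: vector_minus_component intro: component_le_norm_cart)

lemma bdlip_prof: "bdlip simp3 (\<lambda>p. prof (p$i))"
  unfolding prof_eq power2_eq_square power3_eq_cube
  by (intro bdlip_diff bdlip_mult bdlip_const bdlip_component)

lemma bdlip_dprof: "bdlip simp3 (\<lambda>p. dprof (p$i))"
  unfolding dprof_eq power2_eq_square
  by (intro bdlip_diff bdlip_mult bdlip_const bdlip_component)

text \<open>The vertices of a face of the regular icosahedron inscribed in the unit sphere
  (the central angle of an edge has cosine \<open>1 / sqrt 5\<close>).\<close>

definition tri :: "real^3^3 \<Rightarrow> bool" where
  "tri T \<longleftrightarrow> (\<forall>i j. T$i \<bullet> T$j = (if i = j then 1 else 1 / sqrt 5))"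

definition fmap :: "real^3^3 \<Rightarrow> real^3 \<Rightarrow> real^3" where
  "fmap T p = (\<Sum>i\<in>UNIV. prof (p$i) *\<^sub>R T$i)"

definition fder :: "real^3^3 \<Rightarrow> real^3 \<Rightarrow> real^3 \<Rightarrow> real^3" where
  "fder T p v = (\<Sum>i\<in>UNIV. (dprof (p$i) * v$i) *\<^sub>R T$i)"

definition smap :: "real^3^3 \<Rightarrow> real^3 \<Rightarrow> real^3" where
  "smap T p = inverse (norm (fmap T p)) *\<^sub>R fmap T p"

text \<open>The component of \<open>fder\<close> orthogonal to \<open>fmap\<close>, divided by the
  norm of \<open>fmap\<close>, as for any radial projection. It is spelled out with products of
  inverses so that the closure rules for \<open>bdlip\<close> apply term by term.\<close>

definition sder :: "real^3^3 \<Rightarrow> real^3 \<Rightarrow> real^3 \<Rightarrow> real^3" where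
  "sder T p v = inverse (norm (fmap T p)) *\<^sub>R fder T p v
     - (fmap T p \<bullet> fder T p v * inverse (norm (fmap T p)) * inverse (norm (fmap T p)) * inverse (norm (fmap T p))) *\<^sub>R fmap T p"

lemma tri_norm: "tri T \<Longrightarrow> norm (T$i) = 1"
  by (simp add: tri_def norm_eq_sqrt_inner)

lemma tri_inner: "tri T \<Longrightarrow> i \<noteq> j \<Longrightarrow> T$i \<bullet> T$j = 1 / sqrt 5"
  by (simp add: tri_def)

lemma inner_tri_combination:
  assumes "tri T"
  shows "(\<Sum>i\<in>UNIV. a i *\<^sub>R T$i) \<bullet> (\<Sum>i\<in>UNIV. b i *\<^sub>R T$i)
    = a 1 * b 1 + a 2 * b 2 + a 3 * b 3
      + (a 1 * (b 2 + b 3) + a 2 * (b 1 + b 3) + a 3 * (b 1 + b 2)) / sqrt 5"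
  using assms by (simp add: sum_3 tri_def inner_add_left inner_add_right field_simps)

text \<open>Some coordinate is at least 1/3, where the profile is at least 300. The vertices of the
  face have positive inner products, so the norm dominates each coefficient.\<close>

lemma norm_fmap_ge:
  assumes "tri T" "p \<in> simp3" shows "300 \<le> norm (fmap T p)"
proof -
  have pr: "900 * p$i \<le> prof (p$i)" "0 \<le> prof (p$i)" for i
    using prof_ge[of "p$i"] prof_nonneg[of "p$i"] simp3_le[OF assms(2)] simp3_nonneg[OF assms(2)] by auto
  have sq: "300\<^sup>2 \<le> a * a + b * b + c * c" if "300 \<le> a \<or> 300 \<le> b \<or> 300 \<le> c" for a b c :: real
  proof -
    have sx: "300\<^sup>2 \<le> x * x" if "300 \<le> x" for x :: real
      unfolding power2_eq_square using that by (intro mult_mono) auto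
    have nn: "0 \<le> a * a" "0 \<le> b * b" "0 \<le> c * c" by simp_all
    from that show ?thesis
    proof (elim disjE)
      assume "300 \<le> a" from sx[OF this] nn show ?thesis by linarith
    next
      assume "300 \<le> b" from sx[OF this] nn show ?thesis by linarith
    next
      assume "300 \<le> c" from sx[OF this] nn show ?thesis by linarith
    qed
  qed
  have "1/3 \<le> p$1 \<or> 1/3 \<le> p$2 \<or> 1/3 \<le> p$3"
    using assms(2) unfolding simp3_def mem_Collect_eq by linarith
  then have "300 \<le> prof (p$1) \<or> 300 \<le> prof (p$2) \<or> 300 \<le> prof (p$3)"
    using pr(1)[of 1] pr(1)[of 2] pr(1)[of 3] by linarith
  from sq[OF this] have "300\<^sup>2 \<le> prof (p$1) * prof (p$1) + prof (p$2) * prof (p$2) + prof (p$3) * prof (p$3)" .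
  also have "\<dots> \<le> fmap T p \<bullet> fmap T p"
    unfolding fmap_def inner_tri_combination[OF assms(1)] using pr by simp
  also have "\<dots> = (norm (fmap T p))\<^sup>2" by (simp add: power2_norm_eq_inner)
  finally show ?thesis by (rule power2_le_imp_le) simp
qed

lemma norm_fmap_le:
  assumes "tri T" "p \<in> simp3" shows "norm (fmap T p) \<le> 1800"
proof -
  have "norm (fmap T p) \<le> (\<Sum>i\<in>UNIV. norm (prof (p$i) *\<^sub>R T$i))" unfolding fmap_def by (rule norm_sum)
  also have "\<dots> \<le> (\<Sum>i\<in>UNIV. 1800 * p$i)"
    using prof_le prof_nonneg simp3_le[OF assms(2)] simp3_nonneg[OF assms(2)] tri_norm[OF assms(1)]
    by (intro sum_mono) simp
  also have "\<dots> = 1800" using assms(2) by (simp add: sum_3 simp3_def)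
  finally show ?thesis .
qed

lemma fmap_nz: "tri T \<Longrightarrow> p \<in> simp3 \<Longrightarrow> fmap T p \<noteq> 0"
  using norm_fmap_ge[of T p] by auto

lemma norm_smap: "tri T \<Longrightarrow> p \<in> simp3 \<Longrightarrow> norm (smap T p) = 1"
  using fmap_nz[of T p] by (simp add: smap_def)

lemma bdlip_fmap: "bdlip simp3 (fmap T)"
  unfolding fmap_def sum_3
  by (intro bdlip_add bdlip_scaleR bdlip_prof bdlip_const)

lemma bdlip_fder: "bdlip simp3 (\<lambda>p. fder T p v)"
  unfolding fder_def sum_3
  by (intro bdlip_add bdlip_scaleR bdlip_mult bdlip_dprof bdlip_const)

lemma bdlip_inverse_norm: "tri T \<Longrightarrow> bdlip simp3 (\<lambda>p. inverse (norm (fmap T p)))"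
  by (rule bdlip_inverse[of _ _ 300]) (auto intro: bdlip_norm bdlip_fmap norm_fmap_ge)

lemma bdlip_sder: "tri T \<Longrightarrow> bdlip simp3 (\<lambda>p. sder T p v)"
  unfolding sder_def
  by (intro bdlip_diff bdlip_scaleR bdlip_mult bdlip_inner bdlip_fmap bdlip_fder bdlip_inverse_norm)

lemma bdlip_smap: "tri T \<Longrightarrow> bdlip simp3 (smap T)"
  unfolding smap_def
  by (intro bdlip_scaleR bdlip_fmap bdlip_inverse_norm)

lemma linear_sder: "linear (sder T p)"
proof -
  have f: "fder T p (v + w) = fder T p v + fder T p w" "fder T p (c *\<^sub>R v) = c *\<^sub>R fder T p v" for v w c
    by (simp_all add: fder_def sum_3 algebra_simps)
  show ?thesis
    by (rule linearI) (simp_all add: sder_def f inner_add_right algebra_simps)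
qed

text \<open>Linearity in the direction reduces this to the three axis directions, for which
  \<open>bdlip_sder\<close> supplies constants.\<close>

lemma sder_lipschitz:
  assumes "tri T"
  obtains K where "0 \<le> K"
    "\<And>p v. p \<in> simp3 \<Longrightarrow> norm (sder T p v) \<le> K * norm v"
    "\<And>p q v. p \<in> simp3 \<Longrightarrow> q \<in> simp3 \<Longrightarrow> norm (sder T p v - sder T q v) \<le> K * norm v * dist p q"
proof -
  have "\<exists>B\<ge>0. (\<forall>p\<in>simp3. norm (sder T p (axis i 1)) \<le> B) \<and>
     (\<forall>p\<in>simp3. \<forall>q\<in>simp3. norm (sder T p (axis i 1) - sder T q (axis i 1)) \<le> B * dist p q)" for i
    using bdlipE[OF bdlip_sder[OF assms, of "axis i 1"]] by metis
  then obtain B where B: "\<And>i. 0 \<le> B i" "\<And>i p. p \<in> simp3 \<Longrightarrow> norm (sder T p (axis i 1)) \<le> B i"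
     "\<And>i p q. p \<in> simp3 \<Longrightarrow> q \<in> simp3 \<Longrightarrow> norm (sder T p (axis i 1) - sder T q (axis i 1)) \<le> B i * dist p q"
    by metis
  have rep: "sder T p v = (\<Sum>i\<in>UNIV. v$i *\<^sub>R sder T p (axis i 1))" for p v
  proof -
    interpret linear "sder T p" by (rule linear_sder)
    have "sder T p v = sder T p (\<Sum>i\<in>UNIV. v$i *\<^sub>R axis i 1)"
      using basis_expansion[of v] by (simp add: scalar_mult_eq_scaleR)
    then show ?thesis by (simp add: sum scale)
  qed
  define K where "K = (\<Sum>i\<in>UNIV. B i)"
  show ?thesis
  proof (rule that[of K])
    show "0 \<le> K" unfolding K_def using B(1) by (simp add: sum_nonneg)
    fix p v assume p: "p \<in> simp3"
    have "norm (sder T p v) \<le> (\<Sum>i\<in>UNIV. norm (v$i *\<^sub>R sder T p (axis i 1)))"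
      unfolding rep[of p v] by (rule norm_sum)
    also have "\<dots> \<le> (\<Sum>i\<in>UNIV. norm v * B i)"
      using B p component_le_norm_cart[of v] by (intro sum_mono) (auto intro!: mult_mono)
    finally show "norm (sder T p v) \<le> K * norm v"
      by (simp add: K_def sum_distrib_left mult.commute)
    fix q assume q: "q \<in> simp3"
    have "norm (sder T p v - sder T q v) \<le> (\<Sum>i\<in>UNIV. norm (v$i *\<^sub>R (sder T p (axis i 1) - sder T q (axis i 1))))"
      unfolding rep[of p v] rep[of q v] by (simp add: sum_subtractf[symmetric] scaleR_diff_right[symmetric] norm_sum del: sum_subtractf norm_scaleR)
    also have "\<dots> \<le> (\<Sum>i\<in>UNIV. norm v * (B i * dist p q))"
      using B p q component_le_norm_cart[of v] by (intro sum_mono) (auto intro!: mult_mono)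
    finally show "norm (sder T p v - sder T q v) \<le> K * norm v * dist p q"
      by (simp add: K_def sum_distrib_left sum_distrib_right mult_ac)
  qed
qed

lemma smap_has_vector_derivative:
  assumes "tri T" "p + t *\<^sub>R v \<in> simp3"
  shows "((\<lambda>t. smap T (p + t *\<^sub>R v)) has_vector_derivative sder T (p + t *\<^sub>R v) v) (at t)"
proof -
  let ?F = "\<lambda>t. fmap T (p + t *\<^sub>R v)"
  let ?D = "fder T (p + t *\<^sub>R v) v"
  have nz: "?F t \<noteq> 0" using norm_fmap_ge[OF assms] by auto
  have c: "((\<lambda>t. prof ((p + t *\<^sub>R v)$i)) has_real_derivative dprof ((p + t *\<^sub>R v)$i) * v$i) (at t)" for i
    by (rule DERIV_chain2[OF prof_deriv]) (auto intro!: derivative_eq_intros)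
  have F: "(?F has_vector_derivative ?D) (at t)"
    unfolding fmap_def fder_def
    by (intro has_vector_derivative_sum)
      (rule has_vector_derivative_eq_rhs[OF has_vector_derivative_scaleR[OF c has_vector_derivative_const]], simp)
  have N: "((\<lambda>t. norm (?F t)) has_real_derivative (?F t \<bullet> ?D) * inverse (norm (?F t))) (at t)"
    using has_derivative_compose[OF F[unfolded has_vector_derivative_def] has_derivative_norm[OF nz]]
    unfolding has_field_derivative_def
    by (rule has_derivative_eq_rhs)
      (simp add: fun_eq_iff sgn_div_norm inner_commute[of _ "?F t"] mult.commute mult.left_commute divide_inverse)
  have I: "((\<lambda>t. inverse (norm (?F t))) has_real_derivative
      - ((?F t \<bullet> ?D) * inverse (norm (?F t)) * inverse (norm (?F t)) * inverse (norm (?F t)))) (at t)"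
    by (rule DERIV_cong[OF DERIV_inverse_fun[OF N]]) (use nz in \<open>auto simp: power2_eq_square\<close>)
  show ?thesis
    unfolding smap_def sder_def
    by (rule has_vector_derivative_eq_rhs[OF has_vector_derivative_scaleR[OF I F]]) simp
qed

lemma path_bound:
  fixes f :: "real \<Rightarrow> 'a::real_normed_vector"
  assumes "\<And>t. 0 \<le> t \<Longrightarrow> t \<le> 1 \<Longrightarrow> (f has_vector_derivative f' t) (at t)"
    and "\<And>t. 0 \<le> t \<Longrightarrow> t \<le> 1 \<Longrightarrow> norm (f' t) \<le> B"
  shows "norm (f 1 - f 0) \<le> B"
proof -
  have "norm (f 1 - f 0) \<le> B * 1 - B * 0"
  proof (rule differentiable_bound_general[where \<phi> = "\<lambda>t. B * t" and f' = f' and \<phi>' = "\<lambda>t. B"])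
    show "continuous_on {0..1} f"
      using assms(1) by (intro continuous_at_imp_continuous_on ballI has_vector_derivative_continuous) auto
  qed (use assms in \<open>auto intro!: continuous_intros derivative_eq_intros\<close>)
  then show ?thesis by simp
qed

lemma simp3_segment:
  assumes "p \<in> simp3" "p + v \<in> simp3" "0 \<le> t" "t \<le> (1::real)"
  shows "p + t *\<^sub>R v \<in> simp3"
proof -
  have "p + t *\<^sub>R v = (1 - t) *\<^sub>R p + t *\<^sub>R (p + v)" by (simp add: algebra_simps)
  then show ?thesis using convexD[OF convex_simp3 assms(1,2), of "1 - t" t] assms(3,4) by simp
qed

text \<open>The estimates for differences of \<open>smap\<close> integrate bounds on
  \<open>sder\<close> along segments. In the last two, the Lipschitz property of \<open>sder\<close>
  does the work of a bound on second derivatives.\<close>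

lemma smap_estimates:
  assumes "tri T"
  obtains K where "1 \<le> K"
    "\<And>p v. p \<in> simp3 \<Longrightarrow> norm (sder T p v) \<le> K * norm v"
    "\<And>p v. p \<in> simp3 \<Longrightarrow> p + v \<in> simp3 \<Longrightarrow> norm (smap T (p + v) - smap T p) \<le> K * norm v"
    "\<And>p v. p \<in> simp3 \<Longrightarrow> p + v \<in> simp3 \<Longrightarrow> norm (smap T (p + v) - smap T p - sder T p v) \<le> K * (norm v)\<^sup>2"
    "\<And>p v w. p \<in> simp3 \<Longrightarrow> p + v \<in> simp3 \<Longrightarrow> p + w \<in> simp3 \<Longrightarrow> p + v + w \<in> simp3 \<Longrightarrow>
       norm (smap T (p + v + w) - smap T (p + v) - smap T (p + w) + smap T p) \<le> K * norm v * norm w"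
proof -
  obtain K0 where K0: "0 \<le> K0" "\<And>p v. p \<in> simp3 \<Longrightarrow> norm (sder T p v) \<le> K0 * norm v"
    "\<And>p q v. p \<in> simp3 \<Longrightarrow> q \<in> simp3 \<Longrightarrow> norm (sder T p v - sder T q v) \<le> K0 * norm v * dist p q"
    using sder_lipschitz[OF assms] by blast
  define K where "K = max 1 K0"
  have K: "\<And>p v. p \<in> simp3 \<Longrightarrow> norm (sder T p v) \<le> K * norm v"
    "\<And>p q v. p \<in> simp3 \<Longrightarrow> q \<in> simp3 \<Longrightarrow> norm (sder T p v - sder T q v) \<le> K * norm v * dist p q"
    using K0(2,3) unfolding K_def
    by (meson max.cobounded2 mult_right_mono norm_ge_zero order_trans,
        meson max.cobounded2 mult_right_mono norm_ge_zero zero_le_dist order_trans)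
  have K1: "1 \<le> K" by (simp add: K_def)
  show ?thesis
  proof (rule that[OF K1 K(1)])
    fix p v assume p: "p \<in> simp3" "p + v \<in> simp3"
    note seg = simp3_segment[OF p]
    have "norm (smap T (p + 1 *\<^sub>R v) - smap T (p + 0 *\<^sub>R v)) \<le> K * norm v"
      by (rule path_bound[OF smap_has_vector_derivative[OF assms]]) (use seg K(1) in auto)
    then show "norm (smap T (p + v) - smap T p) \<le> K * norm v" by simp
    have "norm ((smap T (p + 1 *\<^sub>R v) - 1 *\<^sub>R sder T p v) - (smap T (p + 0 *\<^sub>R v) - 0 *\<^sub>R sder T p v)) \<le> K * (norm v)\<^sup>2"
    proof (rule path_bound)
      fix t :: real assume t: "0 \<le> t" "t \<le> 1"
      show "((\<lambda>t. smap T (p + t *\<^sub>R v) - t *\<^sub>R sder T p v) has_vector_derivative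
          sder T (p + t *\<^sub>R v) v - sder T p v) (at t)"
        by (intro has_vector_derivative_diff smap_has_vector_derivative[OF assms seg[OF t]])
          (auto intro!: derivative_eq_intros)
      have "norm (sder T (p + t *\<^sub>R v) v - sder T p v) \<le> K * norm v * dist (p + t *\<^sub>R v) p"
        using K(2) seg[OF t] p by blast
      also have "dist (p + t *\<^sub>R v) p \<le> norm v" using t by (simp add: dist_norm mult_left_le_one_le)
      finally show "norm (sder T (p + t *\<^sub>R v) v - sder T p v) \<le> K * (norm v)\<^sup>2"
        using K1 by (simp add: power2_eq_square mult.assoc mult_left_mono)
    qed
    then show "norm (smap T (p + v) - smap T p - sder T p v) \<le> K * (norm v)\<^sup>2" by (simp add: algebra_simps)
    fix w assume w: "p + w \<in> simp3" "p + v + w \<in> simp3"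
    have seg2: "(p + w) + t *\<^sub>R v \<in> simp3" if "0 \<le> t" "t \<le> 1" for t
      using simp3_segment[OF w(1) _ that, of v] w(2) by (simp add: add_ac)
    \<comment> \<open>The mixed second difference is the increment along \<open>v\<close> of the
      difference between \<open>smap\<close> at points offset by \<open>w\<close>; the derivative of
      that difference is small by the Lipschitz property of \<open>sder\<close>.\<close>
    have "norm ((smap T ((p + w) + 1 *\<^sub>R v) - smap T (p + 1 *\<^sub>R v)) - (smap T ((p + w) + 0 *\<^sub>R v) - smap T (p + 0 *\<^sub>R v)))
       \<le> K * norm v * norm w"
    proof (rule path_bound)
      fix t :: real assume t: "0 \<le> t" "t \<le> 1"
      show "((\<lambda>t. smap T ((p + w) + t *\<^sub>R v) - smap T (p + t *\<^sub>R v)) has_vector_derivative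
          sder T ((p + w) + t *\<^sub>R v) v - sder T (p + t *\<^sub>R v) v) (at t)"
        by (intro has_vector_derivative_diff smap_has_vector_derivative[OF assms] seg seg2 t)
      show "norm (sder T ((p + w) + t *\<^sub>R v) v - sder T (p + t *\<^sub>R v) v) \<le> K * norm v * norm w"
        using K(2)[OF seg2[OF t] seg[OF t], of v] by (simp add: dist_norm)
    qed
    then show "norm (smap T (p + v + w) - smap T (p + v) - smap T (p + w) + smap T p) \<le> K * norm v * norm w"
      by (simp add: algebra_simps)
  qed
qed

text \<open>As \<open>(prof 1)\<^sup>2 = 250 * (5835 + 1175 * sqrt 5)\<close> and
  \<open>dprof 0 = 1800\<close>, the square of \<open>sig\<close> is
  \<open>(dprof 0 / prof 1)\<^sup>2 * 4 / 5\<close>, the squared speed at a vertex of the face along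
  a side ending there. In the direction of the opposite side it is
  \<open>(dprof 0 / prof 1)\<^sup>2 * (2 - 2 / sqrt 5)\<close>, larger by exactly the factor
  \<open>(5 - sqrt 5) / 2\<close>.\<close>

definition sig :: real where
  "sig = sqrt (10368 / (5835 + 1175 * sqrt 5))"

lemma sig_pos: "0 < sig"
  by (simp add: sig_def add_pos_pos)

lemma sig_sq: "sig\<^sup>2 = 10368 / (5835 + 1175 * sqrt 5)"
  by (simp add: sig_def)

text \<open>With \<open>k = 1 / sqrt 5\<close>, the substitutions \<open>sqrt 5 = 5 * k\<close> and
  \<open>5 * k * k = 1\<close> turn the Gram determinant into a polynomial identity.\<close>

lemma gram_hwedge:
  fixes k :: real
  assumes "k * sqrt 5 = 1"
  shows "(x * x + y * y + z * z + k * (x * (y + z) + y * (x + z) + z * (x + y)))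
      * (p * p + q * q - 2 * k * p * q)
     - (y * q - x * p + k * (x * q - y * p + z * (q - p)))\<^sup>2
    = 2 / 5 * hwedge x y z p q"
proof -
  have r: "sqrt 5 = 5 * k"
  proof -
    have "5 * k = (sqrt 5 * sqrt 5) * k" by simp
    also have "\<dots> = sqrt 5 * (k * sqrt 5)" by (simp only: mult_ac)
    finally show ?thesis using assms by simp
  qed
  then have k: "5 * k * k = 1" using assms by (simp add: mult_ac)
  then have "5 * ((x * x + y * y + z * z + k * (x * (y + z) + y * (x + z) + z * (x + y)))
      * (p * p + q * q - 2 * k * p * q)
     - (y * q - x * p + k * (x * q - y * p + z * (q - p)))\<^sup>2) = 2 * hwedge x y z p q"
    unfolding hwedge_def r power2_eq_square by algebra
  then show ?thesis by simp
qed

text \<open>The right-hand side is the squared area of the parallelogram of \<open>fmap\<close> and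
  \<open>fder\<close>, that is, base times height, and \<open>sder\<close> is the height divided by
  the base.\<close>

lemma norm_sder_sq:
  assumes "tri T" "p \<in> simp3"
  shows "(norm (sder T p v))\<^sup>2 * (fmap T p \<bullet> fmap T p)\<^sup>2 =
    (fmap T p \<bullet> fmap T p) * (fder T p v \<bullet> fder T p v) - (fmap T p \<bullet> fder T p v)\<^sup>2"
proof -
  define n where "n = norm (fmap T p)"
  define r where "r = inverse n"
  have n: "n \<noteq> 0" unfolding n_def using fmap_nz[OF assms] by simp
  have nn: "fmap T p \<bullet> fmap T p = n\<^sup>2" by (simp add: n_def power2_norm_eq_inner)
  have rn: "r * n = 1" using n by (simp add: r_def)
  define d e where "d = fder T p v \<bullet> fder T p v" and "e = fmap T p \<bullet> fder T p v"
  have sq: "(norm (r *\<^sub>R D - c *\<^sub>R F))\<^sup>2 = r\<^sup>2 * (D \<bullet> D) - 2 * r * c * (F \<bullet> D) + c\<^sup>2 * (F \<bullet> F)"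
    for D F :: "real^3" and r c
    unfolding power2_norm_eq_inner
    by (simp add: inner_diff_left inner_diff_right inner_commute power2_eq_square algebra_simps)
  have "(norm (sder T p v))\<^sup>2 = r\<^sup>2 * d - 2 * r * (e * r * r * r) * e + (e * r * r * r)\<^sup>2 * n\<^sup>2"
    unfolding sder_def n_def[symmetric] r_def[symmetric] e_def[symmetric] sq nn d_def ..
  then have "(norm (sder T p v))\<^sup>2 * (n\<^sup>2)\<^sup>2 = n\<^sup>2 * d - e\<^sup>2"
    using rn by algebra
  then show ?thesis by (simp add: nn d_def e_def)
qed

definition ratio_bound :: real where
  "ratio_bound = 2 * sin (pi / 5)"

text \<open>The sines of twice and three times \<open>pi / 5\<close> agree. Dividing by the sine of
  \<open>pi / 5\<close> leaves \<open>4 * c\<^sup>2 - 2 * c - 1 = 0\<close>, which has a single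
  positive root.\<close>

lemma cos_pi_5: "cos (pi / 5) = (1 + sqrt 5) / 4"
proof -
  define c s where "c = cos (pi / 5)" and "s = sin (pi / 5)"
  have "s > 0" unfolding s_def by (rule sin_gt_zero) auto
  have "c > 0" unfolding c_def by (rule cos_gt_zero) auto
  have "sin (3 * (pi / 5)) = sin (2 * (pi / 5))"
    using sin_pi_minus[of "2 * (pi / 5)"] by (simp add: algebra_simps)
  moreover have "sin (3 * (pi / 5)) = sin (2 * (pi / 5)) * c + cos (2 * (pi / 5)) * s"
    using sin_add[of "2 * (pi / 5)" "pi / 5"] by (simp add: c_def s_def algebra_simps)
  moreover have "sin (2 * (pi / 5)) = 2 * s * c" "cos (2 * (pi / 5)) = 2 * c\<^sup>2 - 1"
    unfolding c_def s_def by (rule sin_double, rule cos_double_cos)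
  ultimately have "2 * s * c = 2 * s * c * c + (2 * c\<^sup>2 - 1) * s" by simp
  then have "s * (4 * c\<^sup>2 - 2 * c - 1) = 0" by (simp add: power2_eq_square algebra_simps)
  then have "4 * c\<^sup>2 - 2 * c - 1 = 0" using \<open>s > 0\<close> by simp
  then have "(4 * c - 1)\<^sup>2 = 5" by (simp add: power2_eq_square algebra_simps)
  then have "\<bar>4 * c - 1\<bar> = sqrt 5" using real_sqrt_abs by metis
  moreover have "sqrt 5 > (1::real)" by (simp)
  moreover have "\<bar>4 * c - 1\<bar> = 4 * c - 1 \<or> \<bar>4 * c - 1\<bar> = 1 - 4 * c" by linarith
  ultimately have "4 * c - 1 = sqrt 5" using \<open>c > 0\<close> by linarith
  then show ?thesis unfolding c_def[symmetric] by simp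
qed

lemma ratio_bound_sq: "ratio_bound\<^sup>2 = (5 - sqrt 5) / 2"
proof -
  have "ratio_bound\<^sup>2 = 4 * (1 - (cos (pi / 5))\<^sup>2)"
    by (simp add: ratio_bound_def power_mult_distrib sin_squared_eq)
  then show ?thesis by (simp add: cos_pi_5 power2_eq_square field_simps)
qed

lemma ratio_bound_pos: "0 < ratio_bound"
  unfolding ratio_bound_def by (simp add: sin_gt_zero)

lemma third_index:
  fixes u v :: 3
  obtains w where "w \<noteq> u" "w \<noteq> v"
proof -
  have "\<not> (\<forall>w. w = u \<or> w = v)"
    unfolding forall_3 by auto
  then show ?thesis using that by blast
qed

lemma distinct_indices:
  fixes u v w :: 3
  assumes "u \<noteq> v" "w \<noteq> u" "w \<noteq> v"
  shows "(u = 1 \<and> v = 2 \<and> w = 3) \<or> (u = 1 \<and> v = 3 \<and> w = 2) \<or> (u = 2 \<and> v = 1 \<and> w = 3)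
      \<or> (u = 2 \<and> v = 3 \<and> w = 1) \<or> (u = 3 \<and> v = 1 \<and> w = 2) \<or> (u = 3 \<and> v = 2 \<and> w = 1)"
  using assms exhaust_3[of u] exhaust_3[of v] exhaust_3[of w] by (elim disjE; simp)

text \<open>The inner products of a face are symmetric under relabelling, so
  \<open>prof_bounds\<close>, which concerns an exchange between the first two coordinates, applies
  to any pair of indices, with the remaining index \<open>w\<close> as the third.\<close>

lemma speed:
  assumes "tri T" "p \<in> simp3" "u \<noteq> v"
  shows "sig \<le> norm (sder T p (axis u 1 - axis v 1))" (is "_ \<le> norm ?s")
    and "norm (sder T p (axis u 1 - axis v 1)) \<le> ratio_bound * sig"
proof -
  obtain w where w: "w \<noteq> u" "w \<noteq> v" by (rule third_index)
  define x y z where "x = prof (p$v)" and "y = prof (p$u)" and "z = prof (p$w)"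
  define a b where "a = dprof (p$v)" and "b = dprof (p$u)"
  define k :: real where "k = 1 / sqrt 5"
  have k: "k * sqrt 5 = 1" by (simp add: k_def)
  have perm: "(v = 1 \<and> u = 2 \<and> w = 3) \<or> (v = 1 \<and> u = 3 \<and> w = 2) \<or> (v = 2 \<and> u = 1 \<and> w = 3)
      \<or> (v = 2 \<and> u = 3 \<and> w = 1) \<or> (v = 3 \<and> u = 1 \<and> w = 2) \<or> (v = 3 \<and> u = 2 \<and> w = 1)"
    using distinct_indices[OF assms(3) w] by blast
  let ?f = "fmap T p" and ?d = "fder T p (axis u 1 - axis v 1)"
  have ff: "?f \<bullet> ?f = x * x + y * y + z * z + k * (x * (y + z) + y * (x + z) + z * (x + y))"
    unfolding fmap_def inner_tri_combination[OF assms(1)] x_def y_def z_def k_def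
    using perm by (elim disjE conjE; hypsubst; simp add: algebra_simps add_divide_distrib)
  have dd: "?d \<bullet> ?d = a * a + b * b - 2 * k * a * b"
    unfolding fder_def inner_tri_combination[OF assms(1)] a_def b_def k_def
    using perm by (elim disjE conjE; hypsubst; simp add: axis_def algebra_simps add_divide_distrib)
  have fd: "?f \<bullet> ?d = y * b - x * a + k * (x * b - y * a + z * (b - a))"
    unfolding fmap_def fder_def inner_tri_combination[OF assms(1)] x_def y_def z_def a_def b_def k_def
    using perm by (elim disjE conjE; hypsubst; simp add: axis_def field_simps)
  have nz: "0 < (?f \<bullet> ?f)\<^sup>2" using fmap_nz[OF assms(1,2)] by simp
  have eq: "(norm ?s)\<^sup>2 * (?f \<bullet> ?f)\<^sup>2 = 2 / 5 * hwedge x y z a b"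
    unfolding norm_sder_sq[OF assms(1,2)] unfolding ff dd fd by (rule gram_hwedge[OF k])
  have "hnrm x y z = sqrt 5 * (?f \<bullet> ?f)"
    unfolding ff hnrm_def using k by algebra
  then have hn: "(hnrm x y z)\<^sup>2 = 5 * (?f \<bullet> ?f)\<^sup>2" by (simp add: power_mult_distrib)
  have "p$v + p$u + p$w = 1" using perm assms(2) by (auto simp: simp3_def)
  note bds = prof_bounds[of "p$v" "p$u" "p$w", OF _ _ _ this, folded x_def y_def z_def a_def b_def, unfolded hn]
  have pos: "0 < 5835 + 1175 * sqrt (5::real)" by (simp add: add_pos_pos)
  define N where "N = (?f \<bullet> ?f)\<^sup>2"
  have hw: "hwedge x y z a b = 5 / 2 * ((norm ?s)\<^sup>2 * N)" using eq by (simp add: N_def)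
  have b1: "5184 * (5 * N) \<le> (5835 + 1175 * sqrt 5) * (5 / 2 * ((norm ?s)\<^sup>2 * N))"
    and b2: "(5835 + 1175 * sqrt 5) * (5 / 2 * ((norm ?s)\<^sup>2 * N)) \<le> (12960 - 2592 * sqrt 5) * (5 * N)"
    using bds simp3_nonneg[OF assms(2)] unfolding hw N_def[symmetric] by blast+
  have "10368 * N \<le> ((5835 + 1175 * sqrt 5) * (norm ?s)\<^sup>2) * N"
    using b1 by (simp add: algebra_simps)
  then have c1: "10368 \<le> (5835 + 1175 * sqrt 5) * (norm ?s)\<^sup>2"
    using nz by (simp add: N_def[symmetric])
  have "((5835 + 1175 * sqrt 5) * (norm ?s)\<^sup>2) * N \<le> (2 * (12960 - 2592 * sqrt 5)) * N"
    using b2 by (simp add: algebra_simps)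
  then have c2: "(5835 + 1175 * sqrt 5) * (norm ?s)\<^sup>2 \<le> 2 * (12960 - 2592 * sqrt 5)"
    using nz by (simp add: N_def[symmetric])
  have "sig\<^sup>2 \<le> (norm ?s)\<^sup>2"
    unfolding sig_sq using c1 pos by (simp add: pos_divide_le_eq mult.commute)
  then show "sig \<le> norm ?s" by (rule power2_le_imp_le) simp
  have "(norm ?s)\<^sup>2 \<le> 2 * (12960 - 2592 * sqrt 5) / (5835 + 1175 * sqrt 5)"
    using c2 pos by (simp add: pos_le_divide_eq mult.commute)
  also have "\<dots> = (ratio_bound * sig)\<^sup>2"
  proof -
    have "2 * (12960 - 2592 * q) / D = (5 - q) / 2 * (10368 / D)" for q D :: real
      by (cases "D = 0") (simp_all add: field_simps)
    then show ?thesis unfolding power_mult_distrib ratio_bound_sq sig_sq by blast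
  qed
  finally show "norm ?s \<le> ratio_bound * sig"
    by (rule power2_le_imp_le) (use ratio_bound_pos sig_pos in simp)
qed

text \<open>Law of cosines: two sides are at least \<open>sig\<close> and the third is at most
  \<open>ratio_bound * sig\<close>. The factor \<open>(sqrt 5 - 1) / 4\<close> is the cosine of 72
  degrees, and only its positivity matters later.\<close>

lemma acute:
  assumes "tri T" "p \<in> simp3" "u \<noteq> m" "v \<noteq> m" "u \<noteq> v"
  shows "sig\<^sup>2 * ((sqrt 5 - 1) / 4) \<le> sder T p (axis u 1 - axis m 1) \<bullet> sder T p (axis v 1 - axis m 1)"
proof -
  let ?a = "sder T p (axis u 1 - axis m 1)" and ?b = "sder T p (axis v 1 - axis m 1)"
  have d: "?a - ?b = sder T p (axis u 1 - axis v 1)"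
    using linear_diff[OF linear_sder[of T p], symmetric] by simp
  have "(norm (?a - ?b))\<^sup>2 \<le> (ratio_bound * sig)\<^sup>2"
    unfolding d using speed(2)[OF assms(1,2,5)] by (rule power_mono) simp
  moreover have "sig\<^sup>2 \<le> (norm ?a)\<^sup>2" "sig\<^sup>2 \<le> (norm ?b)\<^sup>2"
    using speed(1)[OF assms(1,2,3)] speed(1)[OF assms(1,2,4)] sig_pos by (auto intro!: power_mono)
  moreover have "(norm (?a - ?b))\<^sup>2 = (norm ?a)\<^sup>2 + (norm ?b)\<^sup>2 - 2 * (?a \<bullet> ?b)"
    by (simp add: power2_norm_eq_inner inner_diff_left inner_diff_right inner_commute)
  ultimately have "2 * sig\<^sup>2 - (ratio_bound * sig)\<^sup>2 \<le> 2 * (?a \<bullet> ?b)" by linarith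
  then show ?thesis unfolding power_mult_distrib ratio_bound_sq by (simp add: field_simps)
qed

text \<open>The Gram matrix is \<open>1 - k\<close> times the identity plus \<open>k\<close> times
  the all-ones matrix, with \<open>0 < k < 1\<close>, hence positive definite.\<close>

lemma tri_independent:
  assumes "tri T" "(\<Sum>i\<in>UNIV. a i *\<^sub>R T$i) = (\<Sum>i\<in>UNIV. b i *\<^sub>R T$i)" shows "a i = b i"
proof -
  define c where "c i = a i - b i" for i
  define k where "k = 1 / sqrt (5::real)"
  have k: "0 < k" "k < 1" by (simp_all add: k_def)
  have dk: "x / sqrt 5 = k * x" for x by (simp add: k_def)
  have "(\<Sum>i\<in>UNIV. c i *\<^sub>R T$i) = 0"
    using assms(2) by (simp add: c_def scaleR_diff_left sum_subtractf)
  then have "(\<Sum>i\<in>UNIV. c i *\<^sub>R T$i) \<bullet> (\<Sum>i\<in>UNIV. c i *\<^sub>R T$i) = 0" by simp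
  then have "(1 - k) * (c 1 * c 1 + c 2 * c 2 + c 3 * c 3) + k * (c 1 + c 2 + c 3)\<^sup>2 = 0"
    unfolding inner_tri_combination[OF assms(1)] dk by (simp add: power2_eq_square algebra_simps)
  moreover have "0 \<le> k * (c 1 + c 2 + c 3)\<^sup>2" using k by simp
  ultimately have "(1 - k) * (c 1 * c 1 + c 2 * c 2 + c 3 * c 3) \<le> 0" by linarith
  then have "c 1 * c 1 + (c 2 * c 2 + c 3 * c 3) \<le> 0" using k by (simp add: mult_le_0_iff add.assoc)
  moreover have "0 \<le> c 2 * c 2 + c 3 * c 3" "0 \<le> c 1 * c 1" by (simp_all add: add_nonneg_nonneg)
  ultimately have "c 1 * c 1 = 0" "c 2 * c 2 + c 3 * c 3 = 0" by linarith+
  then have "c 1 = 0" "c 2 = 0" "c 3 = 0" by (simp_all add: sum_squares_eq_zero_iff)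
  then show ?thesis using exhaust_3[of i] by (auto simp: c_def)
qed

text \<open>If the directions agree, one image vector is \<open>l\<close> times the other with
  \<open>l \<ge> 1\<close>, up to a swap. Independence and monotonicity then order all coordinates
  the same way, and equal coordinate sums force equality.\<close>

lemma inj_on_smap:
  assumes "tri T" shows "inj_on (smap T) simp3"
proof (rule inj_onI)
  have *: "x = y" if "x \<in> simp3" "y \<in> simp3" "fmap T x = l *\<^sub>R fmap T y" "1 \<le> l" for x y l
  proof -
    have "(\<Sum>i\<in>UNIV. prof (x$i) *\<^sub>R T$i) = (\<Sum>i\<in>UNIV. (l * prof (y$i)) *\<^sub>R T$i)"
      using that(3) by (simp add: fmap_def scaleR_sum_right)
    from tri_independent[OF assms this] have "prof (x$i) = l * prof (y$i)" for i .
    then have "prof (y$i) \<le> prof (x$i)" for i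
      using that(4) prof_nonneg[of "y$i"] simp3_nonneg[OF that(2)] simp3_le[OF that(2)]
      by (simp add: mult_le_cancel_right1)
    then have le: "y$i \<le> x$i" for i
      using prof_le_iff simp3_nonneg simp3_le that(1,2) by blast
    show ?thesis
      using le[of 1] le[of 2] le[of 3] that(1,2) by (simp add: vec_eq_iff forall_3 simp3_def)
  qed
  fix x y assume xy: "x \<in> simp3" "y \<in> simp3" "smap T x = smap T y"
  define m n where "m = norm (fmap T x)" and "n = norm (fmap T y)"
  have mn: "0 < m" "0 < n" using fmap_nz[OF assms] xy by (auto simp: m_def n_def)
  have e: "m *\<^sub>R smap T x = fmap T x" "n *\<^sub>R smap T y = fmap T y"
    using mn by (simp_all add: smap_def m_def n_def)
  have "fmap T x = (m / n) *\<^sub>R fmap T y" "fmap T y = (n / m) *\<^sub>R fmap T x"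
    using mn xy(3) unfolding e[symmetric] by simp_all
  note e2 = this
  show "x = y"
  proof (cases "n \<le> m")
    case True
    then show ?thesis using *[OF xy(1,2) e2(1)] mn by simp
  next
    case False
    then show ?thesis using *[OF xy(2,1) e2(2)] mn by simp
  qed
qed

lemma continuous_on_smap:
  assumes "tri T" shows "continuous_on simp3 (smap T)"
proof -
  obtain B where "0 \<le> B" "\<And>x y. x \<in> simp3 \<Longrightarrow> y \<in> simp3 \<Longrightarrow> norm (smap T x - smap T y) \<le> B * dist x y"
    using bdlipE[OF bdlip_smap[OF assms]] by metis
  then show ?thesis
    by (intro lipschitz_on_continuous_on[of B] lipschitz_onI) (auto simp: dist_norm)
qed

text \<open>The inverse is continuous on a compact set. Maximality gives closeness on the sphere,
  whereas the Taylor estimates need closeness of the parameters.\<close>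

lemma smap_uniformly_injective:
  assumes "tri T" "0 < \<delta>"
  obtains \<eta> where "0 < \<eta>"
    "\<And>x y. x \<in> simp3 \<Longrightarrow> y \<in> simp3 \<Longrightarrow> dist (smap T x) (smap T y) < \<eta> \<Longrightarrow> dist x y < \<delta>"
proof -
  note c = continuous_on_smap[OF assms(1)]
  define g where "g = inv_into simp3 (smap T)"
  have g: "\<And>x. x \<in> simp3 \<Longrightarrow> g (smap T x) = x" unfolding g_def using inj_on_smap[OF assms(1)] by simp
  have "uniformly_continuous_on (smap T ` simp3) g"
    using continuous_on_inv[OF c compact_simp3] g compact_continuous_image[OF c compact_simp3]
    by (auto intro: compact_uniformly_continuous)
  then obtain \<eta> where "0 < \<eta>" "\<And>x y. x \<in> smap T ` simp3 \<Longrightarrow> y \<in> smap T ` simp3 \<Longrightarrow> dist y x < \<eta> \<Longrightarrow> dist (g y) (g x) < \<delta>"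
    using assms(2) unfolding uniformly_continuous_on_def by metis
  then show ?thesis using g by (intro that[of \<eta>]) force+
qed

text \<open>Invert the profile coordinatewise: the preimage of the multiple
  \<open>l *\<^sub>R c\<close> has coordinates \<open>g (l * \<gamma> i)\<close>, and the
  intermediate value theorem picks \<open>l\<close> so that they add up to 1.\<close>

lemma smap_surjective:
  assumes "tri T" "norm c = 1" "c = (\<Sum>i\<in>UNIV. \<gamma> i *\<^sub>R T$i)" "\<And>i. 0 \<le> \<gamma> i"
  obtains y where "y \<in> simp3" "smap T y = c"
proof -
  define G where "G = prof 1"
  have G: "0 < G" unfolding G_def by (rule prof_pos) auto
  have pc: "continuous_on {0..1} prof"
    unfolding prof_eq[abs_def] by (intro continuous_intros)
  have pinj: "inj_on prof {0..1}"
    by (rule inj_onI) (metis atLeastAtMost_iff order_antisym order_refl prof_le_iff)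
  define g where "g = inv_into {0..1} prof"
  have g: "\<And>x. x \<in> {0..1} \<Longrightarrow> g (prof x) = x" unfolding g_def using pinj by simp
  have im: "prof ` {0..1} = {0..G}"
  proof (intro equalityI subsetI)
    fix t assume "t \<in> {0..G}"
    then obtain x where "0 \<le> x" "x \<le> 1" "prof x = t"
      using IVT'[of prof 0 t 1] pc by (auto simp: G_def)
    then show "t \<in> prof ` {0..1}" by auto
  qed (auto simp: G_def prof_nonneg prof_le_iff)
  have gc: "continuous_on {0..G} g"
    using continuous_on_inv[OF pc compact_Icc] g im by auto
  have g01: "prof (g t) = t" "g t \<in> {0..1}" if "t \<in> {0..G}" for t
  proof -
    have "t \<in> prof ` {0..1}" unfolding im by (rule that)
    then obtain x where "t = prof x" "x \<in> {0..1}" by (rule imageE)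
    then show "prof (g t) = t" "g t \<in> {0..1}" using g by simp_all
  qed
  have "\<exists>i. \<gamma> i \<noteq> 0"
  proof (rule ccontr)
    assume "\<nexists>i. \<gamma> i \<noteq> 0"
    then have "c = 0" unfolding assms(3) by simp
    then show False using assms(2) by simp
  qed
  define M where "M = Max (range \<gamma>)"
  have M: "\<gamma> i \<le> M" for i by (simp add: M_def)
  have "M \<in> range \<gamma>" unfolding M_def by (rule Max_in) auto
  then obtain i0 where i0: "\<gamma> i0 = M" by auto
  obtain i1 where "\<gamma> i1 \<noteq> 0" using \<open>\<exists>i. \<gamma> i \<noteq> 0\<close> by blast
  then have Mpos: "0 < M" using assms(4)[of i1] M[of i1] by linarith
  define S where "S l = (\<Sum>i\<in>UNIV. g (l * \<gamma> i))" for l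
  \<comment> \<open>Up to \<open>l = G / M\<close> all arguments stay in the range of the profile,
    and at this end the largest coordinate has already reached 1.\<close>
  have rng: "l * \<gamma> i \<in> {0..G}" if "l \<in> {0..G / M}" for l i
  proof -
    have "l * \<gamma> i \<le> G / M * M" using that assms(4) M Mpos G by (intro mult_mono) auto
    then show ?thesis using that assms(4) Mpos by simp
  qed
  have Sc: "continuous_on {0..G / M} S"
    unfolding S_def by (intro continuous_on_sum continuous_on_compose2[OF gc] continuous_intros) (use rng in auto)
  have "g 0 = 0" using g[of 0] by simp
  then have S0: "S 0 = 0" by (simp add: S_def)
  have "g G = 1" using g[of 1] by (simp add: G_def)
  then have "1 = g (G / M * \<gamma> i0)" using i0 Mpos by simp
  also have "\<dots> \<le> S (G / M)"
    unfolding S_def by (rule member_le_sum) (use g01(2) rng[of "G / M"] G Mpos in auto)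
  finally have "1 \<le> S (G / M)" .
  then obtain l where l: "l \<in> {0..G / M}" "S l = 1"
    using IVT'[of S 0 1 "G / M"] S0 Sc G Mpos by auto
  define y :: "real^3" where "y = (\<chi> i. g (l * \<gamma> i))"
  have y: "y \<in> simp3"
    using g01(2) rng[OF l(1)] l(2) by (auto simp: y_def simp3_def S_def sum_3)
  have "l \<noteq> 0" using l(2) S0 by auto
  then have "0 < l" using l(1) by simp
  have "fmap T y = l *\<^sub>R c"
  proof -
    have "prof (y$i) = l * \<gamma> i" for i using g01(1)[OF rng[OF l(1)], of i] by (simp add: y_def)
    then show ?thesis unfolding fmap_def assms(3) by (simp add: scaleR_sum_right)
  qed
  then have "smap T y = c" using \<open>0 < l\<close> assms(2) by (simp add: smap_def)
  with y show ?thesis by (rule that)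
qed

section \<open>Supporting planes of the image of the lattice\<close>

definition lattice :: "nat \<Rightarrow> (real^3) set" where
  "lattice n = {p \<in> simp3. \<forall>i. real n * p$i \<in> \<int>}"

lemma lattice_simp3: "p \<in> lattice n \<Longrightarrow> p \<in> simp3"
  by (simp add: lattice_def)

lemma norm_axis_diff: "norm (axis u 1 - axis v 1 :: real^3) \<le> 2"
  using norm_triangle_ineq4[of "axis u 1 :: real^3" "axis v 1"] by simp

text \<open>Two coordinates are rounded down and the third absorbs both errors, so the absolute
  errors add up to at most \<open>4 / n\<close>.\<close>

lemma lattice_dense:
  assumes "0 < n" "y \<in> simp3"
  obtains a where "a \<in> lattice n" "norm (a - y) \<le> 4 / n"
proof -
  define r where "r i = real_of_int \<lfloor>n * y$i\<rfloor> / n" for i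
  have r: "r i \<le> y$i" "y$i \<le> r i + 1 / n" "0 \<le> r i" for i
    using assms(1) simp3_nonneg[OF assms(2), of i] real_of_int_floor_add_one_ge[of "n * y$i"]
    by (simp_all add: r_def divide_le_eq field_simps)
  define a :: "real^3" where "a = vector [r 1, r 2, 1 - r 1 - r 2]"
  have a: "a$1 = r 1" "a$2 = r 2" "a$3 = 1 - r 1 - r 2" by (simp_all add: a_def)
  have y: "y$3 = 1 - y$1 - y$2" "0 \<le> y$3" using assms(2) by (auto simp: simp3_def)
  have "a \<in> simp3"
    unfolding simp3_def mem_Collect_eq forall_3 a using r[of 1] r[of 2] y by linarith
  moreover have "real n * a$i \<in> \<int>" for i
  proof -
    have "real n * r i = of_int \<lfloor>n * y$i\<rfloor>" for i using assms(1) by (simp add: r_def)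
    then have "\<forall>i. real n * a$i \<in> \<int>"
      unfolding forall_3 a by (simp add: right_diff_distrib)
    then show ?thesis by blast
  qed
  ultimately have "a \<in> lattice n" by (simp add: lattice_def)
  moreover have "norm (a - y) \<le> 4 / n"
  proof -
    have "norm (a - y) \<le> (\<Sum>i\<in>UNIV. \<bar>(a - y)$i\<bar>)" by (rule norm_le_l1_cart)
    also have "\<dots> \<le> 4 * (1 / n)"
      unfolding sum_3 using r[of 1] r[of 2] y a by simp
    finally show ?thesis by simp
  qed
  ultimately show ?thesis by (rule that)
qed

text \<open>A nonzero integer vector with coordinate sum \<open>0\<close> has, up to sign, exactly one negative coordinate
  \<open>m\<close>, so it lies in the cone spanned by two neighbouring lattice directions; stepping along one of
  them from either end stays between the end points coordinatewise, hence inside the simplex.\<close>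

lemma lattice_direction:
  assumes "a \<in> lattice n" "b \<in> lattice n" "a \<noteq> b" "0 < n"
  obtains a' b' m u v i j where "{a', b'} = {a, b}" "u \<noteq> m" "v \<noteq> m" "u \<noteq> v"
    "1 \<le> (i::nat)" "real n *\<^sub>R (b' - a') = real i *\<^sub>R (axis u 1 - axis m 1) + real j *\<^sub>R (axis v 1 - axis m 1)"
proof -
  define w where "w = real n *\<^sub>R (b - a)"
  have "w$i \<in> \<int>" for i
  proof -
    have "real n * b$i - real n * a$i \<in> \<int>"
      using assms(1,2) by (intro Ints_diff) (simp_all add: lattice_def)
    then show ?thesis by (simp add: w_def right_diff_distrib)
  qed
  then have k: "w$i = of_int \<lfloor>w$i\<rfloor>" for i by simp
  define k where "k i = \<lfloor>w$i\<rfloor>" for i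
  note k = k[folded k_def]
  have "w$1 + w$2 + w$3 = real n * ((b$1 + b$2 + b$3) - (a$1 + a$2 + a$3))"
    by (simp add: w_def algebra_simps)
  also have "\<dots> = 0" using assms(1,2) by (simp add: lattice_def simp3_def)
  finally have sum0: "k 1 + k 2 + k 3 = 0" unfolding k by linarith
  have "w \<noteq> 0" using assms(3,4) by (simp add: w_def)
  then have "\<not> (k 1 = 0 \<and> k 2 = 0 \<and> k 3 = 0)" by (auto simp: vec_eq_iff forall_3 k)
  \<comment> \<open>Two of the three coordinates have the same weak sign. The remaining index
    becomes \<open>m\<close>, the sign \<open>s\<close> makes the two nonnegative, and
    \<open>u\<close> is one of them that is nonzero.\<close>
  with sum0 have "\<exists>s m u v. (s = 1 \<or> s = -1) \<and> u \<noteq> m \<and> v \<noteq> m \<and> u \<noteq> v \<and> 1 \<le> s * k u \<and> 0 \<le> s * k v \<and> k m = - k u - k v"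
  proof -
    have *: "\<exists>s m u v. (s = 1 \<or> s = -1) \<and> u \<noteq> m \<and> v \<noteq> m \<and> u \<noteq> v \<and> 1 \<le> s * k u \<and> 0 \<le> s * k v \<and> k m = - k u - k v"
      if d: "m \<noteq> u" "m \<noteq> v" "u \<noteq> v" and "k m = - k u - k v" "(0 \<le> k u \<and> 0 \<le> k v) \<or> (k u \<le> 0 \<and> k v \<le> 0)" "k u \<noteq> 0 \<or> k v \<noteq> 0" for m u v
    proof -
      have "\<exists>s. (s = 1 \<or> s = -1) \<and> ((1 \<le> s * k u \<and> 0 \<le> s * k v) \<or> (1 \<le> s * k v \<and> 0 \<le> s * k u))"
      proof (cases "0 \<le> k u \<and> 0 \<le> k v")
        case True
        then show ?thesis using that by (intro exI[of _ 1]) auto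
      next
        case False
        then show ?thesis using that by (intro exI[of _ "-1"]) auto
      qed
      then obtain s where s: "s = 1 \<or> s = -1" "(1 \<le> s * k u \<and> 0 \<le> s * k v) \<or> (1 \<le> s * k v \<and> 0 \<le> s * k u)" by blast
      show ?thesis
      proof (cases "1 \<le> s * k u \<and> 0 \<le> s * k v")
        case True
        show ?thesis by (rule exI[of _ s], rule exI[of _ m], rule exI[of _ u], rule exI[of _ v]) (use True s that in auto)
      next
        case False
        show ?thesis by (rule exI[of _ s], rule exI[of _ m], rule exI[of _ v], rule exI[of _ u]) (use False s that in auto)
      qed
    qed
    have nz: "k 1 \<noteq> 0 \<or> k 2 \<noteq> 0" "k 1 \<noteq> 0 \<or> k 3 \<noteq> 0" "k 2 \<noteq> 0 \<or> k 3 \<noteq> 0"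
      using sum0 \<open>\<not> (k 1 = 0 \<and> k 2 = 0 \<and> k 3 = 0)\<close> by linarith+
    have eq: "k 3 = - k 1 - k 2" "k 2 = - k 1 - k 3" "k 1 = - k 2 - k 3" using sum0 by linarith+
    consider "(0 \<le> k 1 \<and> 0 \<le> k 2) \<or> (k 1 \<le> 0 \<and> k 2 \<le> 0)" | "(0 \<le> k 1 \<and> 0 \<le> k 3) \<or> (k 1 \<le> 0 \<and> k 3 \<le> 0)"
       | "(0 \<le> k 2 \<and> 0 \<le> k 3) \<or> (k 2 \<le> 0 \<and> k 3 \<le> 0)" by linarith
    then show ?thesis
    proof cases
      case 1
      show ?thesis by (rule *[of 3 1 2, OF _ _ _ eq(1) 1 nz(1)]) simp_all
    next
      case 2
      show ?thesis by (rule *[of 2 1 3, OF _ _ _ eq(2) 2 nz(2)]) simp_all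
    next
      case 3
      show ?thesis by (rule *[of 1 2 3, OF _ _ _ eq(3) 3 nz(3)]) simp_all
    qed
  qed
  then obtain s m u v where s: "s = 1 \<or> s = -1" and d: "u \<noteq> m" "v \<noteq> m" "u \<noteq> v"
    and ku: "1 \<le> s * k u" "0 \<le> s * k v" "k m = - k u - k v" by blast
  define a' b' where "a' = (if s = 1 then a else b)" and "b' = (if s = 1 then b else a)"
  have set: "{a', b'} = {a, b}" by (auto simp: a'_def b'_def)
  have "real n *\<^sub>R (b' - a') = of_int s *\<^sub>R w"
    using s by (auto simp: a'_def b'_def w_def algebra_simps)
  also have "\<dots> = real (nat (s * k u)) *\<^sub>R (axis u 1 - axis m 1) + real (nat (s * k v)) *\<^sub>R (axis v 1 - axis m 1)"
  proof -
    have "of_int s * w$q = (real_of_int (s * k u) *\<^sub>R (axis u 1 - axis m 1) + real_of_int (s * k v) *\<^sub>R (axis v 1 - axis m 1) :: real^3)$q" for q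
    proof -
      consider "q = u" | "q = v" | "q = m"
        using distinct_indices[of u v m] d exhaust_3[of q] by auto
      then show ?thesis
      proof cases
        case 3
        have "real_of_int (k m) = - real_of_int (k u) - real_of_int (k v)" using ku(3) by simp
        then show ?thesis using d 3 by (simp add: axis_def k right_diff_distrib)
      qed (use d in \<open>auto simp: axis_def k\<close>)
    qed
    then show ?thesis using ku(1,2) by (simp add: vec_eq_iff)
  qed
  finally show ?thesis
    using set d ku(1) by (intro that[of a' b' u m v "nat (s * k u)" "nat (s * k v)"]) auto
qed

lemma lattice_step:
  assumes "a \<in> lattice n" "b \<in> lattice n" "0 < n" "u \<noteq> m" "v \<noteq> m" "u \<noteq> v" "1 \<le> (i::nat)"
    "real n *\<^sub>R (b - a) = real i *\<^sub>R (axis u 1 - axis m 1) + real j *\<^sub>R (axis v 1 - axis m 1)"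
  defines "e \<equiv> axis u 1 - axis m 1 :: real^3"
  shows "a + (1 / n) *\<^sub>R e \<in> lattice n" "b - (1 / n) *\<^sub>R e \<in> lattice n"
proof -
  note a = assms(1)[unfolded lattice_def simp3_def] and b = assms(2)[unfolded lattice_def simp3_def]
  have w: "real n * b$q - real n * a$q = real i * (axis u 1 - axis m 1 :: real^3)$q + real j * (axis v 1 - axis m 1 :: real^3)$q" for q
    using arg_cong[OF assms(8), of "\<lambda>x. x$q"] by (simp add: right_diff_distrib)
  have e: "e$u = 1" "e$m = -1" "e$v = 0" using assms(4-6) by (auto simp: e_def axis_def)
  have i: "1 \<le> real i" "0 \<le> real j" using assms(7) by auto
  have cases: "q = u \<or> q = m \<or> q = v" for q
    using distinct_indices[of u m v] assms(4-6) exhaust_3[of q] by auto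
  have eint: "e$q \<in> \<int>" for q using cases[of q] e by auto
  have e0: "e$1 + e$2 + e$3 = 0"
  proof -
    have "(u = 1 \<and> m = 2 \<and> v = 3) \<or> (u = 1 \<and> m = 3 \<and> v = 2) \<or> (u = 2 \<and> m = 1 \<and> v = 3)
      \<or> (u = 2 \<and> m = 3 \<and> v = 1) \<or> (u = 3 \<and> m = 1 \<and> v = 2) \<or> (u = 3 \<and> m = 2 \<and> v = 1)"
      using distinct_indices[of u m v] assms(4-6) by blast
    then show ?thesis using e by (elim disjE conjE) simp_all
  qed
  have wu: "real n * b$u - real n * a$u = i" and wm: "real n * b$m - real n * a$m = - i - j"
    using w[of u] w[of m] assms(4-6) by (simp_all add: axis_def)
  have nn: "0 \<le> real n * a$q" "0 \<le> real n * b$q" for q using a b by simp_all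
  have iff: "0 \<le> x \<longleftrightarrow> 0 \<le> real n * x" for x using assms(3) by (simp add: zero_le_mult_iff)
  have "0 \<le> real n * (a + (1 / n) *\<^sub>R e)$q" for q
    using cases[of q] e wu wm nn[of u] nn[of m] nn[of v] i assms(3) by (auto simp: distrib_left)
  then have ra: "0 \<le> (a + (1 / n) *\<^sub>R e)$q" for q using iff by blast
  have "0 \<le> real n * (b - (1 / n) *\<^sub>R e)$q" for q
    using cases[of q] e wu wm nn[of u] nn[of m] nn[of v] i assms(3) by (auto simp: right_diff_distrib distrib_left)
  then have rb: "0 \<le> (b - (1 / n) *\<^sub>R e)$q" for q using iff by blast
  have "real n * (a + (1 / n) *\<^sub>R e)$q = real n * a$q + e$q" "real n * (b - (1 / n) *\<^sub>R e)$q = real n * b$q - e$q" for q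
    using assms(3) by (simp_all add: distrib_left right_diff_distrib)
  then have "real n * (a + (1 / n) *\<^sub>R e)$q \<in> \<int>" "real n * (b - (1 / n) *\<^sub>R e)$q \<in> \<int>" for q
    using a b eint[of q] by auto
  moreover have "(a + (1 / n) *\<^sub>R e)$1 + (a + (1 / n) *\<^sub>R e)$2 + (a + (1 / n) *\<^sub>R e)$3 = 1 + (1 / n) * (e$1 + e$2 + e$3)"
    "(b - (1 / n) *\<^sub>R e)$1 + (b - (1 / n) *\<^sub>R e)$2 + (b - (1 / n) *\<^sub>R e)$3 = 1 - (1 / n) * (e$1 + e$2 + e$3)"
    using a b by (auto simp: distrib_left)
  ultimately show "a + (1 / n) *\<^sub>R e \<in> lattice n" "b - (1 / n) *\<^sub>R e \<in> lattice n"
    using ra rb unfolding lattice_def simp3_def e0 by auto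
qed

text \<open>For unit vectors, the second difference of a sphere-valued map is almost radial: its component along
  the nearby unit vector \<open>c\<close> is the inner product of the two steps, up to lower order terms.\<close>

lemma parallelogram_identity:
  fixes A B R S c :: "'a::real_inner"
  assumes "norm A = 1" "norm B = 1" "norm R = 1" "norm S = 1"
  defines "V \<equiv> A + B - R - S"
  shows "c \<bullet> (R + S - A - B) = (R - A) \<bullet> (S - A) - (norm V)\<^sup>2 / 2 + V \<bullet> (B - c)"
proof -
  have n: "A \<bullet> A = 1" "B \<bullet> B = 1" "R \<bullet> R = 1" "S \<bullet> S = 1"
    using assms(1-4) by (simp_all add: norm_eq_sqrt_inner)
  have "2 * (c \<bullet> (R + S - A - B)) = 2 * ((R - A) \<bullet> (S - A)) - V \<bullet> V + 2 * (V \<bullet> (B - c))"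
    unfolding V_def
    by (simp add: inner_add_left inner_add_right inner_diff_left inner_diff_right n inner_commute)
  then show ?thesis unfolding power2_norm_eq_inner by simp
qed

text \<open>Every error term is at most \<open>K\<^sup>2 * t * (x * y)\<close>, with total weight
  below 6, so the inner product of the first-order steps decides the sign. Consequently
  \<open>A\<close> and \<open>B\<close> cannot both be maximisers over a set that contains
  \<open>R\<close> and \<open>S\<close>.\<close>

lemma parallelogram_gain:
  fixes A B R S c d1 d2 :: "'a::real_inner"
  assumes unit: "norm A = 1" "norm B = 1" "norm R = 1" "norm S = 1"
    and V: "norm (B - R - S + A) \<le> K * x * y"
    and R: "norm (R - A - d1) \<le> K * x\<^sup>2" "norm d1 \<le> K * x"
    and S: "norm (S - A - d2) \<le> K * y\<^sup>2" "norm d2 \<le> K * y"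
    and c: "norm (B - c) \<le> K * t"
    and t: "0 \<le> x" "x \<le> t" "0 \<le> y" "y \<le> t" "t \<le> 1" "1 \<le> K"
    and d: "6 * K\<^sup>2 * t * (x * y) < d1 \<bullet> d2"
  shows "c \<bullet> A + c \<bullet> B < c \<bullet> R + c \<bullet> S"
proof -
  define V where "V = A + B - R - S"
  define p q where "p = R - A - d1" and "q = S - A - d2"
  have K2: "K \<le> K\<^sup>2" "0 \<le> K\<^sup>2" "0 \<le> K" using t(6) by (auto simp: power2_eq_square mult_left_mono)
  have xy: "0 \<le> x * y" "0 \<le> t" using t by auto
  have Vn: "norm V \<le> K * x * y" using V by (simp add: V_def algebra_simps)
  have "(R - A) \<bullet> (S - A) = (d1 + p) \<bullet> (d2 + q)" by (simp add: p_def q_def)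
  also have "\<dots> = d1 \<bullet> d2 + d1 \<bullet> q + p \<bullet> d2 + p \<bullet> q" by (simp add: inner_add_left inner_add_right)
  also have "\<dots> \<ge> d1 \<bullet> d2 - norm d1 * norm q - norm p * norm d2 - norm p * norm q"
    using Cauchy_Schwarz_ineq2[of d1 q] Cauchy_Schwarz_ineq2[of p d2] Cauchy_Schwarz_ineq2[of p q]
    by linarith
  finally have 1: "(R - A) \<bullet> (S - A) \<ge> d1 \<bullet> d2 - norm d1 * norm q - norm p * norm d2 - norm p * norm q" .
  have "norm d1 * norm q \<le> (K * x) * (K * y\<^sup>2)" using R S t unfolding q_def by (intro mult_mono) auto
  also have "\<dots> = K\<^sup>2 * (x * y) * y" by (simp add: power2_eq_square)
  also have "\<dots> \<le> K\<^sup>2 * (x * y) * t" using t K2 xy by (intro mult_left_mono) auto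
  finally have 2: "norm d1 * norm q \<le> K\<^sup>2 * (x * y) * t" .
  have "norm p * norm d2 \<le> (K * x\<^sup>2) * (K * y)" using R S t unfolding p_def by (intro mult_mono) auto
  also have "\<dots> = K\<^sup>2 * (x * y) * x" by (simp add: power2_eq_square)
  also have "\<dots> \<le> K\<^sup>2 * (x * y) * t" using t K2 xy by (intro mult_left_mono) auto
  finally have 3: "norm p * norm d2 \<le> K\<^sup>2 * (x * y) * t" .
  have "norm p * norm q \<le> (K * x\<^sup>2) * (K * y\<^sup>2)" using R S t unfolding p_def q_def by (intro mult_mono) auto
  also have "\<dots> = K\<^sup>2 * (x * y) * (x * y)" by (simp add: power2_eq_square)
  also have "\<dots> \<le> K\<^sup>2 * (x * y) * (t * 1)" using t K2 xy by (intro mult_left_mono mult_mono) auto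
  finally have 4: "norm p * norm q \<le> K\<^sup>2 * (x * y) * t" by simp
  have "(norm V)\<^sup>2 \<le> (K * x * y)\<^sup>2" using Vn by (intro power_mono) auto
  also have "\<dots> = K\<^sup>2 * (x * y) * (x * y)" by (simp add: power2_eq_square)
  also have "\<dots> \<le> K\<^sup>2 * (x * y) * (t * 1)" using t K2 xy by (intro mult_left_mono mult_mono) auto
  finally have 5: "(norm V)\<^sup>2 \<le> K\<^sup>2 * (x * y) * t" by simp
  have "\<bar>V \<bullet> (B - c)\<bar> \<le> norm V * norm (B - c)" by (rule Cauchy_Schwarz_ineq2)
  also have "\<dots> \<le> (K * x * y) * (K * t)" using Vn c t K2 by (intro mult_mono) auto
  also have "\<dots> = K\<^sup>2 * (x * y) * t" by (simp add: power2_eq_square)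
  finally have 6: "V \<bullet> (B - c) \<ge> - (K\<^sup>2 * (x * y) * t)" by linarith
  have "0 \<le> K\<^sup>2 * (x * y) * t" using K2 xy by simp
  moreover have "6 * (K\<^sup>2 * (x * y) * t) < d1 \<bullet> d2" using d by (simp add: mult_ac)
  ultimately have "0 < (R - A) \<bullet> (S - A) - (norm V)\<^sup>2 / 2 + V \<bullet> (B - c)"
    using 1 2 3 4 5 6 by linarith
  then show ?thesis
    using parallelogram_identity[OF unit, of c] unfolding V_def by (simp add: inner_add_right inner_diff_right)
qed

lemma maximiser_near:
  fixes c A A' :: "'a::real_inner"
  assumes "norm A = 1" "norm A' = 1" "norm c = 1" "c \<bullet> A' \<le> c \<bullet> A"
  shows "dist A c \<le> dist A' c"
proof -
  have *: "(dist x c)\<^sup>2 = 2 - 2 * (c \<bullet> x)" if "norm x = 1" for x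
    using that assms(3)
    by (simp add: dist_norm power2_norm_eq_inner inner_diff_left inner_diff_right inner_commute norm_eq_1)
  have "(dist A c)\<^sup>2 \<le> (dist A' c)\<^sup>2" unfolding *[OF assms(1)] *[OF assms(2)] using assms(4) by simp
  then show ?thesis by (rule power2_le_imp_le) simp
qed

text \<open>The difference of two non-adjacent maximisers splits into one lattice step
  \<open>v1\<close> and a rest \<open>v2\<close> in the cone of two neighbouring directions. By
  \<open>acute\<close>, \<open>parallelogram_gain\<close> applies to the parallelogram they span,
  whose other corners are lattice points too: a contradiction. The errors are small because every
  maximiser is close to the point \<open>y\<close> with image \<open>c\<close>.\<close>

lemma support_adjacent:
  assumes tri: "tri T"
  obtains N where "\<And>n c \<gamma> a b. N \<le> n \<Longrightarrow> norm c = 1 \<Longrightarrow> c = (\<Sum>i\<in>UNIV. \<gamma> i *\<^sub>R T$i) \<Longrightarrow> (\<And>i. 0 \<le> \<gamma> i) \<Longrightarrow>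
    a \<in> lattice n \<Longrightarrow> b \<in> lattice n \<Longrightarrow> (\<And>x. x \<in> lattice n \<Longrightarrow> c \<bullet> smap T x \<le> c \<bullet> smap T a) \<Longrightarrow>
    (\<And>x. x \<in> lattice n \<Longrightarrow> c \<bullet> smap T x \<le> c \<bullet> smap T b) \<Longrightarrow> a \<noteq> b \<Longrightarrow>
    \<exists>u v. u \<noteq> v \<and> real n *\<^sub>R (b - a) = axis u 1 - axis v 1"
proof -
  show ?thesis
  proof (rule smap_estimates[OF tri])
  fix K assume K: "1 \<le> K"
    "\<And>p v. p \<in> simp3 \<Longrightarrow> norm (sder T p v) \<le> K * norm v"
    "\<And>p v. p \<in> simp3 \<Longrightarrow> p + v \<in> simp3 \<Longrightarrow> norm (smap T (p + v) - smap T p) \<le> K * norm v"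
    "\<And>p v. p \<in> simp3 \<Longrightarrow> p + v \<in> simp3 \<Longrightarrow> norm (smap T (p + v) - smap T p - sder T p v) \<le> K * (norm v)\<^sup>2"
    "\<And>p v w. p \<in> simp3 \<Longrightarrow> p + v \<in> simp3 \<Longrightarrow> p + w \<in> simp3 \<Longrightarrow> p + v + w \<in> simp3 \<Longrightarrow>
       norm (smap T (p + v + w) - smap T (p + v) - smap T (p + w) + smap T p) \<le> K * norm v * norm w"
  define \<kappa> where "\<kappa> = sig\<^sup>2 * ((sqrt 5 - 1) / 4)"
  have \<kappa>: "0 < \<kappa>" "\<kappa> \<le> sig\<^sup>2"
  proof -
    have "0 < (sqrt 5 - 1) / (4::real)" "(sqrt 5 - 1) / 4 \<le> (1::real)" using sqrt5_bounds by simp_all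
    then show "0 < \<kappa>" "\<kappa> \<le> sig\<^sup>2" unfolding \<kappa>_def using sig_pos by (simp_all add: mult_left_le)
  qed
  \<comment> \<open>What is needed is \<open>24 * K\<^sup>2 * t < \<kappa>\<close>: the factor 6 of
    \<open>parallelogram_gain\<close> times the bound 2 on the norms of both edge directions. The 30
    makes it strict.\<close>
  define t where "t = min 1 (\<kappa> / (30 * K\<^sup>2))"
  have K2: "0 < K\<^sup>2" using K(1) by simp
  have t: "0 < t" "t \<le> 1" "24 * K\<^sup>2 * t < \<kappa>"
  proof -
    show "0 < t" "t \<le> 1" using \<kappa>(1) K2 by (auto simp: t_def)
    have "24 * K\<^sup>2 * t \<le> 24 * K\<^sup>2 * (\<kappa> / (30 * K\<^sup>2))" using K2 by (intro mult_left_mono) (auto simp: t_def)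
    also have "\<dots> = 24 / 30 * \<kappa>" using K2 by (simp add: field_simps)
    also have "\<dots> < \<kappa>" using \<kappa>(1) by simp
    finally show "24 * K\<^sup>2 * t < \<kappa>" .
  qed
  \<comment> \<open>Two maximisers within \<open>t / 4\<close> of \<open>y\<close> differ by less
    than \<open>t / 2\<close>, and the single step costs at most another \<open>t / 4\<close>, which
    keeps \<open>v2\<close> below \<open>t\<close>.\<close>
  have "0 < t / 4" using t(1) by simp
  then show ?thesis
  proof (rule smap_uniformly_injective[OF tri])
  fix \<eta> assume \<eta>: "0 < \<eta>"
    "\<And>x y. x \<in> simp3 \<Longrightarrow> y \<in> simp3 \<Longrightarrow> dist (smap T x) (smap T y) < \<eta> \<Longrightarrow> dist x y < t / 4"
  obtain N :: nat where N: "0 < N" "4 * K / N < \<eta>" "2 / N < t / 4"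
  proof -
    obtain N1 :: nat where "4 * K / \<eta> < N1" using reals_Archimedean2 by blast
    moreover obtain N2 :: nat where "8 / t < N2" using reals_Archimedean2 by blast
    ultimately have "4 * K / \<eta> < real (N1 + N2 + 1)" "8 / t < real (N1 + N2 + 1)" by linarith+
    then have "4 * K < real (N1 + N2 + 1) * \<eta>" "8 < real (N1 + N2 + 1) * t"
      using \<eta>(1) t(1) by (simp_all only: pos_divide_less_eq)
    then show ?thesis
      by (intro that[of "N1 + N2 + 1"]) (simp_all only: pos_divide_less_eq of_nat_0_less_iff add_gr_0 zero_less_one simp_thms, simp_all add: mult.commute)
  qed
  show ?thesis
  proof (rule that[of N])
    fix n c \<gamma> a b
    assume n: "N \<le> n" and c: "norm c = 1" "c = (\<Sum>i\<in>UNIV. \<gamma> i *\<^sub>R T$i)" "\<And>i. 0 \<le> \<gamma> i"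
      and ab: "a \<in> lattice n" "b \<in> lattice n"
      and amax: "\<And>x. x \<in> lattice n \<Longrightarrow> c \<bullet> smap T x \<le> c \<bullet> smap T a"
      and bmax: "\<And>x. x \<in> lattice n \<Longrightarrow> c \<bullet> smap T x \<le> c \<bullet> smap T b" and "a \<noteq> b"
    have n0: "0 < n" and nN: "4 * K / n < \<eta>" "2 / n < t / 4"
    proof -
      show "0 < n" using n N(1) by simp
      have "4 * K / n \<le> 4 * K / N" "2 / n \<le> 2 / N"
        using n N(1) K(1) by (simp_all add: divide_left_mono)
      then show "4 * K / n < \<eta>" "2 / n < t / 4" using N by linarith+
    qed
    obtain y where y: "y \<in> simp3" "smap T y = c" by (rule smap_surjective[OF tri c]) (rule that; assumption)
    obtain a0 where a0: "a0 \<in> lattice n" "norm (a0 - y) \<le> 4 / n" by (rule lattice_dense[OF n0 y(1)]) (rule that; assumption)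
    have "dist (smap T a0) c \<le> K * norm (a0 - y)"
      using K(3)[of y "a0 - y"] y lattice_simp3[OF a0(1)] by (simp add: dist_norm)
    also have "\<dots> \<le> K * (4 / n)" using a0(2) K(1) by (intro mult_left_mono) auto
    also have "\<dots> < \<eta>" using nN by (simp add: mult.commute)
    finally have a0c: "dist (smap T a0) c < \<eta>" .
    have near: "dist z y < t / 4" if "z \<in> lattice n" "\<And>x. x \<in> lattice n \<Longrightarrow> c \<bullet> smap T x \<le> c \<bullet> smap T z" for z
    proof -
      have "dist (smap T z) c \<le> dist (smap T a0) c"
        using that(2)[OF a0(1)] by (intro maximiser_near norm_smap[OF tri] lattice_simp3[OF that(1)] lattice_simp3[OF a0(1)] c(1))
      then show ?thesis using \<eta>(2)[OF lattice_simp3[OF that(1)] y(1)] a0c y(2) by simp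
    qed
    obtain a' b' m u v i j where dir: "{a', b'} = {a, b}" "u \<noteq> m" "v \<noteq> m" "u \<noteq> v"
      "1 \<le> (i::nat)" "real n *\<^sub>R (b' - a') = real i *\<^sub>R (axis u 1 - axis m 1) + real j *\<^sub>R (axis v 1 - axis m 1)"
      by (rule lattice_direction[OF ab \<open>a \<noteq> b\<close> n0]) (rule that; assumption)
    have ab': "(a' = a \<and> b' = b) \<or> (a' = b \<and> b' = a)"
      using dir(1) by (auto simp: doubleton_eq_iff)
    have L: "a' \<in> lattice n" "b' \<in> lattice n" using ab' ab by auto
    have mx: "c \<bullet> smap T x \<le> c \<bullet> smap T a'" "c \<bullet> smap T x \<le> c \<bullet> smap T b'" if "x \<in> lattice n" for x
      using ab' amax[OF that] bmax[OF that] by auto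
    define e1 e2 :: "real^3" where "e1 = axis u 1 - axis m 1" and "e2 = axis v 1 - axis m 1"
    show "\<exists>u v. u \<noteq> v \<and> real n *\<^sub>R (b - a) = axis u 1 - axis v 1"
    proof (cases "i + j = 1")
      case True
      then have "i = 1" "j = 0" using dir(5) by auto
      then have "real n *\<^sub>R (b' - a') = axis u 1 - axis m 1" using dir(6) by simp
      moreover have "real n *\<^sub>R (a' - b') = - (real n *\<^sub>R (b' - a'))" by (simp add: algebra_simps)
      ultimately have "real n *\<^sub>R (b - a) = axis u 1 - axis m 1 \<or> real n *\<^sub>R (b - a) = axis m 1 - axis u 1"
        using ab' by auto
      then show ?thesis using dir(2) by (elim disjE) (rule exI[of _ u], rule exI[of _ m], simp, rule exI[of _ m], rule exI[of _ u], simp)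
    next
      case False
      define M where "M = real (i - 1 + j)"
      have M: "1 \<le> M" using False dir(5) by (simp add: M_def)
      define h where "h = 1 / real n"
      have h: "0 < h" "h \<le> t / 8" using n0 nN by (simp_all add: h_def)
      define v1 v2 where "v1 = h *\<^sub>R e1" and "v2 = h *\<^sub>R (real (i - 1) *\<^sub>R e1 + real j *\<^sub>R e2)"
      have "b' - a' = h *\<^sub>R (real n *\<^sub>R (b' - a'))" using n0 by (simp add: h_def)
      also have "\<dots> = h *\<^sub>R (real i *\<^sub>R e1 + real j *\<^sub>R e2)" by (simp add: dir(6) e1_def e2_def)
      also have "real i = 1 + real (i - 1)" using dir(5) by simp
      finally have b': "b' = a' + v1 + v2" by (simp add: v1_def v2_def algebra_simps)
      have "a' + (1 / n) *\<^sub>R e1 \<in> lattice n" "b' - (1 / n) *\<^sub>R e1 \<in> lattice n"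
        using lattice_step[OF L n0 dir(2-6)] by (simp_all add: e1_def)
      then have RL: "a' + v1 \<in> lattice n" "a' + v2 \<in> lattice n"
        by (simp_all add: v1_def h_def b')
      note in3 = RL[THEN lattice_simp3] L[THEN lattice_simp3]
      have ne: "norm e1 \<le> 2" "norm e2 \<le> 2" unfolding e1_def e2_def by (rule norm_axis_diff)+
      have x: "norm v1 \<le> 2 * h" using ne h(1) by (simp add: v1_def)
      have y': "norm v2 \<le> 2 * h * M"
      proof -
        have "norm (real (i - 1) *\<^sub>R e1 + real j *\<^sub>R e2) \<le> real (i - 1) * norm e1 + real j * norm e2"
          by (rule order_trans[OF norm_triangle_ineq]) simp
        also have "\<dots> \<le> real (i - 1) * 2 + real j * 2" using ne by (intro add_mono mult_left_mono) auto
        also have "\<dots> = 2 * M" by (simp add: M_def)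
        finally show ?thesis using h(1) by (simp add: v2_def)
      qed
      have nab: "dist a' y < t / 4" "dist b' y < t / 4" using near L mx by blast+
      have "norm (b' - a') < t / 2"
        using nab dist_triangle2[of b' a' y] by (simp add: dist_norm)
      moreover have "norm v2 = norm (b' - a' - v1)" by (simp add: b')
      ultimately have "norm v2 \<le> t / 2 + norm v1" using norm_triangle_ineq4[of "b' - a'" v1] by linarith
      then have vt: "norm v1 \<le> t" "norm v2 \<le> t" using x h t(1) by linarith+
      have "c \<bullet> smap T a' + c \<bullet> smap T b' < c \<bullet> smap T (a' + v1) + c \<bullet> smap T (a' + v2)"
      proof (rule parallelogram_gain[where K = K and x = "norm v1" and y = "norm v2" and t = t
            and ?d1.0 = "sder T a' v1" and ?d2.0 = "sder T a' v2"])
        show "norm (smap T b' - smap T (a' + v1) - smap T (a' + v2) + smap T a') \<le> K * norm v1 * norm v2"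
          using K(5)[of a' v1 v2] in3 b' by simp
        have "norm (smap T b' - c) \<le> K * norm (b' - y)"
          using K(3)[of y "b' - y"] y in3 by simp
        also have "\<dots> \<le> K * t" using nab t(1) K(1) by (intro mult_left_mono) (auto simp: dist_norm)
        finally show "norm (smap T b' - c) \<le> K * t" .
        interpret linear "sder T a'" by (rule linear_sder)
        have "sder T a' e1 \<bullet> sder T a' e1 = (norm (sder T a' e1))\<^sup>2" by (simp add: power2_norm_eq_inner)
        also have "\<dots> \<ge> sig\<^sup>2"
          using speed(1)[OF tri in3(3) dir(2)] sig_pos unfolding e1_def by (intro power_mono) auto
        finally have d11: "\<kappa> \<le> sder T a' e1 \<bullet> sder T a' e1" using \<kappa>(2) by linarith
        have d12: "\<kappa> \<le> sder T a' e1 \<bullet> sder T a' e2"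
          unfolding e1_def e2_def \<kappa>_def by (rule acute[OF tri in3(3) dir(2,3,4)])
        have "sder T a' v1 \<bullet> sder T a' v2 = h * h * (real (i - 1) * (sder T a' e1 \<bullet> sder T a' e1) + real j * (sder T a' e1 \<bullet> sder T a' e2))"
          by (simp add: v1_def v2_def scale add inner_add_right algebra_simps)
        also have "\<dots> \<ge> h * h * (real (i - 1) * \<kappa> + real j * \<kappa>)"
          using d11 d12 h(1) by (intro mult_left_mono add_mono) auto
        finally have low: "h * h * (M * \<kappa>) \<le> sder T a' v1 \<bullet> sder T a' v2"
          by (simp add: M_def algebra_simps)
        have "norm v1 * norm v2 \<le> (2 * h) * (2 * h * M)" using x y' h(1) by (intro mult_mono) auto
        then have "6 * K\<^sup>2 * t * (norm v1 * norm v2) \<le> 6 * K\<^sup>2 * t * ((2 * h) * (2 * h * M))"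
          using K2 t(1) by (intro mult_left_mono) auto
        also have "\<dots> = (h * h * M) * (24 * K\<^sup>2 * t)" by simp
        also have "\<dots> < (h * h * M) * \<kappa>" using t(3) h(1) M by (intro mult_strict_left_mono) auto
        finally show "6 * K\<^sup>2 * t * (norm v1 * norm v2) < sder T a' v1 \<bullet> sder T a' v2"
          using low by (simp add: mult_ac)
        show "norm (smap T (a' + v1) - smap T a' - sder T a' v1) \<le> K * (norm v1)\<^sup>2"
          "norm (smap T (a' + v2) - smap T a' - sder T a' v2) \<le> K * (norm v2)\<^sup>2"
          "norm (sder T a' v1) \<le> K * norm v1" "norm (sder T a' v2) \<le> K * norm v2"
          by (intro K(2) K(4) in3)+
        show "norm (smap T a') = 1" "norm (smap T b') = 1" "norm (smap T (a' + v1)) = 1" "norm (smap T (a' + v2)) = 1"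
          by (intro norm_smap[OF tri] in3)+
      qed (use K(1) vt t in auto)
      then show ?thesis using mx(1)[OF RL(1)] mx(2)[OF RL(2)] by linarith
    qed
  qed
qed
qed
qed

lemma edge_length_upper:
  assumes "tri T" "0 < n" "a \<in> lattice n" "b \<in> lattice n" "u \<noteq> v" "real n *\<^sub>R (b - a) = axis u 1 - axis v 1"
  shows "dist (smap T a) (smap T b) \<le> ratio_bound * sig / n"
proof -
  have ba: "b - a = (1 / n) *\<^sub>R (axis u 1 - axis v 1)"
    using assms(2) unfolding assms(6)[symmetric] by simp
  have in3: "a \<in> simp3" "a + (b - a) \<in> simp3" using assms(3,4) by (auto dest: lattice_simp3)
  have "norm (smap T (a + 1 *\<^sub>R (b - a)) - smap T (a + 0 *\<^sub>R (b - a))) \<le> ratio_bound * sig / n"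
  proof (rule path_bound[OF smap_has_vector_derivative[OF assms(1)]])
    fix t :: real assume t: "0 \<le> t" "t \<le> 1"
    define q where "q = a + t *\<^sub>R (b - a)"
    show in': "a + t *\<^sub>R (b - a) \<in> simp3" using simp3_segment[OF in3 t] .
    interpret linear "sder T q" by (rule linear_sder)
    have "norm (sder T q (b - a)) \<le> ratio_bound * sig / n"
      using speed(2)[OF assms(1) in'[folded q_def] assms(5)] assms(2) unfolding ba
      by (simp add: scale divide_right_mono)
    then show "norm (sder T (a + t *\<^sub>R (b - a)) (b - a)) \<le> ratio_bound * sig / n" by (simp only: q_def)
  qed
  then show ?thesis by (simp add: dist_norm norm_minus_commute)
qed

text \<open>A chord can be shorter than the curve above it, so a lower bound on the speed is not
  enough; the second-order estimate for \<open>smap\<close> compares chord and tangent at the price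
  of \<open>C / n\<close>.\<close>

lemma edge_length_lower:
  assumes "tri T"
  obtains C where "0 \<le> C" "\<And>n a b u v. 0 < n \<Longrightarrow> a \<in> lattice n \<Longrightarrow> b \<in> lattice n \<Longrightarrow> u \<noteq> v \<Longrightarrow>
    real n *\<^sub>R (b - a) = axis u 1 - axis v 1 \<Longrightarrow> (sig - C / n) / n \<le> dist (smap T a) (smap T b)"
proof -
  obtain K where K: "1 \<le> K"
    "\<And>p v. p \<in> simp3 \<Longrightarrow> p + v \<in> simp3 \<Longrightarrow> norm (smap T (p + v) - smap T p - sder T p v) \<le> K * (norm v)\<^sup>2"
    by (rule smap_estimates[OF assms]) iprover
  show ?thesis
  proof (rule that[of "4 * K"])
    fix n a b u v
    assume h: "0 < n" "a \<in> lattice n" "b \<in> lattice n" "u \<noteq> v" "real n *\<^sub>R (b - a) = axis u 1 - axis v 1"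
    have ba: "b - a = (1 / n) *\<^sub>R (axis u 1 - axis v 1)" using h(1) unfolding h(5)[symmetric] by simp
    have nb: "norm (b - a) \<le> 2 / n"
      unfolding ba using norm_axis_diff[of u v] h(1) by (simp add: divide_right_mono)
    have in3: "a \<in> simp3" "a + (b - a) \<in> simp3" using h(2,3) by (auto dest: lattice_simp3)
    interpret linear "sder T a" by (rule linear_sder)
    have "sig / n \<le> norm (sder T a (b - a))"
      using speed(1)[OF assms in3(1) h(4)] h(1) by (simp add: ba scale divide_right_mono)
    also have "\<dots> \<le> norm (smap T b - smap T a) + norm (smap T b - smap T a - sder T a (b - a))"
      using norm_triangle_ineq4[of "smap T b - smap T a" "smap T b - smap T a - sder T a (b - a)"] by simp
    also have "norm (smap T b - smap T a - sder T a (b - a)) \<le> K * (norm (b - a))\<^sup>2"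
      using K(2)[OF in3] by simp
    also have "K * (norm (b - a))\<^sup>2 \<le> K * (2 / n)\<^sup>2"
      using nb K(1) by (intro mult_left_mono power_mono) auto
    finally have "sig / n \<le> dist (smap T a) (smap T b) + K * (2 / n)\<^sup>2"
      by (simp add: dist_norm norm_minus_commute)
    moreover have "(sig - 4 * K / n) / n = sig / n - K * (2 / n)\<^sup>2"
      by (simp add: power2_eq_square diff_divide_distrib)
    ultimately show "(sig - 4 * K / n) / n \<le> dist (smap T a) (smap T b)" by linarith
  qed (use K in simp)
qed

section \<open>Exact vector arithmetic for the icosahedron\<close>

type_synonym zvec = "zq \<times> zq \<times> zq"

definition zdot :: "zvec \<Rightarrow> zvec \<Rightarrow> zq" where
  "zdot u v = (case u of (a, b, c) \<Rightarrow> case v of (x, y, z) \<Rightarrow> zadd (zmul a x) (zadd (zmul b y) (zmul c z)))"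

definition zvadd :: "zvec \<Rightarrow> zvec \<Rightarrow> zvec" where
  "zvadd u v = (case u of (a, b, c) \<Rightarrow> case v of (x, y, z) \<Rightarrow> (zadd a x, zadd b y, zadd c z))"

definition zvscale :: "zq \<Rightarrow> zvec \<Rightarrow> zvec" where
  "zvscale s v = (case v of (x, y, z) \<Rightarrow> (zmul s x, zmul s y, zmul s z))"

definition vvec :: "zvec \<Rightarrow> real^3" where
  "vvec v = (case v of (x, y, z) \<Rightarrow> vector [zval x, zval y, zval z])"

lemma vvec_dot: "vvec u \<bullet> vvec v = zval (zdot u v)"
  by (simp add: vvec_def zdot_def inner_vec_def sum_3 zval_add zval_mul split: prod.split)

lemma vvec_add: "vvec (zvadd u v) = vvec u + vvec v"
  by (cases u rule: prod_cases3; cases v rule: prod_cases3; simp add: vvec_def zvadd_def vec_eq_iff forall_3 zval_add)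

lemma vvec_scale: "vvec (zvscale s v) = zval s *\<^sub>R vvec v"
  by (cases v rule: prod_cases3; simp add: vvec_def zvscale_def vec_eq_iff forall_3 zval_mul)

section \<open>The regular icosahedron\<close>

text \<open>Twice the cyclic permutations of \<open>(0, \<plusminus>1, \<plusminus>\<phi>)\<close>, where \<open>\<phi>\<close> is the golden ratio.\<close>

definition icoz :: "zvec list" where
  "icoz = [((0,0),(2,0),(1,1)), ((0,0),(2,0),(-1,-1)), ((0,0),(-2,0),(1,1)), ((0,0),(-2,0),(-1,-1)),
    ((2,0),(1,1),(0,0)), ((2,0),(-1,-1),(0,0)), ((-2,0),(1,1),(0,0)), ((-2,0),(-1,-1),(0,0)),
    ((1,1),(0,0),(2,0)), ((-1,-1),(0,0),(2,0)), ((1,1),(0,0),(-2,0)), ((-1,-1),(0,0),(-2,0))]"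

text \<open>In these coordinates \<open>10 + 2 * sqrt 5\<close> is the squared circumradius. The
  four values belong to equal vertices, neighbours, vertices two edges apart, and antipodes.\<close>

lemma icoz_products:
  "list_all (\<lambda>u. list_all (\<lambda>v. let d = zdot u v in
     if u = v then d = (10, 2) else d = (2, 2) \<or> d = (-2, -2) \<or> d = (-10, -2)) icoz) icoz"
  by code_simp

text \<open>For a face \<open>u\<close>, \<open>v\<close>, \<open>w\<close>, the vector
  \<open>x\<close> is the antipode of the vertex across the edge \<open>u\<close>, \<open>v\<close>
  from \<open>w\<close>. Doubling clears the denominator of \<open>(1 - sqrt 5) / 2\<close>.\<close>

lemma icoz_opposite:
  "list_all (\<lambda>u. list_all (\<lambda>v. zdot u v = (2, 2) \<longrightarrow> list_all (\<lambda>w. zdot u w = (2, 2) \<longrightarrow> zdot v w = (2, 2) \<longrightarrow>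
     (let r = zvadd (zvscale (2, 0) w) (zvscale (1, -1) (zvadd u v)) in
       list_ex (\<lambda>x. zvscale (2, 0) x = r) icoz)) icoz) icoz) icoz"
  by code_simp

lemma icoz_uminus: "list_all (\<lambda>u. list_ex (\<lambda>v. v = zvscale (-1, 0) u) icoz) icoz"
  by code_simp

definition ico :: "(real^3) set" where
  "ico = (\<lambda>v. inverse (sqrt (10 + 2 * sqrt 5)) *\<^sub>R vvec v) ` set icoz"

definition cosedge :: real where
  "cosedge = 1 / sqrt 5"

lemma cosedge_sqrt5: "cosedge * sqrt 5 = 1" "sqrt 5 * cosedge = 1"
  by (simp_all add: cosedge_def)

lemma sqrt5_eq: "sqrt 5 = 5 * cosedge"
proof -
  have "5 * cosedge = (sqrt 5 * sqrt 5) * cosedge" by simp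
  also have "\<dots> = sqrt 5 * (cosedge * sqrt 5)" by (simp only: mult_ac)
  finally show ?thesis by (simp add: cosedge_sqrt5)
qed

lemma cosedge_sq: "5 * cosedge * cosedge = 1"
  using cosedge_sqrt5(1) unfolding sqrt5_eq by simp

lemma cosedge_bounds: "0.447 < cosedge" "cosedge < 0.448"
  using sqrt5_bounds unfolding sqrt5_eq by simp_all

lemma ico_scale:
  fixes x y :: "real^3"
  shows "(inverse (sqrt (10 + 2 * sqrt 5)) *\<^sub>R x) \<bullet> (inverse (sqrt (10 + 2 * sqrt 5)) *\<^sub>R y)
    = (x \<bullet> y) / (10 + 2 * sqrt 5)"
proof -
  have "0 < 10 + 2 * sqrt (5::real)" by (simp add: add_pos_pos)
  then show ?thesis by (simp add: field_simps)
qed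

text \<open>The first part encodes that the vertices are unit vectors: \<open>ico_norm\<close> reads
  it off at \<open>y = x\<close>.\<close>

lemma ico_products:
  assumes "x \<in> ico" "y \<in> ico"
  shows "x \<bullet> y = (if x = y then 1 else x \<bullet> y)" "x \<noteq> y \<Longrightarrow> x \<bullet> y = cosedge \<or> x \<bullet> y = - cosedge \<or> x \<bullet> y = -1"
proof -
  obtain u where u: "u \<in> set icoz" "x = inverse (sqrt (10 + 2 * sqrt 5)) *\<^sub>R vvec u" using assms(1) by (auto simp: ico_def)
  obtain v where v: "v \<in> set icoz" "y = inverse (sqrt (10 + 2 * sqrt 5)) *\<^sub>R vvec v" using assms(2) by (auto simp: ico_def)
  have p: "if u = v then zdot u v = (10, 2) else zdot u v = (2, 2) \<or> zdot u v = (-2, -2) \<or> zdot u v = (-10, -2)"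
    using icoz_products u(1) v(1) unfolding list_all_iff Let_def by blast
  have pos: "0 < 10 + 2 * sqrt (5::real)" by (simp add: add_pos_pos)
  have xy: "x \<bullet> y = zval (zdot u v) / (10 + 2 * sqrt 5)"
    unfolding u(2) v(2) ico_scale vvec_dot ..
  have e: "(2 + 2 * sqrt 5) / (10 + 2 * sqrt 5) = cosedge"
    unfolding cosedge_def using pos by (simp add: field_simps)
  have xx: "x \<bullet> x = 1"
  proof -
    have "zdot u u = (10, 2)" using icoz_products u(1) unfolding list_all_iff Let_def by (metis (full_types))
    then show ?thesis unfolding u(2) ico_scale vvec_dot using pos by (simp add: zval_def algebra_simps)
  qed
  then show "x \<bullet> y = (if x = y then 1 else x \<bullet> y)" by auto
  assume "x \<noteq> y"
  then have "u \<noteq> v" using u v by auto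
  then have "zdot u v = (2, 2) \<or> zdot u v = (-2, -2) \<or> zdot u v = (-10, -2)" using p by simp
  then show "x \<bullet> y = cosedge \<or> x \<bullet> y = - cosedge \<or> x \<bullet> y = -1"
  proof (elim disjE)
    assume "zdot u v = (2, 2)"
    then have "x \<bullet> y = (2 + 2 * sqrt 5) / (10 + 2 * sqrt 5)" unfolding xy by (simp add: zval_def)
    then show ?thesis unfolding e by simp
  next
    assume "zdot u v = (-2, -2)"
    then have "x \<bullet> y = - ((2 + 2 * sqrt 5) / (10 + 2 * sqrt 5))" unfolding xy
      by (simp add: zval_def minus_divide_left)
    then show ?thesis unfolding e by simp
  next
    assume "zdot u v = (-10, -2)"
    then have "x \<bullet> y = - 1" unfolding xy using pos by (simp add: zval_def divide_eq_eq)
    then show ?thesis by simp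
  qed
qed

lemma ico_norm: "x \<in> ico \<Longrightarrow> norm x = 1"
  using ico_products(1)[of x x] by (simp add: norm_eq_1)

lemma ico_zdot_iff:
  assumes "u \<in> set icoz" "v \<in> set icoz"
  shows "(inverse (sqrt (10 + 2 * sqrt 5)) *\<^sub>R vvec u) \<bullet> (inverse (sqrt (10 + 2 * sqrt 5)) *\<^sub>R vvec v) = cosedge
    \<longleftrightarrow> zdot u v = (2, 2)"
proof -
  have p: "zdot u v = (10, 2) \<or> zdot u v = (2, 2) \<or> zdot u v = (-2, -2) \<or> zdot u v = (-10, -2)"
    using icoz_products assms unfolding list_all_iff Let_def by (metis (full_types))
  have "0 < 10 + 2 * sqrt (5::real)" by (simp add: add_pos_pos)
  moreover have "cosedge * (10 + 2 * sqrt 5) = 2 + 2 * sqrt 5"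
    using cosedge_sqrt5 sqrt5_eq by (simp add: distrib_left)
  ultimately have e: "x / (10 + 2 * sqrt 5) = cosedge \<longleftrightarrow> x = 2 + 2 * sqrt 5" for x
    by (simp add: divide_eq_eq)
  have "0 < sqrt (5::real)" by simp
  then have s: "4 * sqrt 5 + 4 \<noteq> (0::real)" "4 * sqrt 5 + 12 \<noteq> (0::real)" by linarith+
  show ?thesis unfolding ico_scale vvec_dot e using p s by (auto simp: zval_def)
qed

lemma ico_opposite:
  assumes "A \<in> ico" "B \<in> ico" "C \<in> ico" "A \<bullet> B = cosedge" "A \<bullet> C = cosedge" "B \<bullet> C = cosedge"
  shows "C - ((sqrt 5 - 1) / 2) *\<^sub>R (A + B) \<in> ico"
proof -
  let ?s = "inverse (sqrt (10 + 2 * sqrt 5))"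
  obtain u v w where h: "u \<in> set icoz" "A = ?s *\<^sub>R vvec u" "v \<in> set icoz" "B = ?s *\<^sub>R vvec v"
     "w \<in> set icoz" "C = ?s *\<^sub>R vvec w"
    using assms(1-3) unfolding ico_def by blast
  have d: "zdot u v = (2, 2)" "zdot u w = (2, 2)" "zdot v w = (2, 2)"
    using assms(4-6) unfolding h(2,4,6) by (simp_all only: ico_zdot_iff h)
  then have "\<exists>x\<in>set icoz. zvscale (2, 0) x = zvadd (zvscale (2, 0) w) (zvscale (1, -1) (zvadd u v))"
    using icoz_opposite h(1,3,5) unfolding list_all_iff list_ex_iff Let_def by blast
  then obtain x where x: "x \<in> set icoz" "zvscale (2, 0) x = zvadd (zvscale (2, 0) w) (zvscale (1, -1) (zvadd u v))" by blast
  have "zval (2, 0) *\<^sub>R vvec x = zval (2, 0) *\<^sub>R vvec w + zval (1, -1) *\<^sub>R (vvec u + vvec v)"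
    using arg_cong[OF x(2), of vvec] by (simp only: vvec_add vvec_scale)
  then have "2 *\<^sub>R vvec x = 2 *\<^sub>R vvec w - (sqrt 5 - 1) *\<^sub>R (vvec u + vvec v)"
    by (simp add: zval_def algebra_simps)
  also have "\<dots> = 2 *\<^sub>R (vvec w - ((sqrt 5 - 1) / 2) *\<^sub>R (vvec u + vvec v))"
    unfolding scaleR_diff_right[of 2] scaleR_scaleR by simp
  finally have "2 *\<^sub>R vvec x = 2 *\<^sub>R (vvec w - ((sqrt 5 - 1) / 2) *\<^sub>R (vvec u + vvec v))" .
  then have "vvec x = vvec w - ((sqrt 5 - 1) / 2) *\<^sub>R (vvec u + vvec v)" by simp
  moreover have "s *\<^sub>R w - c *\<^sub>R (s *\<^sub>R u + s *\<^sub>R v) = s *\<^sub>R (w - c *\<^sub>R (u + v))" for s c and u v w :: "real^3"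
    by (simp add: algebra_simps)
  ultimately have "C - ((sqrt 5 - 1) / 2) *\<^sub>R (A + B) = ?s *\<^sub>R vvec x"
    unfolding h(2,4,6) by simp
  then show ?thesis using x(1) unfolding ico_def by blast
qed

lemma ico_uminus:
  assumes "x \<in> ico" shows "- x \<in> ico"
proof -
  obtain u where u: "u \<in> set icoz" "x = inverse (sqrt (10 + 2 * sqrt 5)) *\<^sub>R vvec u" using assms by (auto simp: ico_def)
  then have "zvscale (-1, 0) u \<in> set icoz"
    using icoz_uminus unfolding list_all_iff list_ex_iff by metis
  moreover have "- x = inverse (sqrt (10 + 2 * sqrt 5)) *\<^sub>R vvec (zvscale (-1, 0) u)"
    unfolding u(2) vvec_scale by (simp add: zval_def)
  ultimately show ?thesis unfolding ico_def by blast
qed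

text \<open>Since \<open>A + B\<close> has squared norm \<open>2 * (1 + cosedge)\<close>, this is
  the reflection with normal \<open>A + B\<close>; it exchanges \<open>A\<close> and
  \<open>- B\<close>. A vertex other than these and their antipodes has product
  \<open>\<plusminus>cosedge\<close> with both. If the signs differ, it lies on the mirror; if they
  agree, \<open>ico_opposite\<close> gives its image.\<close>

lemma ico_reflect:
  assumes AB: "A \<in> ico" "B \<in> ico" "A \<bullet> B = cosedge" and x: "x \<in> ico"
  shows "x - (x \<bullet> (A + B) / (1 + cosedge)) *\<^sub>R (A + B) \<in> ico"
proof -
  have k: "0 < cosedge" "1 + cosedge \<noteq> 0" using cosedge_bounds by auto
  have f: "(- 1 - cosedge) / (1 + cosedge) = - 1" using k by (simp add: divide_eq_eq)
  have neg: "- y = z" if "y \<in> ico" "z \<in> ico" "y \<bullet> z = -1" for y z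
  proof -
    have "(y + z) \<bullet> (y + z) = 0"
      using that ico_norm by (simp add: inner_add_left inner_add_right inner_commute norm_eq_1)
    then show ?thesis by (simp add: eq_neg_iff_add_eq_0 flip: neg_eq_iff_add_eq_0)
  qed
  have AA: "A \<bullet> A = 1" "B \<bullet> B = 1" "B \<bullet> A = cosedge"
    using ico_norm AB by (simp_all add: norm_eq_1 inner_commute)
  consider "x = A" | "x = B" | "x = - A" | "x = - B"
    | "x \<bullet> A = cosedge \<or> x \<bullet> A = - cosedge" "x \<bullet> B = cosedge \<or> x \<bullet> B = - cosedge"
    using ico_products(2)[OF x AB(1)] ico_products(2)[OF x AB(2)] neg[OF AB(1) x] neg[OF AB(2) x]
    by (metis inner_commute)
  then show ?thesis
  proof cases
    case 1
    then show ?thesis using k AA AB ico_uminus[of B] by (simp add: inner_add_right)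
  next
    case 2
    then show ?thesis using k AA AB ico_uminus[of A] by (simp add: inner_add_right add.commute)
  next
    case 3
    then show ?thesis using k AA AB f by (simp add: inner_add_right)
  next
    case 4
    then show ?thesis using k AA AB f by (simp add: inner_add_right add.commute)
  next
    case 5
    have q: "2 * cosedge / (1 + cosedge) = (sqrt 5 - 1) / 2"
      using cosedge_sq k unfolding sqrt5_eq by (simp add: field_simps)
    have opp: "y - (2 * cosedge / (1 + cosedge)) *\<^sub>R (A + B) \<in> ico"
      if "y \<in> ico" "y \<bullet> A = cosedge" "y \<bullet> B = cosedge" for y
      unfolding q by (rule ico_opposite) (use AB that in \<open>auto simp: inner_commute\<close>)
    consider "x \<bullet> (A + B) = 0" | "x \<bullet> A = cosedge" "x \<bullet> B = cosedge" | "x \<bullet> A = - cosedge" "x \<bullet> B = - cosedge"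
      using 5 by (auto simp: inner_add_right)
    then show ?thesis
    proof cases
      case 1
      then show ?thesis using x by simp
    next
      case 2
      then have "x \<bullet> (A + B) = 2 * cosedge" by (simp add: inner_add_right)
      then show ?thesis using opp[OF x 2] by simp
    next
      case 3
      then have "x \<bullet> (A + B) = - (2 * cosedge)" by (simp add: inner_add_right)
      then show ?thesis using ico_uminus[OF opp[OF ico_uminus[OF x]]] 3 by (simp add: add.commute)
    qed
  qed
qed

text \<open>Each face occurs under every labelling of its vertices; \<open>smap_transfer\<close>
  relates the different representations of one point.\<close>

definition faces :: "(real^3^3) set" where
  "faces = {T. tri T \<and> (\<forall>i. T$i \<in> ico)}"

lemma faces_nonempty: "faces \<noteq> {}"
proof -
  let ?s = "inverse (sqrt (10 + 2 * sqrt 5))"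
  define u v w :: zvec where "u = ((0,0),(2,0),(1,1))" and "v = ((2,0),(1,1),(0,0))" and "w = ((1,1),(0,0),(2,0))"
  have m: "u \<in> set icoz" "v \<in> set icoz" "w \<in> set icoz" by (simp_all add: icoz_def u_def v_def w_def)
  have d: "zdot u v = (2,2)" "zdot v u = (2,2)" "zdot u w = (2,2)" "zdot w u = (2,2)" "zdot v w = (2,2)" "zdot w v = (2,2)"
    by (simp_all add: zdot_def zadd_def zmul_def u_def v_def w_def)
  define T :: "real^3^3" where "T = vector [?s *\<^sub>R vvec u, ?s *\<^sub>R vvec v, ?s *\<^sub>R vvec w]"
  have T: "T$1 = ?s *\<^sub>R vvec u" "T$2 = ?s *\<^sub>R vvec v" "T$3 = ?s *\<^sub>R vvec w" by (simp_all add: T_def)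
  have i: "T$1 \<in> ico" "T$2 \<in> ico" "T$3 \<in> ico" unfolding T ico_def using m by blast+
  have "T$1 \<bullet> T$2 = cosedge" "T$1 \<bullet> T$3 = cosedge" "T$2 \<bullet> T$3 = cosedge"
     "T$2 \<bullet> T$1 = cosedge" "T$3 \<bullet> T$1 = cosedge" "T$3 \<bullet> T$2 = cosedge"
    unfolding T using m d by (simp_all only: ico_zdot_iff)
  moreover have "T$1 \<bullet> T$1 = 1" "T$2 \<bullet> T$2 = 1" "T$3 \<bullet> T$3 = 1" using i ico_norm by (simp_all add: norm_eq_1)
  ultimately have "tri T" unfolding tri_def forall_3 cosedge_def[symmetric] by simp
  then show ?thesis using i unfolding faces_def forall_3 by blast
qed

lemma finite_ico: "finite ico"
  by (simp add: ico_def)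

lemma finite_faces: "finite faces"
proof -
  have "faces \<subseteq> (\<lambda>f. \<chi> i. f i) ` (PiE UNIV (\<lambda>_. ico))"
  proof
    fix T assume "T \<in> faces"
    then have "(\<lambda>i. T$i) \<in> PiE UNIV (\<lambda>_. ico)" by (auto simp: faces_def)
    then show "T \<in> (\<lambda>f. \<chi> i. f i) ` (PiE UNIV (\<lambda>_. ico))"
      by (rule image_eqI[rotated]) (simp add: vec_lambda_eta)
  qed
  then show ?thesis by (rule finite_subset) (intro finite_imageI finite_PiE finite_ico finite)
qed

lemma tri_span:
  assumes "tri T"
  obtains \<gamma> where "c = (\<Sum>i\<in>UNIV. \<gamma> i *\<^sub>R T$i)"
proof -
  define L :: "real^3 \<Rightarrow> real^3" where "L g = (\<Sum>i\<in>UNIV. g$i *\<^sub>R T$i)" for g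
  have lin: "linear L"
    by (rule linearI) (simp_all add: L_def scaleR_add_left sum.distrib scaleR_sum_right)
  have "inj L"
  proof (rule injI)
    fix x y assume "L x = L y"
    then have "x$i = y$i" for i unfolding L_def by (rule tri_independent[OF assms])
    then show "x = y" by (simp add: vec_eq_iff)
  qed
  then have "surj L" by (rule linear_inj_imp_surj[OF lin])
  then obtain g where "c = L g" using surjD[of L c] by blast
  then show ?thesis using that[of "\<lambda>i. g$i"] by (simp add: L_def)
qed

text \<open>The mirror through the origin and the two vertices of \<open>T\<close> other than \<open>T$m\<close> has normal \<open>M\<close>.\<close>

lemma face_mirror:
  assumes "T \<in> faces"
  obtains M where "\<And>i. T$i \<bullet> M = (if i = m then 1 + cosedge else 0)" "M \<bullet> M = 2 * (1 + cosedge)"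
    "\<forall>x\<in>ico. x - (x \<bullet> M / (1 + cosedge)) *\<^sub>R M \<in> ico"
proof -
  have tri: "tri T" and mem: "\<And>i. T$i \<in> ico" using assms by (auto simp: faces_def)
  have ip: "T$i \<bullet> T$j = (if i = j then 1 else cosedge)" for i j using tri by (simp add: tri_def cosedge_def)
  obtain u where u: "u \<noteq> m" "u \<noteq> m" by (rule third_index[of m m])
  obtain v where v: "v \<noteq> u" "v \<noteq> m" by (rule third_index[of u m])
  have all: "i = u \<or> i = v \<or> i = m" for i
    using distinct_indices[of u v m] u v exhaust_3[of i] by auto
  \<comment> \<open>The vertex \<open>- D\<close> lies across the edge opposite to
    \<open>T$m\<close> and is its mirror image, so \<open>T$m + D\<close> is normal to the
    mirror.\<close>
  define D where "D = T$m - ((sqrt 5 - 1) / 2) *\<^sub>R (T$u + T$v)"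
  have D: "D \<in> ico"
    unfolding D_def by (rule ico_opposite) (use mem ip u v in auto)
  have k: "cosedge * (5 * cosedge) = 1" using cosedge_sq by simp
  have uD: "T$u \<bullet> D = - cosedge" "T$v \<bullet> D = - cosedge" "T$m \<bullet> D = cosedge"
    using u v k unfolding D_def sqrt5_eq by (simp_all add: inner_diff_right inner_add_right ip field_simps)
  have DD: "D \<bullet> D = 1" using ico_norm[OF D] by (simp add: norm_eq_1)
  show ?thesis
  proof (rule that[of "T$m + D"])
    show "T$i \<bullet> (T$m + D) = (if i = m then 1 + cosedge else 0)" for i
      using all[of i] u v uD by (auto simp: inner_add_right ip)
    show "(T$m + D) \<bullet> (T$m + D) = 2 * (1 + cosedge)"
      using uD(3) DD by (simp add: inner_add_left inner_add_right ip inner_commute)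
    show "\<forall>x\<in>ico. x - (x \<bullet> (T$m + D) / (1 + cosedge)) *\<^sub>R (T$m + D) \<in> ico"
      using ico_reflect[OF mem D uD(3)] by blast
  qed
qed

section \<open>The points on the sphere and the faces that contain their maximisers\<close>

definition geo :: "nat \<Rightarrow> (real^3) set" where
  "geo n = (\<Union>T\<in>faces. smap T ` lattice n)"

lemma faces_tri: "T \<in> faces \<Longrightarrow> tri T"
  by (simp add: faces_def)

lemma finite_lattice:
  assumes "0 < n" shows "finite (lattice n)"
proof -
  have "lattice n \<subseteq> (\<lambda>f. \<chi> i. real (f i) / n) ` (PiE UNIV (\<lambda>_. {..n}))"
  proof
    fix p assume p: "p \<in> lattice n"
    define f where "f i = nat \<lfloor>real n * p$i\<rfloor>" for i
    have f: "real (f i) = real n * p$i" for i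
      using p simp3_nonneg[OF lattice_simp3[OF p], of i] by (auto simp: f_def lattice_def elim!: Ints_cases)
    have "real (f i) \<le> real n" for i
      unfolding f using simp3_le[OF lattice_simp3[OF p], of i] by (simp add: mult_left_le)
    then have "f \<in> PiE UNIV (\<lambda>_. {..n})" by auto
    moreover have "p = (\<chi> i. real (f i) / n)" using assms by (simp add: vec_eq_iff f)
    ultimately show "p \<in> (\<lambda>f. \<chi> i. real (f i) / n) ` (PiE UNIV (\<lambda>_. {..n}))" by (intro image_eqI)
  qed
  then show ?thesis by (rule finite_subset) (intro finite_imageI finite_PiE finite finite_atMost)
qed

lemma finite_geo: "0 < n \<Longrightarrow> finite (geo n)"
  unfolding geo_def by (intro finite_UN_I finite_faces finite_imageI finite_lattice)

lemma norm_geo: "x \<in> geo n \<Longrightarrow> norm x = 1"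
  by (auto simp: geo_def intro!: norm_smap faces_tri lattice_simp3)

lemma mirror_coordinate:
  assumes "\<And>i. T$i \<bullet> M = (if i = m then 1 + cosedge else 0)"
  shows "(\<Sum>i\<in>UNIV. g i *\<^sub>R T$i) \<bullet> M = g m * (1 + cosedge)"
  unfolding inner_sum_left inner_scaleR_left assms by (simp add: if_distrib sum.delta cong: if_cong)

text \<open>The reflection is a linear isometry preserving \<open>ico\<close>, and
  \<open>smap\<close> uses only linear combinations of the vertices and their norm, so it commutes
  with the reflection. Hence reflected points of \<open>geo n\<close> are again in
  \<open>geo n\<close>.\<close>

lemma fold:
  assumes M: "M \<bullet> M = 2 * (1 + cosedge)"
    and ico: "\<forall>x\<in>ico. x - (x \<bullet> M / (1 + cosedge)) *\<^sub>R M \<in> ico"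
    and S: "S \<in> faces" and \<rho>_def: "\<rho> = (\<lambda>x. x - (x \<bullet> M / (1 + cosedge)) *\<^sub>R M)"
  shows "(\<chi> i. \<rho> (S$i)) \<in> faces" "smap (\<chi> i. \<rho> (S$i)) p = \<rho> (smap S p)"
proof -
  have k: "1 + cosedge \<noteq> 0" using cosedge_bounds by simp
  have lin: "linear \<rho>"
    unfolding \<rho>_def by (rule linearI) (simp_all add: inner_add_left add_divide_distrib algebra_simps)
  have iso: "\<rho> x \<bullet> \<rho> y = x \<bullet> y" for x y
  proof -
    define a b where "a = x \<bullet> M / (1 + cosedge)" and "b = y \<bullet> M / (1 + cosedge)"
    have ab: "x \<bullet> M = a * (1 + cosedge)" "M \<bullet> y = b * (1 + cosedge)"
      using k by (simp_all add: a_def b_def inner_commute)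
    have "\<rho> x \<bullet> \<rho> y = x \<bullet> y - b * (x \<bullet> M) - a * (M \<bullet> y) + a * b * (M \<bullet> M)"
      unfolding \<rho>_def a_def[symmetric] b_def[symmetric] by (simp add: inner_diff_left inner_diff_right algebra_simps)
    then show ?thesis unfolding M ab by (simp add: algebra_simps)
  qed
  show "(\<chi> i. \<rho> (S$i)) \<in> faces"
    using S ico unfolding faces_def tri_def mem_Collect_eq vec_lambda_beta iso by (simp add: \<rho>_def)
  have "fmap (\<chi> i. \<rho> (S$i)) p = \<rho> (fmap S p)"
    unfolding fmap_def by (simp add: linear_sum[OF lin] linear_cmul[OF lin])
  moreover have "norm (\<rho> x) = norm x" for x by (simp add: norm_eq_sqrt_inner iso)
  ultimately show "smap (\<chi> i. \<rho> (S$i)) p = \<rho> (smap S p)"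
    unfolding smap_def by (simp add: linear_cmul[OF lin])
qed

lemma smap_mirror_coordinate:
  assumes "\<And>i. T$i \<bullet> M = (if i = m then 1 + cosedge else 0)"
  shows "smap T p \<bullet> M = prof (p$m) * (1 + cosedge) / norm (fmap T p)"
  unfolding smap_def inner_scaleR_left by (simp add: fmap_def mirror_coordinate[OF assms] divide_inverse)

text \<open>Among all representations of a maximiser choose the face \<open>T\<close> with \<open>c \<bullet> (\<Sum>i. T$i)\<close> maximal:
  were \<open>c\<close> outside the cone of \<open>T\<close>, reflecting in the separating mirror would either increase \<open>c \<bullet> x\<close>
  or, if \<open>x\<close> lies on the mirror, move the face.\<close>

lemma maximiser_face:
  assumes "x \<in> geo n" "\<And>y. y \<in> geo n \<Longrightarrow> c \<bullet> y \<le> c \<bullet> x"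
  obtains T a \<gamma> where "T \<in> faces" "a \<in> lattice n" "x = smap T a" "c = (\<Sum>i\<in>UNIV. \<gamma> i *\<^sub>R T$i)" "\<And>i. 0 \<le> \<gamma> i"
proof -
  define F where "F = {T \<in> faces. x \<in> smap T ` lattice n}"
  have F: "finite F" "F \<noteq> {}"
    using finite_faces assms(1) by (auto simp: F_def geo_def)
  define h where "h T = c \<bullet> (\<Sum>i\<in>UNIV. T$i)" for T :: "real^3^3"
  obtain T where T: "T \<in> F" "\<And>S. S \<in> F \<Longrightarrow> h S \<le> h T"
  proof -
    have "Max (h ` F) \<in> h ` F" using F by (intro Max_in) auto
    then obtain T where "T \<in> F" "h T = Max (h ` F)" by auto
    moreover have "h S \<le> Max (h ` F)" if "S \<in> F" for S using that F by (intro Max_ge) auto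
    ultimately show ?thesis using that by simp
  qed
  then obtain a where a: "T \<in> faces" "a \<in> lattice n" "x = smap T a" by (auto simp: F_def)
  obtain \<gamma> where \<gamma>: "c = (\<Sum>i\<in>UNIV. \<gamma> i *\<^sub>R T$i)" by (rule tri_span[OF faces_tri[OF a(1)]]) (rule that; assumption)
  have k: "0 < 1 + cosedge" using cosedge_bounds by simp
  have "0 \<le> \<gamma> m" for m
  proof (rule ccontr)
    assume neg: "\<not> 0 \<le> \<gamma> m"
    show False
    proof (rule face_mirror[OF a(1), of m])
      fix M assume M: "\<And>i. T$i \<bullet> M = (if i = m then 1 + cosedge else 0)" "M \<bullet> M = 2 * (1 + cosedge)"
        "\<forall>x\<in>ico. x - (x \<bullet> M / (1 + cosedge)) *\<^sub>R M \<in> ico"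
      define \<rho> where "\<rho> = (\<lambda>x. x - (x \<bullet> M / (1 + cosedge)) *\<^sub>R M)"
      define S :: "real^3^3" where "S = (\<chi> i. \<rho> (T$i))"
      have "S \<in> faces" unfolding S_def by (rule fold(1)[OF M(2,3) a(1) \<rho>_def])
      moreover have "smap S a = \<rho> x" unfolding S_def a(3) by (rule fold(2)[OF M(2,3) a(1) \<rho>_def])
      ultimately have S: "S \<in> faces" "smap S a = \<rho> x" .
      have "c \<bullet> M = \<gamma> m * (1 + cosedge)" by (subst \<gamma>) (rule mirror_coordinate[OF M(1)])
      then have cM: "c \<bullet> M < 0" using neg k by (simp add: mult_neg_pos)
      have "smap S a \<in> geo n" unfolding geo_def by (rule UN_I[OF S(1)]) (rule imageI[OF a(2)])
      then have "\<rho> x \<in> geo n" unfolding S(2) .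
      then have "c \<bullet> \<rho> x \<le> c \<bullet> x" by (rule assms(2))
      then have "0 \<le> (x \<bullet> M) * (c \<bullet> M) / (1 + cosedge)" by (simp add: \<rho>_def inner_diff_right)
      then have "x \<bullet> M \<le> 0" using cM k by (simp add: zero_le_divide_iff zero_le_mult_iff)
      moreover have "0 \<le> x \<bullet> M"
        unfolding a(3) smap_mirror_coordinate[OF M(1)]
        using k prof_nonneg[OF simp3_nonneg simp3_le, OF lattice_simp3 lattice_simp3, OF a(2) a(2)] by simp
      ultimately have "x \<bullet> M = 0" by simp
      then have "\<rho> x = x" by (simp add: \<rho>_def)
      then have "x = smap S a" using S(2) by simp
      then have "S \<in> F" using S(1) imageI[OF a(2), of "smap S"] by (simp add: F_def)
      then have "h S \<le> h T" by (rule T(2))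
      moreover have "h S = h T - (\<Sum>i\<in>UNIV. T$i \<bullet> M / (1 + cosedge)) * (c \<bullet> M)"
        unfolding h_def S_def \<rho>_def
        by (simp add: inner_sum_right inner_diff_right sum_subtractf sum_distrib_right)
      moreover have "(\<Sum>i\<in>UNIV. T$i \<bullet> M / (1 + cosedge)) = 1"
        unfolding M(1) using k by (simp add: if_distrib[of "\<lambda>x. x / _"] sum.delta cong: if_cong)
      ultimately show False using cM by simp
    qed
  qed
  then show ?thesis by (intro that[OF a \<gamma>])
qed

text \<open>The cones over two faces meet only in a common face. Pairing with the vertex sum of a
  face attains its maximum \<open>1 + 2 * cosedge\<close> over \<open>ico\<close> exactly at the
  vertices of that face. Comparing both pairings at \<open>c\<close> gives equality, so no positive
  weight sits on a vertex outside the other face.\<close>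

lemma face_support:
  assumes "T \<in> faces" "S \<in> faces" "c = (\<Sum>i\<in>UNIV. \<gamma> i *\<^sub>R T$i)" "\<And>i. 0 \<le> \<gamma> i"
    and "c = (\<Sum>i\<in>UNIV. \<delta> i *\<^sub>R S$i)" "\<And>i. 0 \<le> \<delta> i" "0 < \<gamma> i"
  shows "T$i \<in> range (\<lambda>j. S$j)"
proof -
  have k: "0 < cosedge" "cosedge < 1" using cosedge_bounds by simp_all
  have le: "v \<bullet> (\<Sum>j\<in>UNIV. U$j) \<le> 1 + 2 * cosedge \<and> (v \<notin> range (\<lambda>j. U$j) \<longrightarrow> v \<bullet> (\<Sum>j\<in>UNIV. U$j) < 1 + 2 * cosedge)
      \<and> (v \<in> range (\<lambda>j. U$j) \<longrightarrow> v \<bullet> (\<Sum>j\<in>UNIV. U$j) = 1 + 2 * cosedge)"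
    if U: "U \<in> faces" and v: "v \<in> ico" for U v
  proof (cases "v \<in> range (\<lambda>j. U$j)")
    case True
    then obtain j where "v = U$j" by blast
    moreover have "U$j \<bullet> (\<Sum>j\<in>UNIV. U$j) = 1 + 2 * cosedge"
      using faces_tri[OF U] exhaust_3[of j] by (auto simp: sum_3 tri_def inner_add_right cosedge_def)
    ultimately show ?thesis using True by simp
  next
    case False
    have "v \<bullet> U$j \<le> cosedge" for j
    proof -
      have "v \<noteq> U$j" "U$j \<in> ico" using False U by (auto simp: faces_def)
      then show ?thesis using ico_products(2)[OF v, of "U$j"] k by auto
    qed
    from this[of 1] this[of 2] this[of 3] have "v \<bullet> (\<Sum>j\<in>UNIV. U$j) < 1 + 2 * cosedge"
      using k by (simp add: sum_3 inner_add_right)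
    then show ?thesis using False by simp
  qed
  have ico: "T$i \<in> ico" "S$i \<in> ico" for i using assms(1,2) by (auto simp: faces_def)
  have sumle: "c \<bullet> (\<Sum>j\<in>UNIV. U$j) \<le> (\<Sum>i\<in>UNIV. g i) * (1 + 2 * cosedge)"
    if "U \<in> faces" "V \<in> faces" "c = (\<Sum>i\<in>UNIV. g i *\<^sub>R V$i)" "\<And>i. 0 \<le> g i" for U V g
  proof -
    have "c \<bullet> (\<Sum>j\<in>UNIV. U$j) = (\<Sum>i\<in>UNIV. g i * (V$i \<bullet> (\<Sum>j\<in>UNIV. U$j)))"
      unfolding that(3) inner_sum_left inner_scaleR_left ..
    also have "\<dots> \<le> (\<Sum>i\<in>UNIV. g i * (1 + 2 * cosedge))"
      using le[OF that(1)] that(2,4) by (intro sum_mono mult_left_mono) (auto simp: faces_def)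
    finally show ?thesis by (simp only: sum_distrib_right)
  qed
  have eqU: "c \<bullet> (\<Sum>j\<in>UNIV. V$j) = (\<Sum>i\<in>UNIV. g i) * (1 + 2 * cosedge)"
    if "V \<in> faces" "c = (\<Sum>i\<in>UNIV. g i *\<^sub>R V$i)" for V g
  proof -
    have "c \<bullet> (\<Sum>j\<in>UNIV. V$j) = (\<Sum>i\<in>UNIV. g i * (V$i \<bullet> (\<Sum>j\<in>UNIV. V$j)))"
      unfolding that(2) inner_sum_left inner_scaleR_left ..
    also have "\<dots> = (\<Sum>i\<in>UNIV. g i * (1 + 2 * cosedge))"
      using le[OF that(1)] that(1) by (intro sum.cong refl) (auto simp: faces_def)
    finally show ?thesis by (simp only: sum_distrib_right)
  qed
  have "(\<Sum>i\<in>UNIV. \<gamma> i) * (1 + 2 * cosedge) \<le> (\<Sum>i\<in>UNIV. \<delta> i) * (1 + 2 * cosedge)"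
    using eqU[OF assms(1,3)] sumle[OF assms(1,2,5,6)] by linarith
  then have "c \<bullet> (\<Sum>j\<in>UNIV. S$j) \<ge> (\<Sum>i\<in>UNIV. \<gamma> i) * (1 + 2 * cosedge)"
    using eqU[OF assms(2,5)] by linarith
  moreover have "c \<bullet> (\<Sum>j\<in>UNIV. S$j) = (\<Sum>i\<in>UNIV. \<gamma> i * (T$i \<bullet> (\<Sum>j\<in>UNIV. S$j)))"
    unfolding assms(3) inner_sum_left inner_scaleR_left ..
  ultimately have "(\<Sum>i\<in>UNIV. \<gamma> i * (1 + 2 * cosedge - T$i \<bullet> (\<Sum>j\<in>UNIV. S$j))) \<le> 0"
    by (simp only: right_diff_distrib[of "\<gamma> _"] sum_subtractf sum_distrib_right)
  moreover have nn: "0 \<le> \<gamma> i * (1 + 2 * cosedge - T$i \<bullet> (\<Sum>j\<in>UNIV. S$j))" for i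
    using le[OF assms(2) ico(1)[of i]] assms(4) by simp
  ultimately have "(\<Sum>i\<in>UNIV. \<gamma> i * (1 + 2 * cosedge - T$i \<bullet> (\<Sum>j\<in>UNIV. S$j))) = 0"
    by (intro antisym sum_nonneg)
  then have "\<gamma> i * (1 + 2 * cosedge - T$i \<bullet> (\<Sum>j\<in>UNIV. S$j)) = 0"
    using nn by (simp add: sum_nonneg_eq_0_iff)
  then show ?thesis using le[OF assms(2) ico(1)[of i]] assms(7) by auto
qed

lemma tri_inj: "tri T \<Longrightarrow> T$i = T$j \<Longrightarrow> i = j"
  using tri_inner[of T i j] tri_norm[of T i] cosedge_bounds by (auto simp: norm_eq_1 cosedge_def[symmetric])

text \<open>As \<open>prof 0 = 0\<close>, only vertices with positive coordinate enter
  \<open>fmap\<close>, so their coordinates can be moved to the labels which these vertices have in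
  \<open>T\<close>. Each \<open>J i\<close> has at most one element, so its sum is a single
  coordinate or 0.\<close>

lemma smap_transfer:
  assumes "tri T" "tri S" "b \<in> lattice n" "\<And>j. 0 < b$j \<Longrightarrow> S$j \<in> range (\<lambda>i. T$i)"
  shows "smap S b \<in> smap T ` lattice n"
proof -
  define J where "J i = {j. S$j = T$i}" for i
  define a :: "real^3" where "a = (\<chi> i. \<Sum>j\<in>J i. b$j)"
  have b: "0 \<le> b$j" for j using simp3_nonneg[OF lattice_simp3[OF assms(3)]] .
  have cardI: "(\<Sum>i\<in>{i. S$j = T$i}. x) = (if S$j \<in> range (\<lambda>i. T$i) then x else 0)" for j and x :: "'z::comm_monoid_add"
  proof (cases "S$j \<in> range (\<lambda>i. T$i)")
    case True
    then obtain i where i: "S$j = T$i" by blast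
    then have "{i. S$j = T$i} = {i}" using tri_inj[OF assms(1)] by auto
    then show ?thesis using True by simp
  next
    case False
    then have "{i. S$j = T$i} = {}" by auto
    then show ?thesis using False by simp
  qed
  have swap: "(\<Sum>i\<in>UNIV. \<Sum>j\<in>J i. f j) = (\<Sum>j\<in>UNIV. f j)" if "\<And>j. b$j = 0 \<Longrightarrow> f j = 0" for f :: "3 \<Rightarrow> 'z::comm_monoid_add"
  proof -
    have "(\<Sum>i\<in>UNIV. \<Sum>j\<in>J i. f j) = (\<Sum>j\<in>UNIV. \<Sum>i\<in>{i. S$j = T$i}. f j)"
      using sum.swap_restrict[of "UNIV::3 set" "UNIV::3 set" "\<lambda>i j. f j" "\<lambda>i j. S$j = T$i"] by (simp add: J_def)
    also have "\<dots> = (\<Sum>j\<in>UNIV. f j)"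
    proof (rule sum.cong[OF refl])
      fix j
      have "f j = 0" if "S$j \<notin> range (\<lambda>i. T$i)"
      proof -
        have "b$j = 0" using that assms(4)[of j] b[of j] by linarith
        then show ?thesis using \<open>\<And>j. b$j = 0 \<Longrightarrow> f j = 0\<close> by blast
      qed
      then show "(\<Sum>i\<in>{i. S$j = T$i}. f j) = f j" unfolding cardI by auto
    qed
    finally show ?thesis .
  qed
  have Jc: "J i = {} \<or> (\<exists>j. J i = {j})" for i
  proof (cases "J i = {}")
    case False
    then obtain j where "j \<in> J i" by blast
    then have "J i = {j}" using tri_inj[OF assms(2)] unfolding J_def by (auto dest: sym)
    then show ?thesis by blast
  qed simp
  have "a \<in> lattice n"
  proof -
    have "a$1 + a$2 + a$3 = 1"
      using swap[of "\<lambda>j. b$j"] lattice_simp3[OF assms(3)] by (simp add: a_def sum_3 simp3_def)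
    moreover have "0 \<le> a$i" for i using b by (simp add: a_def sum_nonneg)
    moreover have "real n * a$i \<in> \<int>" for i
      using Jc[of i] assms(3) by (auto simp: a_def lattice_def)
    ultimately show ?thesis by (simp add: lattice_def simp3_def)
  qed
  moreover have "fmap T a = fmap S b"
  proof -
    have "fmap T a = (\<Sum>i\<in>UNIV. \<Sum>j\<in>J i. prof (b$j) *\<^sub>R S$j)"
      unfolding fmap_def
    proof (rule sum.cong[OF refl])
      fix i
      show "prof (a$i) *\<^sub>R T$i = (\<Sum>j\<in>J i. prof (b$j) *\<^sub>R S$j)"
        using Jc[of i]
      proof (elim disjE exE)
        fix j assume j: "J i = {j}"
        then have "S$j = T$i" unfolding J_def by blast
        then show ?thesis by (simp add: a_def j)
      qed (simp add: a_def)
    qed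
    also have "\<dots> = fmap S b" unfolding fmap_def by (rule swap) simp
    finally show ?thesis .
  qed
  then have "smap S b = smap T a" by (simp add: smap_def)
  ultimately show ?thesis by blast
qed

text \<open>A point on the arc between \<open>q\<close> and \<open>r\<close> is within half their
  angle of one of them, and \<open>1 - (dist q r)\<^sup>2 / 4\<close> is the squared cosine of half
  the angle.\<close>

lemma between_bound:
  fixes q r c :: "'a::real_inner"
  assumes "norm q = 1" "norm r = 1" "norm c = 1" "c = l *\<^sub>R q + m *\<^sub>R r" "0 \<le> l" "0 \<le> m"
    and "c \<bullet> q \<le> W" "c \<bullet> r \<le> W"
  shows "0 < W" "1 - (dist q r)\<^sup>2 / 4 \<le> W\<^sup>2"
proof -
  define s where "s = l + m"
  define e where "e = (dist q r)\<^sup>2 / 4"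
  have n: "q \<bullet> q = 1" "r \<bullet> r = 1" "c \<bullet> c = 1" using assms(1-3) by (simp_all add: norm_eq_1)
  have "c \<bullet> c = l * (c \<bullet> q) + m * (c \<bullet> r)" by (subst (2) assms(4)) (simp add: inner_add_right)
  also have "\<dots> \<le> l * W + m * W" using assms(5-8) by (intro add_mono mult_left_mono) auto
  finally have sW: "1 \<le> s * W" by (simp add: n s_def distrib_right)
  have s0: "0 \<le> s" using assms(5,6) by (simp add: s_def)
  then show W: "0 < W" using sW by (metis mult_nonneg_nonpos not_less not_one_le_zero order_trans)
  have "(dist q r)\<^sup>2 = 2 - 2 * (q \<bullet> r)"
    unfolding dist_norm power2_norm_eq_inner
    by (simp add: inner_diff_left inner_diff_right n inner_commute)
  then have qr: "q \<bullet> r = 1 - 2 * e" unfolding e_def by linarith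
  have "1 = (l *\<^sub>R q + m *\<^sub>R r) \<bullet> (l *\<^sub>R q + m *\<^sub>R r)" using n(3) assms(4) by simp
  also have "\<dots> = l * l + m * m + 2 * l * m * (q \<bullet> r)"
    by (simp add: inner_add_left inner_add_right n inner_commute)
  also have "\<dots> = s\<^sup>2 - e * (4 * l * m)" unfolding qr by (simp add: s_def power2_eq_square algebra_simps)
  also have "\<dots> \<ge> s\<^sup>2 - e * s\<^sup>2"
  proof -
    have "4 * l * m \<le> s\<^sup>2" using zero_le_power2[of "l - m"] by (simp add: s_def power2_eq_square algebra_simps)
    then have "e * (4 * l * m) \<le> e * s\<^sup>2" by (rule mult_left_mono) (simp add: e_def)
    then show ?thesis by simp
  qed
  finally have "s\<^sup>2 * (1 - e) \<le> 1" by (simp add: algebra_simps)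
  also have "1 \<le> (s * W)\<^sup>2" using sW by (simp add: one_le_power)
  finally have "s\<^sup>2 * (1 - e) \<le> s\<^sup>2 * W\<^sup>2" by (simp add: power_mult_distrib)
  moreover have "0 < s\<^sup>2" using sW by (auto simp: zero_less_power2)
  ultimately show "1 - (dist q r)\<^sup>2 / 4 \<le> W\<^sup>2" unfolding e_def[symmetric] by simp
qed

text \<open>Only the component of \<open>x\<close> orthogonal to \<open>M\<close> contributes to
  \<open>c \<bullet> x\<close>, and the right-hand side is its squared length.\<close>

lemma plane_bound:
  fixes c x M :: "'a::real_inner"
  assumes "norm c = 1" "norm x = 1" "c \<bullet> M = 0" "M \<noteq> 0"
  shows "(c \<bullet> x)\<^sup>2 \<le> 1 - (x \<bullet> M)\<^sup>2 / (M \<bullet> M)"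
proof -
  define y where "y = x - (x \<bullet> M / (M \<bullet> M)) *\<^sub>R M"
  have MM: "M \<bullet> M \<noteq> 0" using assms(4) by simp
  have "c \<bullet> x = c \<bullet> y" using assms(3) by (simp add: y_def inner_diff_right)
  moreover have "(c \<bullet> y)\<^sup>2 \<le> (c \<bullet> c) * (y \<bullet> y)" by (rule Cauchy_Schwarz_ineq)
  moreover have "y \<bullet> y = x \<bullet> x - 2 * (x \<bullet> M / (M \<bullet> M)) * (x \<bullet> M) + (x \<bullet> M / (M \<bullet> M))\<^sup>2 * (M \<bullet> M)"
    unfolding y_def by (simp add: inner_diff_left inner_diff_right inner_commute power2_eq_square)
  moreover have "\<dots> = 1 - (x \<bullet> M)\<^sup>2 / (M \<bullet> M)"
    using MM assms(2) by (simp add: norm_eq_1 power2_eq_square field_simps)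
  moreover have "c \<bullet> c = 1" using assms(1) by (simp add: norm_eq_1)
  ultimately show ?thesis by simp
qed

lemma sign_change:
  fixes D :: "nat \<Rightarrow> real"
  assumes "0 < n" "0 \<le> D 0" "D n \<le> 0"
  obtains i where "i < n" "0 \<le> D i" "D (Suc i) \<le> 0"
proof -
  have "\<exists>i<n. 0 \<le> D i \<and> D (Suc i) \<le> 0" using assms
  proof (induction n)
    case (Suc n)
    show ?case
    proof (cases "0 \<le> D n")
      case False
      then have "0 < n" using Suc.prems(2) by (cases n) auto
      then show ?thesis using Suc False by (auto intro: less_SucI)
    qed (use Suc in auto)
  qed simp
  then show ?thesis using that by blast
qed

text \<open>A positive lattice coordinate is at least \<open>1 / n\<close>. For
  \<open>n \<ge> 2\<close> the higher terms of the profile cost less than \<open>200 / n\<close>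
  there, leaving \<open>1600 / n\<close>, and \<open>fmap\<close> has norm at most 1800.\<close>

lemma height_bound:
  assumes "tri T" "2 \<le> n" "a \<in> lattice n" "0 < a$m"
  shows "8 / (9 * real n) \<le> prof (a$m) / norm (fmap T a)"
proof -
  have n: "2 \<le> real n" using assms(2) by simp
  have a3: "a \<in> simp3" using lattice_simp3[OF assms(3)] .
  have "real n * a$m \<in> \<int>" "0 < real n * a$m" using assms by (auto simp: lattice_def)
  then have "1 \<le> real n * a$m" by (auto elim!: Ints_cases)
  then have am: "1 / real n \<le> a$m" using n by (simp add: field_simps)
  define h where "h = 1 / real n"
  have h: "0 < h" "h \<le> 1 / 2" using n by (auto simp: h_def field_simps)
  have "1600 * h \<le> prof h"
  proof -
    have "216 * h\<^sup>2 \<le> 108 * h" using h by (simp add: power2_eq_square)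
    moreover have "(409 - 125 * sqrt 5) * h ^ 3 \<le> 130 * (h * (1 / 4))"
    proof (rule mult_mono)
      have "h ^ 3 = h * (h * h)" by (simp add: power3_eq_cube)
      also have "\<dots> \<le> h * (1 / 2 * (1 / 2))" using h by (intro mult_left_mono mult_mono) auto
      finally show "h ^ 3 \<le> h * (1 / 4)" by simp
    qed (use sqrt5_bounds h in auto)
    ultimately show ?thesis unfolding prof_eq using h by linarith
  qed
  also have "\<dots> \<le> prof (a$m)"
    using am h simp3_le[OF a3, of m] simp3_nonneg[OF a3, of m] by (simp add: prof_le_iff h_def)
  finally have p: "1600 * h \<le> prof (a$m)" .
  have f: "0 < norm (fmap T a)" "norm (fmap T a) \<le> 1800"
    using norm_fmap_le[OF assms(1) a3] norm_fmap_ge[OF assms(1) a3] by auto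
  have "8 / (9 * real n) = 1600 * h / 1800" using n by (simp add: h_def)
  also have "\<dots> \<le> prof (a$m) / norm (fmap T a)"
    using p f h by (intro frac_le) auto
  finally show ?thesis .
qed

text \<open>If \<open>c\<close> lies over a side of the face, it is between two consecutive lattice
  points of that side, so the maximum \<open>W\<close> has \<open>W\<^sup>2\<close> at least
  \<open>1 - r / n\<^sup>2\<close> with \<open>r\<close> about 0.42. A lattice point off the side is
  too high above its plane: there the square is at most \<open>1 - r' / n\<^sup>2\<close> with
  \<open>r'\<close> about 0.57.\<close>

lemma maximiser_on_side:
  assumes T: "T \<in> faces" and n: "2 \<le> n" and c: "norm c = 1" "c = (\<Sum>i\<in>UNIV. \<gamma> i *\<^sub>R T$i)" "\<And>i. 0 \<le> \<gamma> i"
    and a: "a \<in> lattice n" "\<And>x. x \<in> lattice n \<Longrightarrow> c \<bullet> smap T x \<le> c \<bullet> smap T a"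
    and m: "\<gamma> m = 0"
  shows "a$m = 0"
proof (rule ccontr)
  assume "a$m \<noteq> 0"
  have tri: "tri T" using faces_tri[OF T] .
  have am: "0 < a$m" using \<open>a$m \<noteq> 0\<close> simp3_nonneg[OF lattice_simp3[OF a(1)], of m] by simp
  have n0: "0 < n" "0 < real n" using n by auto
  obtain u where u: "u \<noteq> m" "u \<noteq> m" by (rule third_index[of m m])
  obtain v where v: "v \<noteq> u" "v \<noteq> m" by (rule third_index[of u m])
  have UN: "(UNIV::3 set) = {u, v, m}"
    using distinct_indices[of u v m] u v UNIV_3 by auto
  have sum3: "(\<Sum>i\<in>UNIV. f i) = f u + f v + f m" for f :: "3 \<Rightarrow> real^3"
    unfolding UN using u v by (simp add: add.assoc)
  have sum3r: "(\<Sum>i\<in>UNIV. f i) = f u + f v + f m" for f :: "3 \<Rightarrow> real"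
    unfolding UN using u v by (simp add: add.assoc)
  define q :: "nat \<Rightarrow> real^3" where "q i = (\<chi> j. if j = u then i / n else if j = v then 1 - i / n else 0)" for i
  have q: "q i $ u = i / n" "q i $ v = 1 - i / n" "q i $ m = 0" for i using u v by (simp_all add: q_def)
  have qL: "q i \<in> lattice n" if "i \<le> n" for i
  proof -
    have "0 \<le> q i $ j" for j using that n0 by (simp add: q_def)
    moreover have "q i $ 1 + q i $ 2 + q i $ 3 = 1"
      using sum3r[of "\<lambda>j. q i $ j"] by (simp add: sum_3 q)
    moreover have "real n * q i $ j \<in> \<int>" for j using n0 by (simp add: q_def right_diff_distrib)
    ultimately show ?thesis by (simp add: lattice_def simp3_def)
  qed
  define P R where "P i = prof (real i / n)" and "R i = prof (1 - real i / n)" for i :: nat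
  have fq: "fmap T (q i) = P i *\<^sub>R T$u + R i *\<^sub>R T$v" for i
    unfolding fmap_def sum3 by (simp add: q P_def R_def)
  have cuv: "c = \<gamma> u *\<^sub>R T$u + \<gamma> v *\<^sub>R T$v" using c(2) unfolding sum3 m by simp
  \<comment> \<open>The determinant of \<open>c\<close> and \<open>fmap T (q i)\<close> in the basis
    \<open>T$u\<close>, \<open>T$v\<close>: its sign tells on which side of the lattice point
    \<open>c\<close> lies.\<close>
  define D where "D i = \<gamma> u * R i - \<gamma> v * P i" for i
  have "P 0 = 0" "R n = 0" using n0 by (simp_all add: P_def R_def)
  moreover have "0 \<le> R 0" "0 \<le> P n" using n0 by (simp_all add: P_def R_def prof_nonneg)
  ultimately have "0 \<le> D 0" "D n \<le> 0" using c(3) by (simp_all add: D_def)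
  then obtain i where i: "i < n" "0 \<le> D i" "D (Suc i) \<le> 0"
    by (rule sign_change[OF n0(1)]) (rule that; assumption)
  have io: "real i / n < real (Suc i) / n" "real (Suc i) / n \<le> 1" "0 \<le> real i / n"
    using i(1) n0 by (simp_all add: divide_strict_right_mono)
  have mono: "P i < P (Suc i)" "R (Suc i) < R i" "0 \<le> P i" "0 \<le> R (Suc i)"
    unfolding P_def R_def using io by (auto intro!: prof_strict_mono prof_nonneg)
  define \<Delta> where "\<Delta> = R i * P (Suc i) - R (Suc i) * P i"
  have "R (Suc i) * P i \<le> R i * P i" using mono by (intro mult_right_mono) auto
  also have "\<dots> < R i * P (Suc i)" using mono by (intro mult_strict_left_mono) auto
  finally have \<Delta>: "0 < \<Delta>" by (simp add: \<Delta>_def)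
  \<comment> \<open>Cramer's rule in the plane of \<open>T$u\<close> and \<open>T$v\<close>, with
    determinant \<open>\<Delta>\<close>.\<close>
  have "\<Delta> *\<^sub>R c = (- D (Suc i)) *\<^sub>R fmap T (q i) + D i *\<^sub>R fmap T (q (Suc i))"
  proof -
    have "\<Delta> *\<^sub>R c = (\<gamma> u * \<Delta>) *\<^sub>R T$u + (\<gamma> v * \<Delta>) *\<^sub>R T$v" unfolding cuv by (simp add: scaleR_add_right mult.commute)
    moreover have "\<gamma> u * \<Delta> = (- D (Suc i)) * P i + D i * P (Suc i)" "\<gamma> v * \<Delta> = (- D (Suc i)) * R i + D i * R (Suc i)"
      by (simp_all add: D_def \<Delta>_def algebra_simps)
    ultimately show ?thesis unfolding fq by (simp add: scaleR_add_right scaleR_add_left scaleR_diff_left)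
  qed
  moreover have "c = (1 / \<Delta>) *\<^sub>R (\<Delta> *\<^sub>R c)" using \<Delta> by simp
  ultimately have c1: "c = (1 / \<Delta>) *\<^sub>R ((- D (Suc i)) *\<^sub>R fmap T (q i) + D i *\<^sub>R fmap T (q (Suc i)))" by simp
  define N0 N1 where "N0 = norm (fmap T (q i))" and "N1 = norm (fmap T (q (Suc i)))"
  have f0: "fmap T (q i) = N0 *\<^sub>R smap T (q i)" and f1: "fmap T (q (Suc i)) = N1 *\<^sub>R smap T (q (Suc i))"
    using fmap_nz[OF tri lattice_simp3[OF qL]] i(1) by (simp_all add: smap_def N0_def N1_def)
  from c1 have "c = (1 / \<Delta>) *\<^sub>R ((- D (Suc i)) *\<^sub>R (N0 *\<^sub>R smap T (q i)) + D i *\<^sub>R (N1 *\<^sub>R smap T (q (Suc i))))"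
    unfolding f0 f1 .
  then have ce: "c = (- D (Suc i) * N0 / \<Delta>) *\<^sub>R smap T (q i) + (D i * N1 / \<Delta>) *\<^sub>R smap T (q (Suc i))"
    by (simp only: scaleR_add_right scaleR_scaleR times_divide_eq_left mult_1_left mult.assoc)
  have N: "0 \<le> N0" "0 \<le> N1" by (simp_all add: N0_def N1_def)
  define W where "W = c \<bullet> smap T a"
  have qin: "q i \<in> lattice n" "q (Suc i) \<in> lattice n" using qL i(1) by auto
  have bb: "1 - (dist (smap T (q i)) (smap T (q (Suc i))))\<^sup>2 / 4 \<le> W\<^sup>2"
    by (rule between_bound(2)[OF _ _ c(1) ce])
      (use norm_smap[OF tri lattice_simp3] qin i \<Delta> N a(2) in \<open>auto simp: W_def mult_nonpos_nonneg divide_nonpos_pos\<close>)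
  have "real n *\<^sub>R (q (Suc i) - q i) = axis u 1 - axis v 1"
  proof -
    have "(real n *\<^sub>R (q (Suc i) - q i)) $ j = (axis u 1 - axis v 1 :: real^3) $ j" for j
    proof -
      have "j = u \<or> j = v \<or> j = m" using UN by blast
      then show ?thesis using u v n0 by (auto simp: q axis_def right_diff_distrib add_divide_distrib distrib_left)
    qed
    then show ?thesis by (simp add: vec_eq_iff)
  qed
  then have "dist (smap T (q i)) (smap T (q (Suc i))) \<le> ratio_bound * sig / n"
    using edge_length_upper[OF tri n0(1) qin] v(1) by metis
  then have "(dist (smap T (q i)) (smap T (q (Suc i))))\<^sup>2 \<le> (ratio_bound * sig / n)\<^sup>2" by (intro power_mono) auto
  also have "\<dots> = ratio_bound\<^sup>2 * sig\<^sup>2 / (real n)\<^sup>2" by (simp add: power_mult_distrib power_divide)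
  finally have "1 - ratio_bound\<^sup>2 * sig\<^sup>2 / (real n)\<^sup>2 / 4 \<le> 1 - (dist (smap T (q i)) (smap T (q (Suc i))))\<^sup>2 / 4"
    by (intro diff_left_mono divide_right_mono) auto
  then have low: "1 - ratio_bound\<^sup>2 * sig\<^sup>2 / (real n)\<^sup>2 / 4 \<le> W\<^sup>2" using bb by (rule order_trans)
  show False
  proof (rule face_mirror[OF T, of m])
    fix M assume M: "\<And>i. T$i \<bullet> M = (if i = m then 1 + cosedge else 0)" "M \<bullet> M = 2 * (1 + cosedge)"
    have k: "0 < 1 + cosedge" using cosedge_bounds by simp
    have "c \<bullet> M = \<gamma> m * (1 + cosedge)" by (subst c(2)) (rule mirror_coordinate[OF M(1)])
    then have cM: "c \<bullet> M = 0" using m by simp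
    have "M \<noteq> 0" using M(2) k by auto
    then have up: "W\<^sup>2 \<le> 1 - (smap T a \<bullet> M)\<^sup>2 / (M \<bullet> M)"
      unfolding W_def using plane_bound[OF c(1) norm_smap[OF tri lattice_simp3[OF a(1)]] cM] by blast
    have "(8 / (9 * real n))\<^sup>2 * ((1 + cosedge) / 2) \<le> (prof (a$m) / norm (fmap T a))\<^sup>2 * ((1 + cosedge) / 2)"
      using height_bound[OF tri n a(1) am] k by (intro mult_right_mono power_mono) auto
    also have "\<dots> = (smap T a \<bullet> M)\<^sup>2 / (M \<bullet> M)"
    proof -
      have e: "smap T a \<bullet> M = (prof (a$m) / norm (fmap T a)) * (1 + cosedge)"
        unfolding smap_mirror_coordinate[OF M(1)] by simp
      have gen: "r\<^sup>2 * (K / 2) = (r * K)\<^sup>2 / (2 * K)" if "0 < K" for r K :: real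
        using that by (simp add: power2_eq_square field_simps)
      show ?thesis unfolding M(2) e by (rule gen[OF k])
    qed
    also have "\<dots> \<le> ratio_bound\<^sup>2 * sig\<^sup>2 / (real n)\<^sup>2 / 4"
    proof -
      have "B \<le> A" if "1 - A \<le> w" "w \<le> 1 - B" for A B w :: real using that by linarith
      then show ?thesis using low up by blast
    qed
    finally have "(8 / (9 * real n))\<^sup>2 * ((1 + cosedge) / 2) \<le> ratio_bound\<^sup>2 * sig\<^sup>2 / (real n)\<^sup>2 / 4" .
    then have "64 / 81 * ((1 + cosedge) / 2) / (real n)\<^sup>2 \<le> ratio_bound\<^sup>2 * sig\<^sup>2 / 4 / (real n)\<^sup>2"
      by (simp add: power_divide power_mult_distrib)
    moreover have "A \<le> B" if "A / Z \<le> B / Z" "0 < Z" for A B Z :: real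
      using that by (simp add: divide_le_cancel)
    ultimately have b1: "64 / 81 * ((1 + cosedge) / 2) \<le> ratio_bound\<^sup>2 * sig\<^sup>2 / 4"
      using zero_less_power[OF n0(2), of 2] by blast
    have "sig\<^sup>2 \<le> 1.3"
      unfolding sig_sq using sqrt5_bounds by (subst pos_divide_le_eq) (auto simp: add_pos_pos)
    moreover have "ratio_bound\<^sup>2 \<le> 1.5" unfolding ratio_bound_sq using sqrt5_bounds by simp
    ultimately have "ratio_bound\<^sup>2 * sig\<^sup>2 \<le> 1.5 * 1.3" by (intro mult_mono) auto
    also have "\<dots> \<le> (2::real)" by simp
    finally have "ratio_bound\<^sup>2 * sig\<^sup>2 \<le> 2" .
    then have "ratio_bound\<^sup>2 * sig\<^sup>2 / 4 \<le> 2 / 4" by (rule divide_right_mono) simp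
    with b1 have "64 / 81 * ((1 + cosedge) / 2) \<le> 2 / 4" by (rule order_trans)
    \<comment> \<open>Rounding \<open>cosedge\<close> down to \<open>2 / 5\<close> still leaves
      about 0.55, against the bound \<open>2 / 4\<close> from the other side.\<close>
    moreover have "64 / 81 * ((1 + 2 / 5) / 2) \<le> 64 / 81 * ((1 + cosedge) / 2)"
      using cosedge_bounds(1) by (intro mult_left_mono divide_right_mono add_left_mono) simp_all
    ultimately have "64 / 81 * ((1 + 2 / 5) / 2) \<le> (2 / 4 :: real)" by (rule order_trans[rotated])
    then show False by simp
  qed
qed

text \<open>Every maximiser is represented in a face whose cone contains \<open>c\<close>. By
  \<open>maximiser_on_side\<close> it involves only vertices that carry positive weight in
  \<open>c\<close>, and by \<open>face_support\<close> these are vertices of the fixed face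
  \<open>T\<close>.\<close>

lemma geo_maximisers:
  assumes "2 \<le> n" "norm c = 1"
  obtains T \<gamma> where "T \<in> faces" "c = (\<Sum>i\<in>UNIV. \<gamma> i *\<^sub>R T$i)" "\<And>i. 0 \<le> \<gamma> i"
    "{x \<in> geo n. \<forall>y\<in>geo n. c \<bullet> y \<le> c \<bullet> x} \<subseteq> smap T ` lattice n"
proof -
  have fin: "finite (geo n)" using assms(1) by (intro finite_geo) simp
  obtain S where "S \<in> faces" using faces_nonempty by blast
  moreover have "lattice n \<noteq> {}"
  proof -
    have "axis 1 1 \<in> lattice n" by (auto simp: lattice_def simp3_def axis_def)
    then show ?thesis by blast
  qed
  ultimately have ne: "geo n \<noteq> {}" by (auto simp: geo_def)
  have "Max ((\<bullet>) c ` geo n) \<in> (\<bullet>) c ` geo n" using fin ne by (intro Max_in) auto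
  then obtain x0 where x0: "x0 \<in> geo n" "c \<bullet> x0 = Max ((\<bullet>) c ` geo n)" by auto
  then have x0m: "c \<bullet> y \<le> c \<bullet> x0" if "y \<in> geo n" for y using that fin by (simp add: Max_ge)
  show ?thesis
  proof (rule maximiser_face[OF x0(1) x0m])
    fix T a \<gamma> assume T: "T \<in> faces" "a \<in> lattice n" "x0 = smap T a"
      and \<gamma>: "c = (\<Sum>i\<in>UNIV. \<gamma> i *\<^sub>R T$i)" "\<And>i. 0 \<le> \<gamma> i"
    show ?thesis
    proof (rule that[OF T(1) \<gamma>], rule subsetI)
      fix x assume "x \<in> {x \<in> geo n. \<forall>y\<in>geo n. c \<bullet> y \<le> c \<bullet> x}"
      then have x: "x \<in> geo n" "\<And>y. y \<in> geo n \<Longrightarrow> c \<bullet> y \<le> c \<bullet> x" by auto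
      show "x \<in> smap T ` lattice n"
      proof (rule maximiser_face[OF x])
        fix S b \<delta> assume S: "S \<in> faces" "b \<in> lattice n" "x = smap S b"
          and \<delta>: "c = (\<Sum>i\<in>UNIV. \<delta> i *\<^sub>R S$i)" "\<And>i. 0 \<le> \<delta> i"
        have bm: "c \<bullet> smap S z \<le> c \<bullet> smap S b" if "z \<in> lattice n" for z
        proof -
          have "smap S z \<in> geo n" using S(1) that unfolding geo_def by blast
          then show ?thesis using x(2) S(3) by simp
        qed
        have "S$j \<in> range (\<lambda>i. T$i)" if "0 < b$j" for j
        proof -
          have "\<delta> j \<noteq> 0" using maximiser_on_side[OF S(1) assms \<delta> S(2) bm, of j] that by auto
          then have "0 < \<delta> j" using \<delta>(2)[of j] by simp
          then show ?thesis by (rule face_support[OF S(1) T(1) \<delta> \<gamma>])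
        qed
        then show ?thesis unfolding S(3) by (intro smap_transfer faces_tri T S)
      qed
    qed
  qed
qed

section \<open>Mutually adjacent lattice points\<close>

definition adjacent :: "nat \<Rightarrow> real^3 \<Rightarrow> real^3 \<Rightarrow> bool" where
  "adjacent n a b \<longleftrightarrow> (\<exists>u v. u \<noteq> v \<and> real n *\<^sub>R (b - a) = axis u 1 - axis v 1)"

text \<open>The six steps from a lattice point lead to the corners of a hexagon. Two corners differ
  by another such step only if they are consecutive, and consecutive corners share an index in the
  same place.\<close>

lemma hex_difference:
  fixes u v u' v' p q :: 3
  assumes "u \<noteq> v" "u' \<noteq> v'" "p \<noteq> q" "axis u 1 - axis v 1 - (axis u' 1 - axis v' 1) = (axis p 1 - axis q 1 :: real^3)"
  shows "u = u' \<or> v = v'"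
proof (rule ccontr)
  assume h: "\<not> (u = u' \<or> v = v')"
  have c: "(axis u 1 - axis v 1 - (axis u' 1 - axis v' 1) :: real^3) $ i = (axis p 1 - axis q 1 :: real^3) $ i" for i
    using assms(4) by simp
  have pq: "(axis p 1 - axis q 1 :: real^3) $ i \<le> 1" "-1 \<le> (axis p 1 - axis q 1 :: real^3) $ i" for i
    by (auto simp: axis_def)
  have "v' \<noteq> u"
    using c[of u] pq(1)[of u] assms(1,2) h by (auto simp: axis_def split: if_splits)
  moreover have "u' \<noteq> v"
    using c[of v] pq(2)[of v] assms(1,2) h by (auto simp: axis_def split: if_splits)
  ultimately show False
    using distinct_indices[of u v u'] distinct_indices[of u v v'] h assms(1,2) by auto
qed

text \<open>All three pairs would have to share the same place; the other place then needs three
  distinct values different from the shared index, out of only two.\<close>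

lemma no_three_hexes:
  fixes u1 v1 u2 v2 u3 v3 :: 3
  assumes "u1 \<noteq> v1" "u2 \<noteq> v2" "u3 \<noteq> v3" "(u1, v1) \<noteq> (u2, v2)" "(u1, v1) \<noteq> (u3, v3)" "(u2, v2) \<noteq> (u3, v3)"
    "u1 = u2 \<or> v1 = v2" "u1 = u3 \<or> v1 = v3" "u2 = u3 \<or> v2 = v3"
  shows False
proof -
  have no: False if "a \<noteq> x" "b \<noteq> x" "c \<noteq> x" "a \<noteq> b" "a \<noteq> c" "b \<noteq> c" for a b c x :: 3
    using distinct_indices[of a b c] exhaust_3[of x] that by auto
  show ?thesis
    using no[of v1 u1 v2 v3] no[of u1 v1 u2 u3] assms by auto
qed

lemma adjacent_card:
  assumes "finite A" "\<And>a b. a \<in> A \<Longrightarrow> b \<in> A \<Longrightarrow> a \<noteq> b \<Longrightarrow> adjacent n a b" "0 < n"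
  shows "card A \<le> 3"
proof (rule ccontr)
  assume "\<not> card A \<le> 3"
  then have "4 \<le> card A" by simp
  then obtain a where a: "a \<in> A" by fastforce
  have "3 \<le> card (A - {a})" using \<open>4 \<le> card A\<close> a assms(1) by simp
  then obtain S where S: "S \<subseteq> A - {a}" "card S = 3" using obtain_subset_with_card_n by metis
  then obtain b c d where S3: "S = {b, c, d}" "b \<noteq> c" "b \<noteq> d" "c \<noteq> d" by (auto simp: card_3_iff)
  have mem: "b \<in> A" "c \<in> A" "d \<in> A" "a \<noteq> b" "a \<noteq> c" "a \<noteq> d" using S(1) S3(1) by auto
  have hex: "\<exists>u v. u \<noteq> v \<and> real n *\<^sub>R (y - x) = axis u 1 - axis v 1" if "x \<in> A" "y \<in> A" "x \<noteq> y" for x y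
    using assms(2)[OF that] by (simp add: adjacent_def)
  obtain u1 v1 where 1: "u1 \<noteq> v1" "real n *\<^sub>R (b - a) = axis u1 1 - axis v1 1" using hex[OF a mem(1,4)] by blast
  obtain u2 v2 where 2: "u2 \<noteq> v2" "real n *\<^sub>R (c - a) = axis u2 1 - axis v2 1" using hex[OF a mem(2,5)] by blast
  obtain u3 v3 where 3: "u3 \<noteq> v3" "real n *\<^sub>R (d - a) = axis u3 1 - axis v3 1" using hex[OF a mem(3,6)] by blast
  have share: "u = u' \<or> v = v'" if h: "x \<in> A" "y \<in> A" "x \<noteq> y" "u \<noteq> v" "u' \<noteq> v'"
    "real n *\<^sub>R (y - a) = axis u 1 - axis v 1" "real n *\<^sub>R (x - a) = axis u' 1 - axis v' 1" for x y u v u' v'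
  proof -
    obtain p q where pq: "p \<noteq> q" "real n *\<^sub>R (y - x) = axis p 1 - axis q 1" using hex[OF h(1-3)] by blast
    have "real n *\<^sub>R (y - x) = real n *\<^sub>R (y - a) - real n *\<^sub>R (x - a)" by (simp add: algebra_simps)
    then have "axis u 1 - axis v 1 - (axis u' 1 - axis v' 1) = (axis p 1 - axis q 1 :: real^3)" by (simp only: h(6,7) pq(2))
    then show ?thesis using hex_difference[OF h(4,5) pq(1)] by blast
  qed
  have inj: "x = y" if "real n *\<^sub>R (x - a) = real n *\<^sub>R (y - a)" for x y :: "real^3" using that assms(3) by simp
  show False
  proof (rule no_three_hexes[OF 1(1) 2(1) 3(1)])
    show "(u1, v1) \<noteq> (u2, v2)" using inj[of b c] 1(2) 2(2) S3(2) by auto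
    show "(u1, v1) \<noteq> (u3, v3)" using inj[of b d] 1(2) 3(2) S3(3) by auto
    show "(u2, v2) \<noteq> (u3, v3)" using inj[of c d] 2(2) 3(2) S3(4) by auto
    show "u1 = u2 \<or> v1 = v2" using share[OF mem(2,1) _ 1(1) 2(1) 1(2) 2(2)] S3(2) by blast
    show "u1 = u3 \<or> v1 = v3" using share[OF mem(3,1) _ 1(1) 3(1) 1(2) 3(2)] S3(3) by blast
    show "u2 = u3 \<or> v2 = v3" using share[OF mem(3,2) _ 2(1) 3(1) 2(2) 3(2)] S3(4) by blast
  qed
qed

text \<open>For a nonzero \<open>c\<close>, these are the points of \<open>X\<close> on its
  supporting plane with outer normal \<open>c\<close>.\<close>

definition top :: "(real^3) set \<Rightarrow> real^3 \<Rightarrow> (real^3) set" where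
  "top X c = {x \<in> X. \<forall>y\<in>X. c \<bullet> y \<le> c \<bullet> x}"

lemma support_adjacent':
  assumes "tri T"
  shows "\<exists>N. \<forall>n\<ge>N. \<forall>c \<gamma> a b. norm c = 1 \<longrightarrow> c = (\<Sum>i\<in>UNIV. \<gamma> i *\<^sub>R T$i) \<longrightarrow> (\<forall>i. 0 \<le> \<gamma> i) \<longrightarrow>
    a \<in> lattice n \<longrightarrow> b \<in> lattice n \<longrightarrow> (\<forall>x\<in>lattice n. c \<bullet> smap T x \<le> c \<bullet> smap T a) \<longrightarrow>
    (\<forall>x\<in>lattice n. c \<bullet> smap T x \<le> c \<bullet> smap T b) \<longrightarrow> a \<noteq> b \<longrightarrow> adjacent n a b"
proof (rule support_adjacent[OF assms])
  fix N
  assume *: "\<And>n c \<gamma> a b. N \<le> n \<Longrightarrow> norm c = 1 \<Longrightarrow> c = (\<Sum>i\<in>UNIV. \<gamma> i *\<^sub>R T$i) \<Longrightarrow> (\<And>i. 0 \<le> \<gamma> i) \<Longrightarrow>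
    a \<in> lattice n \<Longrightarrow> b \<in> lattice n \<Longrightarrow> (\<And>x. x \<in> lattice n \<Longrightarrow> c \<bullet> smap T x \<le> c \<bullet> smap T a) \<Longrightarrow>
    (\<And>x. x \<in> lattice n \<Longrightarrow> c \<bullet> smap T x \<le> c \<bullet> smap T b) \<Longrightarrow> a \<noteq> b \<Longrightarrow>
    \<exists>u v. u \<noteq> v \<and> real n *\<^sub>R (b - a) = axis u 1 - axis v 1"
  show ?thesis
  proof (intro exI[of _ N] allI impI)
    fix n c \<gamma> a b
    assume h: "N \<le> n" "norm c = 1" "c = (\<Sum>i\<in>UNIV. \<gamma> i *\<^sub>R T$i)" "\<forall>i. 0 \<le> \<gamma> i" "a \<in> lattice n" "b \<in> lattice n"
      "\<forall>x\<in>lattice n. c \<bullet> smap T x \<le> c \<bullet> smap T a" "\<forall>x\<in>lattice n. c \<bullet> smap T x \<le> c \<bullet> smap T b" "a \<noteq> b"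
    show "adjacent n a b"
      unfolding adjacent_def
      by (rule *[OF h(1-3) spec[OF h(4)] h(5,6) bspec[OF h(7)] bspec[OF h(8)] h(9)])
  qed
qed

lemma edge_length_lower':
  assumes "tri T"
  shows "\<exists>C\<ge>0. \<forall>n>0. \<forall>a\<in>lattice n. \<forall>b\<in>lattice n. adjacent n a b \<longrightarrow> (sig - C / n) / n \<le> dist (smap T a) (smap T b)"
proof (rule edge_length_lower[OF assms])
  fix C :: real
  assume *: "0 \<le> C" "\<And>n a b u v. 0 < n \<Longrightarrow> a \<in> lattice n \<Longrightarrow> b \<in> lattice n \<Longrightarrow> u \<noteq> v \<Longrightarrow>
    real n *\<^sub>R (b - a) = axis u 1 - axis v 1 \<Longrightarrow> (sig - C / n) / n \<le> dist (smap T a) (smap T b)"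
  show ?thesis
    unfolding adjacent_def using * by (intro exI[of _ C] conjI allI ballI impI) (auto simp del: scaleR_right_diff_distrib)
qed

text \<open>Since \<open>faces\<close> is finite, maxima over it turn the thresholds and constants
  for single faces into uniform ones.\<close>

lemma top_geo:
  obtains N C where "0 \<le> C" "2 \<le> N"
    "\<And>n c. N \<le> n \<Longrightarrow> norm c = 1 \<Longrightarrow> card (top (geo n) c) \<le> 3"
    "\<And>n c x y. N \<le> n \<Longrightarrow> norm c = 1 \<Longrightarrow> x \<in> top (geo n) c \<Longrightarrow> y \<in> top (geo n) c \<Longrightarrow> x \<noteq> y \<Longrightarrow>
      (sig - C / n) / n \<le> dist x y \<and> dist x y \<le> ratio_bound * sig / n"
proof -
  define P where "P T N \<longleftrightarrow> (\<forall>n\<ge>N. \<forall>c \<gamma> a b. norm c = 1 \<longrightarrow> c = (\<Sum>i\<in>UNIV. \<gamma> i *\<^sub>R T$i) \<longrightarrow> (\<forall>i. 0 \<le> \<gamma> i) \<longrightarrow>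
    a \<in> lattice n \<longrightarrow> b \<in> lattice n \<longrightarrow> (\<forall>x\<in>lattice n. c \<bullet> smap T x \<le> c \<bullet> smap T a) \<longrightarrow>
    (\<forall>x\<in>lattice n. c \<bullet> smap T x \<le> c \<bullet> smap T b) \<longrightarrow> a \<noteq> b \<longrightarrow> adjacent n a b)" for T N
  have "\<forall>T\<in>faces. \<exists>N. P T N" unfolding P_def using support_adjacent' faces_tri by blast
  then obtain fN where fN: "\<And>T. T \<in> faces \<Longrightarrow> P T (fN T)" by metis
  define Q where "Q T C \<longleftrightarrow> (\<forall>n>0. \<forall>a\<in>lattice n. \<forall>b\<in>lattice n. adjacent n a b \<longrightarrow>
     (sig - C / real n) / real n \<le> dist (smap T a) (smap T b))" for T C
  have "\<forall>T\<in>faces. \<exists>C\<ge>0. Q T C" unfolding Q_def using edge_length_lower' faces_tri by blast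
  then obtain fC where fC: "\<And>T. T \<in> faces \<Longrightarrow> 0 \<le> fC T" "\<And>T. T \<in> faces \<Longrightarrow> Q T (fC T)" by metis
  define N where "N = Max (insert 2 (fN ` faces))"
  define C where "C = Max (insert 0 (fC ` faces))"
  have NT: "fN T \<le> N" if "T \<in> faces" for T
    unfolding N_def using finite_faces that by (auto intro!: Max_ge)
  have N2: "2 \<le> N" unfolding N_def using finite_faces by (auto intro!: Max_ge)
  have C0: "0 \<le> C" unfolding C_def using finite_faces by (auto intro!: Max_ge)
  have CT: "fC T \<le> C" if "T \<in> faces" for T
    unfolding C_def using finite_faces that by (auto intro!: Max_ge)
  have main: "\<exists>T\<in>faces. \<exists>A\<subseteq>lattice n. top (geo n) c = smap T ` A \<and> (\<forall>a\<in>A. \<forall>b\<in>A. a \<noteq> b \<longrightarrow> adjacent n a b)"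
    if n: "N \<le> n" and c: "norm c = 1" for n c
  proof -
    have n2: "2 \<le> n" using n N2 by simp
    show ?thesis
    proof (rule geo_maximisers[OF n2 c])
      fix T \<gamma> assume T: "T \<in> faces" "c = (\<Sum>i\<in>UNIV. \<gamma> i *\<^sub>R T$i)" "\<And>i. 0 \<le> \<gamma> i"
        and sub: "{x \<in> geo n. \<forall>y\<in>geo n. c \<bullet> y \<le> c \<bullet> x} \<subseteq> smap T ` lattice n"
      define A where "A = {a \<in> lattice n. smap T a \<in> top (geo n) c}"
      have "top (geo n) c = smap T ` A" using sub unfolding A_def top_def by blast
      moreover have "adjacent n a b" if "a \<in> A" "b \<in> A" "a \<noteq> b" for a b
      proof -
        have g: "smap T x \<in> geo n" if "x \<in> lattice n" for x
          unfolding geo_def by (rule UN_I[OF T(1)]) (rule imageI[OF that])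
        have "\<forall>x\<in>lattice n. c \<bullet> smap T x \<le> c \<bullet> smap T a" "\<forall>x\<in>lattice n. c \<bullet> smap T x \<le> c \<bullet> smap T b"
          using that g by (auto simp: A_def top_def)
        moreover have "a \<in> lattice n" "b \<in> lattice n" using that by (auto simp: A_def)
        moreover have "fN T \<le> n" using NT[OF T(1)] n by simp
        ultimately show ?thesis using fN[OF T(1)] c T(2,3) that(3) unfolding P_def by blast
      qed
      moreover have "A \<subseteq> lattice n" by (auto simp: A_def)
      ultimately show ?thesis using T(1) by blast
    qed
  qed
  show ?thesis
  proof (rule that[OF C0 N2])
    fix n and c :: "real^3" assume n: "N \<le> n" and c: "norm c = 1"
    have n0: "0 < n" using n N2 by simp
    obtain T A where TA: "T \<in> faces" "A \<subseteq> lattice n" "top (geo n) c = smap T ` A"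
      "\<forall>a\<in>A. \<forall>b\<in>A. a \<noteq> b \<longrightarrow> adjacent n a b" using main[OF n c] by blast
    have fin: "finite A" using TA(2) finite_lattice[OF n0] by (rule finite_subset)
    have "card (smap T ` A) \<le> card A" using fin by (rule card_image_le)
    also have "\<dots> \<le> 3" using adjacent_card[OF fin _ n0] TA(4) by blast
    finally show "card (top (geo n) c) \<le> 3" unfolding TA(3) .
    fix x y assume xy: "x \<in> top (geo n) c" "y \<in> top (geo n) c" "x \<noteq> y"
    then obtain a b where ab: "a \<in> A" "b \<in> A" "x = smap T a" "y = smap T b" unfolding TA(3) by blast
    have "a \<noteq> b" using xy(3) ab by auto
    then have adj: "adjacent n a b" using TA(4) ab by blast
    have L: "a \<in> lattice n" "b \<in> lattice n" using ab TA(2) by auto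
    have "(sig - C / n) / n \<le> (sig - fC T / n) / n"
      using CT[OF TA(1)] n0 by (intro divide_right_mono diff_left_mono) auto
    also have "\<dots> \<le> dist x y" using fC(2)[OF TA(1)] n0 L adj unfolding Q_def ab by blast
    finally have "(sig - C / n) / n \<le> dist x y" .
    moreover obtain u v where "u \<noteq> v" "real n *\<^sub>R (b - a) = axis u 1 - axis v 1"
      using adj unfolding adjacent_def by blast
    then have "dist x y \<le> ratio_bound * sig / n"
      unfolding ab by (rule edge_length_upper[OF faces_tri[OF TA(1)] n0 L])
    ultimately show "(sig - C / n) / n \<le> dist x y \<and> dist x y \<le> ratio_bound * sig / n" by simp
  qed
qed

section \<open>The convex hull as a polyhedron with triangular faces\<close>

lemma edge_segment:
  fixes P :: "'a::euclidean_space set"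
  assumes "polytope P" "e edge_of P"
  obtains a b where "a \<noteq> b" "e = closed_segment a b" "a extreme_point_of P" "b extreme_point_of P"
    "diameter e = dist a b"
proof -
  have f: "e face_of P" "aff_dim e = 1" using assms(2) by (auto simp: edge_of_def)
  have pe: "polytope e" using face_of_polytope_polytope[OF assms(1) f(1)] .
  have "e \<noteq> {}" using f(2) by auto
  moreover have "collinear e" using f(2) by (simp add: collinear_aff_dim)
  ultimately obtain a b where ab: "e = closed_segment a b"
    using compact_convex_collinear_segment[OF _ polytope_imp_compact[OF pe] polytope_imp_convex[OF pe]] by blast
  have ne: "a \<noteq> b" using f(2) ab by auto
  have ext: "a extreme_point_of e" "b extreme_point_of e"
    unfolding ab by (simp_all add: extreme_point_of_segment)
  have "diameter e = dist a b"
  proof (rule antisym)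
    show "diameter e \<le> dist a b"
    proof (rule diameter_le)
      fix x y assume "x \<in> e" "y \<in> e"
      then obtain s t where st: "0 \<le> s" "s \<le> 1" "x = (1 - s) *\<^sub>R a + s *\<^sub>R b" "0 \<le> t" "t \<le> 1" "y = (1 - t) *\<^sub>R a + t *\<^sub>R b"
        unfolding ab in_segment by blast
      have "x - y = (t - s) *\<^sub>R (a - b)" unfolding st(3,6) by (simp add: algebra_simps)
      then have "norm (x - y) = \<bar>t - s\<bar> * norm (a - b)" by simp
      also have "\<dots> \<le> 1 * norm (a - b)" using st by (intro mult_right_mono) auto
      finally show "norm (x - y) \<le> dist a b" by (simp add: dist_norm)
    qed (simp add: ab)
    show "dist a b \<le> diameter e"
      using diameter_bounded_bound[OF polytope_imp_bounded[OF pe], of a b] ab by simp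
  qed
  moreover have "a extreme_point_of P" "b extreme_point_of P"
    using ext extreme_point_of_face[OF f(1)] by simp_all
  ultimately show ?thesis using ne ab by (intro that)
qed

text \<open>Faces of polytopes are exposed. This reduces all questions about facets and edges of the
  hull to \<open>top\<close>.\<close>

lemma face_top:
  fixes X :: "(real^3) set"
  assumes "finite X" "F face_of (convex hull X)" "F \<noteq> {}" "F \<noteq> convex hull X"
  obtains c where "norm c = 1" "F \<inter> X = top X c" "F = convex hull (F \<inter> X)"
proof -
  have "polyhedron (convex hull X)" using assms(1) by (simp add: polytope_convex_hull polytope_imp_polyhedron finite_imp_compact)
  then have "F exposed_face_of (convex hull X)" using assms(2) exposed_face_of_polyhedron by blast
  then obtain a b where ab: "a \<noteq> 0" "convex hull X \<subseteq> {x. a \<bullet> x \<le> b}" "F = convex hull X \<inter> {x. a \<bullet> x = b}"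
    using assms(3,4) unfolding exposed_face_of by blast
  obtain S where S: "S \<subseteq> X" "F = convex hull S"
    using face_of_convex_hull_subset[OF finite_imp_compact[OF assms(1)] assms(2)] by blast
  have FX: "F = convex hull (F \<inter> X)"
  proof
    have "S \<subseteq> F \<inter> X" using S hull_subset[of S convex] by blast
    then show "F \<subseteq> convex hull (F \<inter> X)" unfolding S(2) by (rule hull_mono)
    have "convex F" using assms(2) face_of_imp_convex convex_convex_hull by blast
    then show "convex hull (F \<inter> X) \<subseteq> F" by (intro hull_minimal) auto
  qed
  have "F \<inter> X \<noteq> {}" using assms(3) FX by (metis convex_hull_empty)
  then obtain x0 where x0: "x0 \<in> F" "x0 \<in> X" by blast
  have Xh: "x \<in> convex hull X" if "x \<in> X" for x using that by (rule hull_inc)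
  define c where "c = a /\<^sub>R norm a"
  have ca: "c \<bullet> x \<le> c \<bullet> y \<longleftrightarrow> a \<bullet> x \<le> a \<bullet> y" for x y using ab(1) by (simp add: c_def)
  have "F \<inter> X = top X c"
  proof (intro equalityI subsetI)
    fix x assume "x \<in> F \<inter> X"
    then show "x \<in> top X c" using ab(2,3) Xh unfolding top_def ca by auto
  next
    fix x assume "x \<in> top X c"
    then have "x \<in> X" "a \<bullet> x0 \<le> a \<bullet> x" using x0 unfolding top_def ca by auto
    then show "x \<in> F \<inter> X" using ab(2,3) Xh[of x] x0 by auto
  qed
  moreover have "norm c = 1" using ab(1) by (simp add: c_def)
  ultimately show ?thesis using FX by (intro that)
qed

lemma tri_in_geo:
  assumes "T \<in> faces" "0 < n" shows "T$i \<in> geo n"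
proof -
  have "axis i 1 \<in> lattice n"
    using exhaust_3[of i] by (auto simp: lattice_def simp3_def axis_def)
  moreover have "smap T (axis i 1) = T$i"
  proof -
    have "fmap T (axis i 1) = (\<Sum>j\<in>UNIV. if j = i then prof 1 *\<^sub>R T$j else 0)"
      unfolding fmap_def by (intro sum.cong refl) (simp add: axis_def)
    then have "fmap T (axis i 1) = prof 1 *\<^sub>R T$i" by simp
    moreover have "0 < prof 1" by (rule prof_pos) auto
    ultimately show ?thesis using tri_norm[OF faces_tri[OF assms(1)], of i] by (simp add: smap_def)
  qed
  ultimately show ?thesis using UN_I[OF assms(1), of "T$i" "\<lambda>T. smap T ` lattice n"] imageI[of "axis i 1" "lattice n" "smap T"]
    unfolding geo_def by simp
qed

text \<open>Along with a vertex its antipode belongs to \<open>geo n\<close>, so 0 is in the affine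
  hull, which is then a linear span and contains the vertices of a face as a basis of the
  space.\<close>

lemma aff_dim_geo:
  assumes "0 < n" shows "aff_dim (geo n) = 3"
proof -
  obtain T where T: "T \<in> faces" using faces_nonempty by blast
  define S :: "real^3^3" where "S = (\<chi> i. - (T$i))"
  have "S \<in> faces" using T ico_uminus by (auto simp: S_def faces_def tri_def)
  then have "S$1 \<in> geo n" using assms by (rule tri_in_geo)
  then have "- (T$1) \<in> affine hull geo n" "T$1 \<in> affine hull geo n"
    using tri_in_geo[OF T assms, of 1] by (auto simp: S_def intro: hull_inc)
  then have "(1/2) *\<^sub>R (T$1) + (1/2) *\<^sub>R (- (T$1)) \<in> affine hull geo n"
    by (intro mem_affine affine_affine_hull) auto
  then have "0 \<in> affine hull geo n" by simp
  then have sp: "affine hull geo n = span (geo n)" by (rule affine_hull_span_0)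
  have "c \<in> span (geo n)" for c
  proof (rule tri_span[OF faces_tri[OF T], of c])
    fix \<gamma> assume c: "c = (\<Sum>i\<in>UNIV. \<gamma> i *\<^sub>R T$i)"
    show "c \<in> span (geo n)"
      unfolding c by (intro span_sum span_scale span_base tri_in_geo[OF T assms])
  qed
  then have "affine hull geo n = UNIV" unfolding sp by blast
  then show ?thesis using aff_dim_eq_full[of "geo n"] by simp
qed

text \<open>The points of a single side are enough: the bound only has to drive the number of faces
  to infinity.\<close>

lemma card_geo:
  assumes "0 < n" shows "n + 1 \<le> card (geo n)"
proof -
  obtain T where T: "T \<in> faces" using faces_nonempty by blast
  define q :: "nat \<Rightarrow> real^3" where "q i = vector [real i / n, 1 - real i / n, 0]" for i
  have q: "q i $ 1 = real i / n" "q i $ 2 = 1 - real i / n" "q i $ 3 = 0" for i by (simp_all add: q_def)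
  have qL: "q i \<in> lattice n" if "i \<le> n" for i
    using that assms unfolding lattice_def simp3_def mem_Collect_eq forall_3 q by (simp add: right_diff_distrib)
  have "inj_on (\<lambda>i. smap T (q i)) {..n}"
  proof (rule inj_onI)
    fix i j assume ij: "i \<in> {..n}" "j \<in> {..n}" "smap T (q i) = smap T (q j)"
    then have "q i = q j"
      using inj_onD[OF inj_on_smap[OF faces_tri[OF T]] ij(3)] lattice_simp3[OF qL] by simp
    then have "real i / n = real j / n" using q(1) by metis
    then show "i = j" using assms by simp
  qed
  then have "card ((\<lambda>i. smap T (q i)) ` {..n}) = n + 1" by (simp add: card_image)
  moreover have "(\<lambda>i. smap T (q i)) ` {..n} \<subseteq> geo n"
    using T qL unfolding geo_def by auto
  ultimately show ?thesis using card_mono[OF finite_geo[OF assms]] by metis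
qed

text \<open>A facet is two-dimensional and so contains at least three points of
  \<open>geo n\<close>; \<open>card3\<close> permits no more, which makes it a triangle. Points of
  norm 1 are not interior, so the facets cover \<open>geo n\<close>, and
  \<open>n + 1 \<le> 3 * m\<close> follows.\<close>

lemma geodesic_polyhedron:
  assumes n: "0 < n" and card3: "\<And>c. norm c = 1 \<Longrightarrow> card (top (geo n) c) \<le> 3"
    and dist: "\<And>c x y. norm c = 1 \<Longrightarrow> x \<in> top (geo n) c \<Longrightarrow> y \<in> top (geo n) c \<Longrightarrow> x \<noteq> y \<Longrightarrow>
      lo \<le> dist x y \<and> dist x y \<le> hi" and lo: "0 < lo" "0 \<le> hi"
  defines "P \<equiv> convex hull (geo n)"
  obtains m where "n + 1 \<le> 3 * m" "convex_polyhedron P" "inscribed_in_unit_sphere P" "has_triangular_faces m P"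
    "edge_ratio P \<le> hi / lo"
proof -
  have fin: "finite (geo n)" using finite_geo[OF n] .
  have poly: "polytope P" unfolding P_def using fin by (simp add: polytope_convex_hull)
  have dimP: "aff_dim P = 3" unfolding P_def aff_dim_convex_hull by (rule aff_dim_geo[OF n])
  have cp: "convex_polyhedron P" using poly dimP by (simp add: convex_polyhedron_def)
  have ins: "inscribed_in_unit_sphere P"
    unfolding inscribed_in_unit_sphere_def
  proof (intro exI[of _ 0] subsetI)
    fix v assume "v \<in> {v. v extreme_point_of P}"
    then have "v \<in> geo n" unfolding P_def by (auto dest: extreme_point_of_convex_hull)
    then show "v \<in> sphere 0 1" using norm_geo by simp
  qed
  have facet: "2 simplex F \<and> card (F \<inter> geo n) = 3" if F: "F facet_of P" for F
  proof -
    have f: "F face_of P" "F \<noteq> {}" "aff_dim F = 2" using F dimP by (auto simp: facet_of_def)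
    have nP: "F \<noteq> P" using f(3) dimP by auto
    obtain c where c: "norm c = 1" "F \<inter> geo n = top (geo n) c" "F = convex hull (F \<inter> geo n)"
      by (rule face_top[OF fin f(1)[unfolded P_def] f(2) nP[unfolded P_def]]) (rule that; assumption)
    have fs: "finite (F \<inter> geo n)" using fin by blast
    have ad: "aff_dim (F \<inter> geo n) = 2" using f(3) c(3) aff_dim_convex_hull by metis
    have "aff_dim (F \<inter> geo n) \<le> of_nat (card (F \<inter> geo n)) - 1" by (rule aff_dim_le_card[OF fs])
    then have "3 \<le> card (F \<inter> geo n)" unfolding ad by simp
    then have c3: "card (F \<inter> geo n) = 3" using card3[OF c(1)] c(2) by simp
    then have "\<not> affine_dependent (F \<inter> geo n)" using ad fs by (simp add: affine_independent_iff_card)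
    then have "2 simplex F"
      unfolding simplex_def by (intro exI[of _ "F \<inter> geo n"] conjI c(3)) (simp_all add: c3)
    then show ?thesis using c3 ..
  qed
  have finF: "finite {F. F facet_of P}" using poly by (rule finite_polytope_facets)
  define m where "m = card {F. F facet_of P}"
  have cover: "geo n \<subseteq> (\<Union>F\<in>{F. F facet_of P}. F \<inter> geo n)"
  proof
    fix x assume x: "x \<in> geo n"
    have "P \<subseteq> cball 0 1"
      unfolding P_def using norm_geo by (intro hull_minimal) auto
    then have "interior P \<subseteq> ball 0 1" using interior_mono[of P "cball 0 1"] by simp
    then have "x \<notin> interior P" using norm_geo[OF x] by auto
    moreover have "rel_interior P = interior P"
      using dimP by (intro rel_interior_interior) (simp add: aff_dim_eq_full[symmetric])
    moreover have "x \<in> P" unfolding P_def using x by (rule hull_inc)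
    ultimately have "x \<in> rel_frontier P" unfolding rel_frontier_def using closure_subset by blast
    then show "x \<in> (\<Union>F\<in>{F. F facet_of P}. F \<inter> geo n)"
      using rel_frontier_of_polyhedron[OF polytope_imp_polyhedron[OF poly]] x by blast
  qed
  have "n + 1 \<le> card (geo n)" by (rule card_geo[OF n])
  also have "\<dots> \<le> card (\<Union>F\<in>{F. F facet_of P}. F \<inter> geo n)"
    using cover fin finF by (intro card_mono) auto
  also have "\<dots> \<le> (\<Sum>F\<in>{F. F facet_of P}. card (F \<inter> geo n))" by (rule card_UN_le[OF finF])
  also have "\<dots> = (\<Sum>F\<in>{F. F facet_of P}. 3)" using facet by (intro sum.cong) auto
  also have "\<dots> = 3 * m" by (simp add: m_def)
  finally have nm: "n + 1 \<le> 3 * m" .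
  then have "0 < m" by simp
  then have "{F. F facet_of P} \<noteq> {}" unfolding m_def by (simp add: card_gt_0_iff)
  then obtain F where F: "F facet_of P" by blast
  have bounds: "lo \<le> l \<and> l \<le> hi" if "l \<in> edge_lengths P" for l
  proof -
    obtain e where e: "e edge_of P" "l = diameter e" using \<open>l \<in> edge_lengths P\<close> unfolding edge_lengths_def by blast
    show ?thesis
    proof (rule edge_segment[OF poly e(1)])
      fix a b assume ab: "a \<noteq> b" "e = closed_segment a b" "a extreme_point_of P" "b extreme_point_of P"
        "diameter e = dist a b"
      have f: "e face_of P" "aff_dim e = 1" using e(1) by (auto simp: edge_of_def)
      have nP: "e \<noteq> P" "e \<noteq> {}" using f(2) dimP ab(2) by auto
      obtain c where c: "norm c = 1" "e \<inter> geo n = top (geo n) c"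
        by (rule face_top[OF fin f(1)[unfolded P_def] nP(2) nP(1)[unfolded P_def]]) (rule that; assumption)
      have "a \<in> geo n" "b \<in> geo n" using ab(3,4) unfolding P_def by (auto dest: extreme_point_of_convex_hull)
      moreover have "a \<in> e" "b \<in> e" unfolding ab(2) by simp_all
      ultimately have "a \<in> top (geo n) c" "b \<in> top (geo n) c" unfolding c(2)[symmetric] by blast+
      then have "lo \<le> dist a b \<and> dist a b \<le> hi" using ab(1) by (rule dist[OF c(1)])
      then show ?thesis unfolding e(2) ab(5) .
    qed
  qed
  have finE: "finite (edge_lengths P)"
  proof -
    have "{e. e edge_of P} \<subseteq> {e. e face_of P}" by (auto simp: edge_of_def)
    then have "finite {e. e edge_of P}" using finite_polytope_faces[OF poly] by (rule finite_subset)
    then show ?thesis unfolding edge_lengths_def by (rule finite_imageI)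
  qed
  have neE: "edge_lengths P \<noteq> {}"
  proof -
    have "2 simplex F" using facet[OF F] ..
    then obtain C where C: "\<not> affine_dependent C" "int (card C) = 2 + 1" "F = convex hull C"
      unfolding simplex_def by blast
    then have "card C = 3" by simp
    then obtain a b c where abc: "C = {a, b, c}" "a \<noteq> b" by (auto simp: card_3_iff)
    have "(convex hull {a, b}) face_of F"
      unfolding C(3) face_of_convex_hull_affine_independent[OF C(1)]
      by (rule exI[of _ "{a, b}"]) (simp add: abc(1))
    moreover have "F face_of P" using F by (simp add: facet_of_def)
    ultimately have "(convex hull {a, b}) face_of P" by (rule face_of_trans)
    moreover have "aff_dim (convex hull {a, b}) = 1" unfolding aff_dim_convex_hull aff_dim_2 using abc(2) by simp
    ultimately have "(convex hull {a, b}) edge_of P" by (simp add: edge_of_def)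
    then show ?thesis unfolding edge_lengths_def by blast
  qed
  have "Max (edge_lengths P) \<le> hi" using bounds by (intro Max.boundedI[OF finE neE]) blast
  moreover have "lo \<le> Min (edge_lengths P)" using bounds by (intro Min.boundedI[OF finE neE]) blast
  ultimately have "edge_ratio P \<le> hi / lo"
    unfolding edge_ratio_def using lo by (intro frac_le) auto
  moreover have "has_triangular_faces m P" using facet by (auto simp: has_triangular_faces_def m_def)
  ultimately show ?thesis using nm cp ins by (intro that)
qed

lemma liminf_upper: "liminf inf_edge_ratio \<le> ereal ratio_bound"
proof (rule ereal_le_epsilon2)
  fix \<epsilon> :: real assume \<epsilon>: "0 < \<epsilon>"
  show "liminf inf_edge_ratio \<le> ereal ratio_bound + ereal \<epsilon>"
  proof (rule top_geo)
    fix N C assume C: "0 \<le> C" and N: "2 \<le> N"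
      and card3: "\<And>n c. N \<le> n \<Longrightarrow> norm c = 1 \<Longrightarrow> card (top (geo n) c) \<le> 3"
      and dist: "\<And>n c x y. N \<le> n \<Longrightarrow> norm c = 1 \<Longrightarrow> x \<in> top (geo n) c \<Longrightarrow> y \<in> top (geo n) c \<Longrightarrow> x \<noteq> y \<Longrightarrow>
        (sig - C / n) / n \<le> dist x y \<and> dist x y \<le> ratio_bound * sig / n"
    \<comment> \<open>Lowering the bound for the shortest edge from \<open>sig\<close> to
      \<open>sig - \<theta>\<close> raises the ratio by exactly \<open>\<epsilon>\<close>.\<close>
    define \<theta> where "\<theta> = sig * \<epsilon> / (ratio_bound + \<epsilon>)"
    have \<theta>: "0 < \<theta>" "\<theta> < sig" "ratio_bound * sig / (sig - \<theta>) = ratio_bound + \<epsilon>"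
    proof -
      have r: "0 < ratio_bound + \<epsilon>" using ratio_bound_pos \<epsilon> by simp
      show "0 < \<theta>" using r sig_pos \<epsilon> by (simp add: \<theta>_def)
      show "\<theta> < sig" using r sig_pos ratio_bound_pos by (simp add: \<theta>_def field_simps)
      have "sig - \<theta> = ratio_bound * sig / (ratio_bound + \<epsilon>)" using r by (simp add: \<theta>_def field_simps)
      then show "ratio_bound * sig / (sig - \<theta>) = ratio_bound + \<epsilon>"
        using r sig_pos ratio_bound_pos by simp
    qed
    obtain N1 :: nat where N1: "C / \<theta> < N1" using reals_Archimedean2 by blast
    have "\<exists>m\<ge>M. inf_edge_ratio m \<le> ereal (ratio_bound + \<epsilon>)" for M
    proof -
      \<comment> \<open>\<open>N1\<close> achieves \<open>C / n < \<theta>\<close>, and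
        \<open>3 * M\<close> gives \<open>M \<le> m\<close> through
        \<open>n + 1 \<le> 3 * m\<close>.\<close>
      define n where "n = N + N1 + 3 * M"
      have n: "N \<le> n" "0 < n" "3 * M \<le> n" "C / \<theta> < n" using N N1 by (auto simp: n_def)
      have Cn: "C / n < \<theta>" using n(2,4) \<theta>(1) by (simp add: field_simps)
      define lo hi where "lo = (sig - \<theta>) / n" and "hi = ratio_bound * sig / n"
      have lohi: "0 < lo" "0 \<le> hi" "hi / lo = ratio_bound + \<epsilon>"
        using n(2) \<theta> ratio_bound_pos sig_pos by (auto simp: lo_def hi_def)
      have le: "lo \<le> (sig - C / n) / n" unfolding lo_def using Cn n(2) by (intro divide_right_mono) auto
      have d: "lo \<le> dist x y \<and> dist x y \<le> hi"
        if "norm c = 1" "x \<in> top (geo n) c" "y \<in> top (geo n) c" "x \<noteq> y" for c x y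
        using dist[OF n(1) that] le unfolding hi_def by linarith
      show ?thesis
      proof (rule geodesic_polyhedron[OF n(2) card3[OF n(1)] d lohi(1,2)])
        fix m assume m: "n + 1 \<le> 3 * m" and P: "convex_polyhedron (convex hull geo n)"
          "inscribed_in_unit_sphere (convex hull geo n)" "has_triangular_faces m (convex hull geo n)"
          and r: "edge_ratio (convex hull geo n) \<le> hi / lo"
        have "inf_edge_ratio m \<le> ereal (edge_ratio (convex hull geo n))"
          unfolding inf_edge_ratio_def using P by (intro INF_lower) simp
        also have "\<dots> \<le> ereal (ratio_bound + \<epsilon>)" using r lohi(3) by simp
        finally have "inf_edge_ratio m \<le> ereal (ratio_bound + \<epsilon>)" .
        moreover have "M \<le> m" using m n(3) by simp
        ultimately show ?thesis by blast
      qed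
    qed
    then have "liminf inf_edge_ratio \<le> ereal (ratio_bound + \<epsilon>)"
      unfolding liminf_SUP_INF by (intro SUP_least) (meson INF_lower2 atLeast_iff)
    then show ?thesis by simp
  qed
qed

section \<open>A vertex with at most five faces\<close>

text \<open>For a cone with apex 0 this is proportional to its solid angle.\<close>

abbreviation bvol :: "(real^3) set \<Rightarrow> real" where
  "bvol S \<equiv> measure lebesgue (S \<inter> ball 0 1)"

lemma bvol_measurable: "open S \<Longrightarrow> S \<inter> ball 0 1 \<in> lmeasurable" for S :: "(real^3) set"
  by (intro lmeasurable_open bounded_Int) auto

lemma bvol_uminus:
  assumes "open S" shows "bvol (uminus ` S) = bvol S"
proof -
  have "orthogonal_transformation (uminus :: real^3 \<Rightarrow> real^3)"
    unfolding orthogonal_transformation_def by (auto intro: linearI)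
  then have "measure lebesgue (uminus ` (S \<inter> ball 0 1)) = bvol S"
    using bvol_measurable[OF assms] by (rule measure_orthogonal_image)
  moreover have "uminus ` (S \<inter> ball 0 1) = uminus ` S \<inter> ball (0::real^3) 1" by (auto simp: image_iff)
  ultimately show ?thesis by simp
qed

text \<open>Girard's formula for the angle excess, as an inequality: up to null sets, the ball is covered by the
  octant, its three neighbours, and their antipodes, and the three wedges cover the octant three times.\<close>

lemma wedge_sum:
  fixes p q r :: "real^3"
  assumes "p \<noteq> 0" "q \<noteq> 0" "r \<noteq> 0"
  shows "bvol UNIV / 2 + 2 * bvol {x. 0 < p \<bullet> x \<and> 0 < q \<bullet> x \<and> 0 < r \<bullet> x}
    \<le> bvol {x. 0 < q \<bullet> x \<and> 0 < r \<bullet> x} + bvol {x. 0 < p \<bullet> x \<and> 0 < r \<bullet> x} + bvol {x. 0 < p \<bullet> x \<and> 0 < q \<bullet> x}"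
proof -
  have op: "open {x. 0 < s \<bullet> x}" "open {x. s \<bullet> x < 0}" for s :: "real^3"
    by (auto intro: open_halfspace_gt open_halfspace_lt)
  define oct where "oct a b c = {x. 0 < a \<bullet> x \<and> 0 < b \<bullet> x \<and> 0 < c \<bullet> x}" for a b c :: "real^3"
  have oo: "open (oct a b c)" for a b c
    unfolding oct_def by (intro open_Collect_conj op)
  have ow: "open {x. 0 < a \<bullet> x \<and> 0 < b \<bullet> x}" for a b :: "real^3"
    by (intro open_Collect_conj op)
  have neg: "bvol (oct (- a) (- b) (- c)) = bvol (oct a b c)" for a b c
  proof -
    have "oct (- a) (- b) (- c) = uminus ` oct a b c"
    proof (intro equalityI subsetI)
      fix x assume "x \<in> oct (- a) (- b) (- c)"
      then have "- x \<in> oct a b c" by (simp add: oct_def)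
      then show "x \<in> uminus ` oct a b c" by (intro image_eqI[of x uminus "- x"]) simp_all
    qed (auto simp: oct_def)
    then show ?thesis using bvol_uminus[OF oo] by metis
  qed
  have two: "bvol (oct a b c) + bvol (oct (- a) b c) \<le> bvol {x. 0 < b \<bullet> x \<and> 0 < c \<bullet> x}" for a b c
  proof -
    have "(oct a b c \<inter> ball 0 1) \<inter> (oct (- a) b c \<inter> ball 0 1) = {}" by (auto simp: oct_def)
    then have "bvol (oct a b c) + bvol (oct (- a) b c) = measure lebesgue ((oct a b c \<inter> ball 0 1) \<union> (oct (- a) b c \<inter> ball 0 1))"
      using measure_Un3[OF bvol_measurable[OF oo] bvol_measurable[OF oo], of a b c "- a" b c] by simp
    also have "\<dots> \<le> bvol {x. 0 < b \<bullet> x \<and> 0 < c \<bullet> x}"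
      using bvol_measurable[OF oo] bvol_measurable[OF ow]
      by (intro measure_mono_fmeasurable) (auto simp: oct_def dest: fmeasurableD)
    finally show ?thesis .
  qed
  define H where "H = {x. p \<bullet> x = 0} \<union> {x. q \<bullet> x = 0} \<union> {x. r \<bullet> x = 0}"
  have H: "negligible H"
    unfolding H_def using assms by (intro negligible_Un) (auto intro: negligible_hyperplane)
  define L where "L = [(p, q, r), (- p, q, r), (p, - q, r), (p, q, - r), (- p, - q, - r), (p, - q, - r), (- p, q, - r), (- p, - q, r)]"
  define D where "D t = oct (fst t) (fst (snd t)) (snd (snd t)) \<inter> ball 0 1" for t
  have D: "D t \<in> lmeasurable" for t unfolding D_def by (rule bvol_measurable[OF oo])
  have "UNIV \<inter> ball 0 1 \<subseteq> H \<union> (\<Union>t\<in>set L. D t)"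
  proof
    fix x :: "real^3" assume x: "x \<in> UNIV \<inter> ball 0 1"
    have "x \<in> (\<Union>t\<in>set L. D t)" if "p \<bullet> x \<noteq> 0" "q \<bullet> x \<noteq> 0" "r \<bullet> x \<noteq> 0"
      using that x unfolding L_def D_def oct_def
      by (cases "0 < p \<bullet> x"; cases "0 < q \<bullet> x"; cases "0 < r \<bullet> x") (simp_all add: not_less)
    then show "x \<in> H \<union> (\<Union>t\<in>set L. D t)" unfolding H_def by blast
  qed
  moreover have "H \<union> (\<Union>t\<in>set L. D t) \<in> lmeasurable"
    by (rule fmeasurable.Un[OF negligible_imp_measurable[OF H] fmeasurable.finite_UN[OF finite_set D]])
  ultimately have "bvol UNIV \<le> measure lebesgue (H \<union> (\<Union>t\<in>set L. D t))"
    using bvol_measurable[OF open_UNIV] by (intro measure_mono_fmeasurable fmeasurableD) auto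
  also have "\<dots> \<le> measure lebesgue H + measure lebesgue (\<Union>t\<in>set L. D t)"
    using D negligible_imp_sets[OF H] by (intro measure_Un_le sets.finite_UN) (auto dest: fmeasurableD)
  also have "measure lebesgue H = 0" using H by (rule negligible_imp_measure0)
  also have "measure lebesgue (\<Union>t\<in>set L. D t) \<le> (\<Sum>t\<in>set L. measure lebesgue (D t))"
    using D by (intro measure_UNION_le) (auto dest: fmeasurableD)
  also have "\<dots> \<le> sum_list (map (\<lambda>t. measure lebesgue (D t)) L)"
  proof -
    have "sum f (set xs) \<le> sum_list (map f xs)" if "\<And>x. (0::real) \<le> f x" for f :: "(real^3) \<times> (real^3) \<times> (real^3) \<Rightarrow> real" and xs
      by (induction xs) (auto simp: sum.insert_if that add_increasing)
    then show ?thesis by simp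
  qed
  also have "\<dots> = bvol (oct p q r) + bvol (oct (- p) q r) + bvol (oct p (- q) r) + bvol (oct p q (- r))
     + bvol (oct (- p) (- q) (- r)) + bvol (oct p (- q) (- r)) + bvol (oct (- p) q (- r)) + bvol (oct (- p) (- q) r)"
    by (simp add: D_def L_def add.assoc)
  finally have "bvol UNIV \<le> 2 * (bvol (oct p q r) + bvol (oct (- p) q r) + bvol (oct p (- q) r) + bvol (oct p q (- r)))"
    using neg[of p q r] neg[of "- p" q r] neg[of p "- q" r] neg[of p q "- r"] by simp
  moreover have "oct q p r = oct p q r" "oct r p q = oct p q r" "oct (- q) p r = oct p (- q) r" "oct (- r) p q = oct p q (- r)"
    unfolding oct_def by blast+
  moreover note two[of p q r] two[of q p r] two[of r p q]
  ultimately show ?thesis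
    unfolding oct_def[symmetric] by simp
qed

text \<open>Double counting of angles. The vectors \<open>d t b\<close> are the coordinate
  functionals of the cone over \<open>t\<close>, and the wedge \<open>W t v\<close> measures the
  angle of \<open>t\<close> at \<open>v\<close>. Angles around a vertex add up to at most a full
  turn, those of a triangle to more than half a turn, so \<open>card \<T> < 2 * card V\<close>. If
  all degrees were at least 6, then \<open>6 * card V \<le> 3 * card \<T>\<close>.\<close>

lemma fan_degree:
  fixes \<T> :: "(real^3) set set" and d :: "(real^3) set \<Rightarrow> real^3 \<Rightarrow> real^3"
  assumes fin: "finite \<T>" "\<T> \<noteq> {}" and card3: "\<And>t. t \<in> \<T> \<Longrightarrow> card t = 3"
    and dual: "\<And>t a b. t \<in> \<T> \<Longrightarrow> a \<in> t \<Longrightarrow> b \<in> t \<Longrightarrow> d t a \<bullet> b = (if a = b then 1 else 0)"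
    and disj: "\<And>t u x. t \<in> \<T> \<Longrightarrow> u \<in> \<T> \<Longrightarrow> \<forall>b\<in>t. 0 < d t b \<bullet> x \<Longrightarrow> \<forall>b\<in>u. 0 < d u b \<bullet> x \<Longrightarrow> t = u"
  obtains v where "v \<in> \<Union>\<T>" "card {t \<in> \<T>. v \<in> t} \<le> 5"
proof (rule ccontr)
  assume "\<not> thesis"
  note obt = that
  have deg: "6 \<le> card {t \<in> \<T>. v \<in> t}" if "v \<in> \<Union>\<T>" for v
  proof (rule ccontr)
    assume "\<not> 6 \<le> card {t \<in> \<T>. v \<in> t}"
    then have "card {t \<in> \<T>. v \<in> t} \<le> 5" by simp
    with that have thesis by (rule obt)
    with \<open>\<not> thesis\<close> show False ..
  qed
  define V where "V = \<Union>\<T>"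
  have ft: "finite t" if "t \<in> \<T>" for t using card3[OF that] card.infinite[of t] by fastforce
  have finV: "finite V" unfolding V_def using fin(1) ft by (intro finite_Union) auto
  define W where "W t v = {x. \<forall>b\<in>t - {v}. 0 < d t b \<bullet> x}" for t v
  have oW: "open (W t v)" if "t \<in> \<T>" for t v
  proof -
    have "W t v = (\<Inter>b\<in>t - {v}. {x. 0 < d t b \<bullet> x})" by (auto simp: W_def)
    then show ?thesis using ft[OF that] by (auto intro!: open_INT open_halfspace_gt)
  qed
  have local: "(\<Sum>t\<in>{t \<in> \<T>. v \<in> t}. bvol (W t v)) \<le> bvol UNIV" if "v \<in> V" for v
  proof -
    have "W t v \<inter> W u v = {}" if tu: "t \<in> \<T>" "v \<in> t" "u \<in> \<T>" "v \<in> u" "t \<noteq> u" for t u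
    proof (rule ccontr)
      assume "W t v \<inter> W u v \<noteq> {}"
      then obtain x where x: "x \<in> W t v" "x \<in> W u v" by blast
      \<comment> \<open>So small that \<open>v + e *\<^sub>R x\<close> keeps a positive coordinate
        at \<open>v\<close> in both cones. Its other coordinates are positive because
        \<open>x\<close> is in both wedges, so the two open cones meet, contrary to
        \<open>disj\<close>.\<close>
      define e where "e = 1 / (1 + \<bar>d t v \<bullet> x\<bar> + \<bar>d u v \<bullet> x\<bar>)"
      have e: "0 < e" by (simp add: e_def add_pos_nonneg)
      have pos: "\<forall>b\<in>s. 0 < d s b \<bullet> (v + e *\<^sub>R x)"
        if s: "s \<in> \<T>" "v \<in> s" "x \<in> W s v" "\<bar>d s v \<bullet> x\<bar> \<le> \<bar>d t v \<bullet> x\<bar> + \<bar>d u v \<bullet> x\<bar>" for s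
      proof
        fix b assume b: "b \<in> s"
        show "0 < d s b \<bullet> (v + e *\<^sub>R x)"
        proof (cases "b = v")
          case True
          have "e * \<bar>d s v \<bullet> x\<bar> < 1"
            unfolding e_def using s(4) by (simp add: divide_less_eq add_pos_nonneg)
          moreover have "\<bar>e * (d s v \<bullet> x)\<bar> = e * \<bar>d s v \<bullet> x\<bar>" using e by (simp add: abs_mult)
          ultimately have "- 1 < e * (d s v \<bullet> x)" by linarith
          then show ?thesis using True dual[OF s(1) b s(2)] by (simp add: inner_add_right)
        next
          case False
          then have "0 < d s b \<bullet> x" using s(3) b unfolding W_def by blast
          then show ?thesis using False dual[OF s(1) b s(2)] e by (simp add: inner_add_right)
        qed
      qed
      have "t = u" by (rule disj[OF tu(1,3) pos[OF tu(1,2) x(1)] pos[OF tu(3,4) x(2)]]) auto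
      then show False using tu(5) by simp
    qed
    note dis = this
    have "pairwise (\<lambda>t u. negligible ((W t v \<inter> ball 0 1) \<inter> (W u v \<inter> ball 0 1))) {t \<in> \<T>. v \<in> t}"
    proof (rule pairwiseI)
      fix t u assume "t \<in> {t \<in> \<T>. v \<in> t}" "u \<in> {t \<in> \<T>. v \<in> t}" "t \<noteq> u"
      then have "W t v \<inter> W u v = {}" using dis[of t u] by simp
      then have "(W t v \<inter> ball 0 1) \<inter> (W u v \<inter> ball 0 1) = {}" by blast
      then show "negligible ((W t v \<inter> ball 0 1) \<inter> (W u v \<inter> ball 0 1))" by simp
    qed
    then have "(\<Sum>t\<in>{t \<in> \<T>. v \<in> t}. bvol (W t v)) = measure lebesgue (\<Union>t\<in>{t \<in> \<T>. v \<in> t}. W t v \<inter> ball 0 1)"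
      using fin(1) bvol_measurable[OF oW] by (intro measure_negligible_finite_Union_image[symmetric]) auto
    also have "\<dots> \<le> bvol UNIV"
    proof (rule measure_mono_fmeasurable)
      show "(\<Union>t\<in>{t \<in> \<T>. v \<in> t}. W t v \<inter> ball 0 1) \<in> sets lebesgue"
        using fin(1) fmeasurableD[OF bvol_measurable[OF oW]] by (intro sets.finite_UN) simp_all
      show "UNIV \<inter> ball (0::real^3) 1 \<in> lmeasurable" by (rule bvol_measurable[OF open_UNIV])
    qed blast
    finally show ?thesis .
  qed
  have tri: "bvol UNIV / 2 < (\<Sum>v\<in>t. bvol (W t v))" if t: "t \<in> \<T>" for t
  proof -
    obtain a b c where abc: "t = {a, b, c}" "a \<noteq> b" "a \<noteq> c" "b \<noteq> c" using card3[OF t] by (auto simp: card_3_iff)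
    have nz: "d t x \<noteq> 0" if "x \<in> t" for x using dual[OF t that that] by auto
    define Q where "Q = {x. 0 < d t a \<bullet> x \<and> 0 < d t b \<bullet> x \<and> 0 < d t c \<bullet> x}"
    have oQ: "open Q" unfolding Q_def by (intro open_Collect_conj open_halfspace_gt)
    \<comment> \<open>The sum of the vertices, scaled into the ball, lies in the open cone, which
      therefore has positive volume; this makes the angle excess strict.\<close>
    define y where "y = a + b + c"
    have y: "d t a \<bullet> y = 1" "d t b \<bullet> y = 1" "d t c \<bullet> y = 1"
      using dual[OF t] abc by (simp_all add: y_def inner_add_right)
    then have ynz: "y \<noteq> 0" by auto
    define z where "z = (1 / (2 * norm y)) *\<^sub>R y"
    have "norm z = 1 / 2" using ynz by (simp add: z_def)
    moreover have "z \<in> Q" using y ynz by (simp add: Q_def z_def)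
    ultimately have "z \<in> Q \<inter> ball 0 1" by simp
    then have "Q \<inter> ball 0 1 \<noteq> {}" by blast
    then have "\<not> negligible (Q \<inter> ball 0 1)" using oQ by (intro open_not_negligible open_Int) auto
    then have "bvol Q \<noteq> 0" using negligible_iff_measure0[OF bvol_measurable[OF oQ]] by blast
    then have Qpos: "0 < bvol Q" using measure_nonneg[of lebesgue "Q \<inter> ball 0 1"] by linarith
    have W3: "W t a = {x. 0 < d t b \<bullet> x \<and> 0 < d t c \<bullet> x}" "W t b = {x. 0 < d t a \<bullet> x \<and> 0 < d t c \<bullet> x}"
       "W t c = {x. 0 < d t a \<bullet> x \<and> 0 < d t b \<bullet> x}"
    proof -
      have "t - {a} = {b, c}" "t - {b} = {a, c}" "t - {c} = {a, b}" using abc by auto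
      then show "W t a = {x. 0 < d t b \<bullet> x \<and> 0 < d t c \<bullet> x}" "W t b = {x. 0 < d t a \<bullet> x \<and> 0 < d t c \<bullet> x}"
        "W t c = {x. 0 < d t a \<bullet> x \<and> 0 < d t b \<bullet> x}" by (simp_all add: W_def)
    qed
    have "(\<Sum>v\<in>{a, b, c}. bvol (W t v)) = bvol (W t a) + bvol (W t b) + bvol (W t c)"
      using abc(2-4) by (simp add: add.assoc)
    then have sum: "(\<Sum>v\<in>t. bvol (W t v)) = bvol (W t a) + bvol (W t b) + bvol (W t c)"
      by (simp only: abc(1))
    have "a \<in> t" "b \<in> t" "c \<in> t" using abc(1) by simp_all
    from wedge_sum[OF nz[OF this(1)] nz[OF this(2)] nz[OF this(3)]] Qpos
    show ?thesis unfolding sum W3 Q_def by linarith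
  qed
  have "real (card \<T>) * (bvol UNIV / 2) = (\<Sum>t\<in>\<T>. bvol UNIV / 2)" by simp
  also have "\<dots> < (\<Sum>t\<in>\<T>. \<Sum>v\<in>t. bvol (W t v))" using fin tri by (intro sum_strict_mono) auto
  also have "\<dots> = (\<Sum>t\<in>\<T>. \<Sum>v\<in>{v \<in> V. v \<in> t}. bvol (W t v))"
    by (intro sum.cong refl) (auto simp: V_def)
  also have "\<dots> = (\<Sum>v\<in>V. \<Sum>t\<in>{t \<in> \<T>. v \<in> t}. bvol (W t v))"
    by (rule sum.swap_restrict[OF fin(1) finV])
  also have "\<dots> \<le> (\<Sum>v\<in>V. bvol UNIV)" using local by (rule sum_mono)
  also have "\<dots> = real (card V) * bvol UNIV" by simp
  finally have "real (card \<T>) * (bvol UNIV / 2) < real (card V) * bvol UNIV" .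
  then have "real (card \<T>) / 2 * bvol UNIV < real (card V) * bvol UNIV" by simp
  then have "real (card \<T>) / 2 < real (card V)" by (rule mult_right_less_imp_less) simp
  then have lt: "card \<T> < 2 * card V" by linarith
  have "6 * card V = (\<Sum>v\<in>V. 6)" by simp
  also have "\<dots> \<le> (\<Sum>v\<in>V. card {t \<in> \<T>. v \<in> t})" using deg by (intro sum_mono) (simp add: V_def)
  also have "\<dots> = (\<Sum>v\<in>V. \<Sum>t\<in>{t \<in> \<T>. v \<in> t}. 1)" by simp
  also have "\<dots> = (\<Sum>t\<in>\<T>. \<Sum>v\<in>{v \<in> V. v \<in> t}. 1)"
    by (rule sum.swap_restrict[OF finV fin(1)])
  also have "\<dots> = (\<Sum>t\<in>\<T>. card t)"
  proof (intro sum.cong refl)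
    fix t assume "t \<in> \<T>"
    then have "{v \<in> V. v \<in> t} = t" by (auto simp: V_def)
    then show "(\<Sum>v\<in>{v \<in> V. v \<in> t}. 1) = card t" by simp
  qed
  also have "\<dots> = 3 * card \<T>" using card3 by simp
  finally show False using lt by linarith
qed

section \<open>Sectors of at least 72 degrees and their chords\<close>

definition cos72 :: real where
  "cos72 = (sqrt 5 - 1) / 4"

lemma cos72_bounds: "0 < cos72" "cos72 < 1"
  using sqrt5_bounds by (simp_all add: cos72_def)

lemma cos_fifth:
  assumes "k \<in> {1, 2, 3, 4::nat}" shows "cos (2 * pi * k / 5) \<le> cos72"
proof -
  have c1: "cos (2 * (pi / 5)) = cos72"
    unfolding cos_double_cos cos_pi_5 cos72_def by (simp add: power2_eq_square field_simps)
  have "cos (4 * (pi / 5)) = - cos (pi / 5)"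
    using cos_pi_minus[of "pi / 5"] by (simp add: field_simps)
  moreover have "- ((1 + q) / 4) \<le> (q - 1) / 4" if "0 \<le> q" for q :: real
    using that by (simp add: field_simps)
  ultimately have c2: "cos (4 * (pi / 5)) \<le> cos72" unfolding cos_pi_5 cos72_def by simp
  have "cos (6 * (pi / 5)) = cos (4 * (pi / 5))" "cos (8 * (pi / 5)) = cos (2 * (pi / 5))"
    using cos_2pi_minus[of "4 * (pi / 5)"] cos_2pi_minus[of "2 * (pi / 5)"] by (simp_all add: field_simps)
  with assms c1 c2 show ?thesis by (auto simp: field_simps)
qed

text \<open>With \<open>p\<close> and \<open>q\<close> normalised, the triangle inequality makes the
  weights of a unit vector in the sector add up to at least 1. The product of two such sums, times
  the cosine \<open>h \<le> 1\<close> of the sector, is at most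
  \<open>x \<bullet> y\<close>.\<close>

lemma sector_inner:
  fixes p q :: "'a::real_inner"
  assumes "0 \<le> c" "c * (norm p * norm q) < p \<bullet> q" "norm x = 1" "norm y = 1"
    and "x = b *\<^sub>R p + g *\<^sub>R q" "0 \<le> b" "0 \<le> g" "y = b' *\<^sub>R p + g' *\<^sub>R q" "0 \<le> b'" "0 \<le> g'"
  shows "c < x \<bullet> y"
proof -
  have nz: "p \<noteq> 0" "q \<noteq> 0" using assms(2) by auto
  define P Q where "P = norm p" and "Q = norm q"
  have PQ: "0 < P" "0 < Q" using nz by (simp_all add: P_def Q_def)
  define h where "h = (p \<bullet> q) / (P * Q)"
  have h: "c < h" "h \<le> 1" "p \<bullet> q = h * (P * Q)"
  proof -
    show "c < h" using assms(2) PQ by (simp add: h_def P_def[symmetric] Q_def[symmetric] pos_less_divide_eq)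
    show "h \<le> 1" using norm_cauchy_schwarz[of p q] PQ by (simp add: h_def P_def[symmetric] Q_def[symmetric] pos_divide_le_eq)
    show "p \<bullet> q = h * (P * Q)" using PQ by (simp add: h_def)
  qed
  define B G B' G' where "B = b * P" and "G = g * Q" and "B' = b' * P" and "G' = g' * Q"
  have nn: "0 \<le> B" "0 \<le> G" "0 \<le> B'" "0 \<le> G'" using assms(6,7,9,10) PQ by (simp_all add: B_def G_def B'_def G'_def)
  have "1 \<le> B + G" "1 \<le> B' + G'"
    using norm_triangle_ineq[of "b *\<^sub>R p" "g *\<^sub>R q"] norm_triangle_ineq[of "b' *\<^sub>R p" "g' *\<^sub>R q"] assms(3-10)
    by (simp_all add: B_def G_def B'_def G'_def P_def Q_def)
  then have "1 * 1 \<le> (B + G) * (B' + G')" by (intro mult_mono) auto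
  then have "h * 1 \<le> h * ((B + G) * (B' + G'))" using h(1) assms(1) by (intro mult_left_mono) auto
  also have "\<dots> \<le> B * B' + G * G' + h * (B * G' + G * B')"
  proof -
    have "h * (B * B' + G * G') \<le> 1 * (B * B' + G * G')" using h nn by (intro mult_right_mono) auto
    then show ?thesis by (simp add: algebra_simps)
  qed
  also have "\<dots> = x \<bullet> y"
  proof -
    have "x \<bullet> y = b * b' * (p \<bullet> p) + g * g' * (q \<bullet> q) + (b * g' + g * b') * (p \<bullet> q)"
      unfolding assms(5,8) by (simp add: inner_add_left inner_add_right inner_commute[of q p] algebra_simps)
    moreover have "p \<bullet> p = P * P" "q \<bullet> q = Q * Q" by (simp_all add: P_def Q_def norm_eq_sqrt_inner)
    ultimately show ?thesis unfolding h(3) by (simp add: B_def G_def B'_def G'_def algebra_simps)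
  qed
  finally show ?thesis using h(1) by simp
qed

lemma orthonormal_complement:
  fixes v :: "real^3"
  assumes "norm v = 1"
  obtains e1 e2 where "norm e1 = 1" "norm e2 = 1" "e1 \<bullet> e2 = 0" "e1 \<bullet> v = 0" "e2 \<bullet> v = 0"
proof -
  obtain y where y: "y \<noteq> 0" "orthogonal v y"
    using orthogonal_to_vector_exists[of v] by auto
  define e1 where "e1 = y /\<^sub>R norm y"
  define e2 where "e2 = cross3 v e1"
  have e1: "norm e1 = 1" "e1 \<bullet> v = 0" using y by (simp_all add: e1_def orthogonal_def inner_commute)
  have "e2 \<bullet> v = 0" "e1 \<bullet> e2 = 0"
    unfolding e2_def using dot_cross_self[of v e1] by (simp_all add: inner_commute)
  moreover have "(norm e2)\<^sup>2 = 1"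
    unfolding e2_def norm_cross using assms e1 by (simp add: inner_commute)
  then have "norm e2 = 1" using norm_ge_zero[of e2] by (simp add: power2_eq_1_iff)
  ultimately show ?thesis using e1 by (intro that)
qed

text \<open>If every sector at \<open>v\<close> were narrower than 72 degrees, the five directions \<open>\<theta> + 2\<pi>j/5\<close> would lie in
  five different sectors, so the circle would be the disjoint union of five rotated copies of one closed
  sector.\<close>

lemma wide_sector:
  fixes v :: "real^3" and I :: "'i set" and a b A B :: "'i \<Rightarrow> real^3"
  assumes v: "norm v = 1" and I: "finite I" "card I \<le> 5"
    and cover: "\<And>x. \<exists>i\<in>I. 0 \<le> A i \<bullet> x \<and> 0 \<le> B i \<bullet> x"
    and rep: "\<And>i x. i \<in> I \<Longrightarrow> \<exists>r. x = r *\<^sub>R v + (A i \<bullet> x) *\<^sub>R a i + (B i \<bullet> x) *\<^sub>R b i"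
  obtains i where "i \<in> I"
    "(a i - (a i \<bullet> v) *\<^sub>R v) \<bullet> (b i - (b i \<bullet> v) *\<^sub>R v) \<le> cos72 * (norm (a i - (a i \<bullet> v) *\<^sub>R v) * norm (b i - (b i \<bullet> v) *\<^sub>R v))"
proof (rule ccontr)
  assume "\<not> thesis"
  note obt = that
  define p q where "p i = a i - (a i \<bullet> v) *\<^sub>R v" and "q i = b i - (b i \<bullet> v) *\<^sub>R v" for i
  have narrow: "cos72 * (norm (p i) * norm (q i)) < p i \<bullet> q i" if "i \<in> I" for i
  proof (rule ccontr)
    assume "\<not> cos72 * (norm (p i) * norm (q i)) < p i \<bullet> q i"
    then have "p i \<bullet> q i \<le> cos72 * (norm (p i) * norm (q i))" by simp
    with that have thesis unfolding p_def q_def by (rule obt)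
    with \<open>\<not> thesis\<close> show False ..
  qed
  have vv: "v \<bullet> v = 1" using v by (simp add: norm_eq_1)
  have pv: "p i \<bullet> v = 0" "q i \<bullet> v = 0" for i by (simp_all add: p_def q_def inner_diff_left vv)
  obtain e1 e2 where e: "norm e1 = 1" "norm e2 = 1" "e1 \<bullet> e2 = 0" "e1 \<bullet> v = 0" "e2 \<bullet> v = 0"
    by (rule orthonormal_complement[OF v]) (rule that; assumption)
  define x where "x t = cos t *\<^sub>R e1 + sin t *\<^sub>R e2" for t :: real
  have xx: "x s \<bullet> x t = cos (s - t)" for s t
    using e by (simp add: x_def inner_add_left inner_add_right norm_eq_1 inner_commute[of e2 e1] cos_diff)
  have nx: "norm (x t) = 1" for t using xx[of t t] by (simp add: norm_eq_1)
  have xv: "x t \<bullet> v = 0" for t using e by (simp add: x_def inner_add_left)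
  \<comment> \<open>Projecting along \<open>v\<close> removes the unknown multiple of
    \<open>v\<close>, so \<open>A i\<close> and \<open>B i\<close> also give the coordinates of
    \<open>x t\<close> in the tangent plane.\<close>
  have xp: "x t = (A i \<bullet> x t) *\<^sub>R p i + (B i \<bullet> x t) *\<^sub>R q i" if i: "i \<in> I" for i t
  proof -
    obtain r where r: "x t = r *\<^sub>R v + (A i \<bullet> x t) *\<^sub>R a i + (B i \<bullet> x t) *\<^sub>R b i" using rep[OF i, of "x t"] by blast
    define \<alpha> \<beta> where "\<alpha> = A i \<bullet> x t" and "\<beta> = B i \<bullet> x t"
    have r': "x t = (r + \<alpha> * (a i \<bullet> v) + \<beta> * (b i \<bullet> v)) *\<^sub>R v + \<alpha> *\<^sub>R p i + \<beta> *\<^sub>R q i"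
      using r unfolding \<alpha>_def[symmetric] \<beta>_def[symmetric] p_def q_def by (simp add: algebra_simps)
    have "0 = x t \<bullet> v" using xv by simp
    also have "\<dots> = r + \<alpha> * (a i \<bullet> v) + \<beta> * (b i \<bullet> v)" by (subst r') (simp add: inner_add_left pv vv)
    finally show ?thesis using r' unfolding \<alpha>_def[symmetric] \<beta>_def[symmetric] by simp
  qed
  define S where "S i = {t. 0 \<le> A i \<bullet> x t \<and> 0 \<le> B i \<bullet> x t}" for i
  have close: "cos72 < cos (s - t)" if "i \<in> I" "s \<in> S i" "t \<in> S i" for i s t
    unfolding xx[symmetric]
    by (rule sector_inner[OF less_imp_le[OF cos72_bounds(1)] narrow[OF that(1)] nx nx xp[OF that(1)] _ _ xp[OF that(1)]])
      (use that(2,3) in \<open>auto simp: S_def\<close>)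
  define w where "w = 2 * pi / 5"
  have sep: "j = k" if "i \<in> I" "t + real j * w \<in> S i" "t + real k * w \<in> S i" "j < 5" "k < 5" for i t j k
  proof -
    have *: "\<not> (l < m)" if h: "t + real m * w \<in> S i" "t + real l * w \<in> S i" "m < 5" for l m :: nat
    proof
      assume "l < m"
      then have "m - l \<in> {1, 2, 3, 4}" using h(3) by auto
      then have "cos (2 * pi * real (m - l) / 5) \<le> cos72" by (rule cos_fifth)
      moreover have e: "t + real m * w - (t + real l * w) = 2 * pi * real (m - l) / 5"
        using \<open>l < m\<close> by (simp add: w_def of_nat_diff field_simps)
      have "cos72 < cos (2 * pi * real (m - l) / 5)"
        using close[OF \<open>i \<in> I\<close> h(1,2)] unfolding e .
      ultimately show False by linarith
    qed
    show ?thesis using *[OF that(2,3,4)] *[OF that(3,2,5)] by simp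
  qed
  \<comment> \<open>The five directions lie in five different sectors, and there are at most five,
    so each sector, in particular \<open>i\<close>, receives one.\<close>
  have hit: "\<exists>j<5. t + real j * w \<in> S i" if i: "i \<in> I" for i t
  proof -
    have "\<exists>i\<in>I. t + real j * w \<in> S i" for j using cover[of "x (t + real j * w)"] by (simp add: S_def)
    then obtain f where f: "\<And>j. f j \<in> I" "\<And>j. t + real j * w \<in> S (f j)" by metis
    have inj: "inj_on f {..<5}"
    proof (rule inj_onI)
      fix j k assume jk: "j \<in> {..<5::nat}" "k \<in> {..<5}" "f j = f k"
      have "t + real k * w \<in> S (f j)" unfolding jk(3) by (rule f(2))
      then show "j = k" using sep[OF f(1) f(2)[of j]] jk(1,2) by simp
    qed
    have "f ` {..<5} \<subseteq> I" using f(1) by blast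
    moreover have "card (f ` {..<5}) = 5" using inj by (simp add: card_image)
    ultimately have "f ` {..<5} = I" using I by (intro card_subset_eq) (auto dest: card_mono)
    then obtain j where "j < 5" "i = f j" using i by auto
    then show ?thesis using f(2)[of j] by blast
  qed
  obtain i where i: "i \<in> I" using cover[of 0] by blast
  have clS: "closed {t. t + real j * w \<in> S i}" for j
  proof -
    have "{t. t + real j * w \<in> S i} = {t. 0 \<le> A i \<bullet> x (t + real j * w)} \<inter> {t. 0 \<le> B i \<bullet> x (t + real j * w)}"
      by (auto simp: S_def)
    also have "closed \<dots>" unfolding x_def by (intro closed_Int closed_Collect_le continuous_intros)
    finally show ?thesis .
  qed
  \<comment> \<open>One translate of the parameter set of sector \<open>i\<close> against the other
    four: two disjoint nonempty closed sets covering the connected line.\<close>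
  define X where "X = {t. t + real 0 * w \<in> S i}"
  define Y where "Y = (\<Union>j\<in>{1,2,3,4::nat}. {t. t + real j * w \<in> S i})"
  have "closed X" unfolding X_def by (rule clS)
  moreover have "closed Y" unfolding Y_def by (rule closed_UN) (simp, intro ballI clS)
  moreover have "UNIV \<subseteq> X \<union> Y"
  proof
    fix t
    obtain j where "j < 5" "t + real j * w \<in> S i" using hit[OF i] by blast
    moreover have "j \<in> {0, 1, 2, 3, 4}" using \<open>j < 5\<close> by auto
    ultimately show "t \<in> X \<union> Y" unfolding X_def Y_def by auto
  qed
  moreover have "X \<inter> Y = {}"
  proof (rule ccontr)
    assume "X \<inter> Y \<noteq> {}"
    then obtain t j where "t + real 0 * w \<in> S i" "j \<in> {1,2,3,4}" "t + real j * w \<in> S i"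
      unfolding X_def Y_def by blast
    then show False using sep[OF i, of t 0 j] by auto
  qed
  moreover have "X \<noteq> {}" "Y \<noteq> {}"
  proof -
    obtain j where j: "j < 5" "0 + real j * w \<in> S i" using hit[OF i] by blast
    then have "real j * w \<in> X" by (simp add: X_def)
    then show "X \<noteq> {}" by blast
    have "(real j * w - w) + real 1 * w \<in> S i" using j by simp
    then have "real j * w - w \<in> Y" unfolding Y_def by blast
    then show "Y \<noteq> {}" by blast
  qed
  ultimately show False
    using connected_UNIV[where 'a=real] unfolding connected_closed by blast
qed

text \<open>Law of cosines for the projections to the tangent plane at \<open>v\<close>, which are
  no longer than the chords \<open>\<alpha>\<close> and \<open>\<beta>\<close>. The heights
  contribute exactly \<open>- \<alpha>\<^sup>2 * \<beta>\<^sup>2 / 2\<close>, the source of the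
  fourth-order error, and \<open>2 * (1 - cos72)\<close> is the square of
  \<open>ratio_bound\<close>.\<close>

lemma chord_bound:
  fixes v a b :: "'a::real_inner"
  assumes unit: "norm v = 1" "norm a = 1" "norm b = 1"
    and ang: "(a - (a \<bullet> v) *\<^sub>R v) \<bullet> (b - (b \<bullet> v) *\<^sub>R v) \<le> cos72 * (norm (a - (a \<bullet> v) *\<^sub>R v) * norm (b - (b \<bullet> v) *\<^sub>R v))"
    and len: "s \<le> dist a v" "s \<le> dist b v" "dist a v \<le> L" "dist b v \<le> L" "0 \<le> s"
  shows "(ratio_bound * s)\<^sup>2 - L ^ 4 / 2 \<le> (dist a b)\<^sup>2"
proof -
  define \<alpha> \<beta> where "\<alpha> = dist a v" and "\<beta> = dist b v"
  have n: "v \<bullet> v = 1" "a \<bullet> a = 1" "b \<bullet> b = 1" using unit by (simp_all add: norm_eq_1)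
  have d: "(dist x y)\<^sup>2 = 2 - 2 * (x \<bullet> y)" if "x \<bullet> x = 1" "y \<bullet> y = 1" for x y :: 'a
    unfolding dist_norm power2_norm_eq_inner using that
    by (simp add: inner_diff_left inner_diff_right inner_commute)
  have av: "a \<bullet> v = 1 - \<alpha>\<^sup>2 / 2" "b \<bullet> v = 1 - \<beta>\<^sup>2 / 2"
    using d[OF n(2,1)] d[OF n(3,1)] unfolding \<alpha>_def \<beta>_def by linarith+
  have proj: "(norm (x - (x \<bullet> v) *\<^sub>R v))\<^sup>2 = 1 - (x \<bullet> v)\<^sup>2" if "x \<bullet> x = 1" for x
    unfolding power2_norm_eq_inner using that n(1)
    by (simp add: inner_diff_left inner_diff_right inner_commute power2_eq_square)
  have pn: "norm (x - (x \<bullet> v) *\<^sub>R v) \<le> g" if "x \<bullet> x = 1" "x \<bullet> v = 1 - g\<^sup>2 / 2" "0 \<le> g" for x g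
  proof (rule power2_le_imp_le)
    have "(1 - g\<^sup>2 / 2)\<^sup>2 = 1 - g\<^sup>2 + (g\<^sup>2 / 2)\<^sup>2" by (simp add: power2_eq_square algebra_simps)
    then show "(norm (x - (x \<bullet> v) *\<^sub>R v))\<^sup>2 \<le> g\<^sup>2"
      unfolding proj[OF that(1)] unfolding that(2) using zero_le_power2[of "g\<^sup>2 / 2"] by linarith
  qed (rule that(3))
  have ab0: "0 \<le> \<alpha>" "0 \<le> \<beta>" by (simp_all add: \<alpha>_def \<beta>_def)
  define D where "D = (a - (a \<bullet> v) *\<^sub>R v) \<bullet> (b - (b \<bullet> v) *\<^sub>R v)"
  have "D \<le> cos72 * (norm (a - (a \<bullet> v) *\<^sub>R v) * norm (b - (b \<bullet> v) *\<^sub>R v))" unfolding D_def by (rule ang)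
  also have "\<dots> \<le> cos72 * (\<alpha> * \<beta>)"
    using pn[OF n(2) av(1) ab0(1)] pn[OF n(3) av(2) ab0(2)] ab0 cos72_bounds(1)
    by (intro mult_left_mono mult_mono) auto
  finally have D: "D \<le> cos72 * (\<alpha> * \<beta>)" .
  have "a \<bullet> b = D + (a \<bullet> v) * (b \<bullet> v)"
    unfolding D_def using n(1) by (simp add: inner_diff_left inner_diff_right inner_commute algebra_simps)
  then have "(dist a b)\<^sup>2 = 2 - 2 * D - 2 * ((1 - \<alpha>\<^sup>2 / 2) * (1 - \<beta>\<^sup>2 / 2))"
    using d[OF n(2,3)] av by simp
  also have "\<dots> = \<alpha>\<^sup>2 + \<beta>\<^sup>2 - 2 * D - \<alpha>\<^sup>2 * \<beta>\<^sup>2 / 2" by (simp add: algebra_simps)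
  finally have eq: "(dist a b)\<^sup>2 = \<alpha>\<^sup>2 + \<beta>\<^sup>2 - 2 * D - \<alpha>\<^sup>2 * \<beta>\<^sup>2 / 2" .
  have "\<alpha>\<^sup>2 + \<beta>\<^sup>2 - 2 * (cos72 * (\<alpha> * \<beta>)) = (\<alpha> - \<beta>)\<^sup>2 + 2 * (1 - cos72) * (\<alpha> * \<beta>)"
    by (simp add: power2_eq_square algebra_simps)
  also have "\<dots> \<ge> 0 + 2 * (1 - cos72) * (s * s)"
    using len ab0 cos72_bounds unfolding \<alpha>_def[symmetric] \<beta>_def[symmetric]
    by (intro add_mono mult_left_mono mult_mono) auto
  finally have low: "2 * (1 - cos72) * (s * s) \<le> \<alpha>\<^sup>2 + \<beta>\<^sup>2 - 2 * (cos72 * (\<alpha> * \<beta>))" by simp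
  have "\<alpha>\<^sup>2 * \<beta>\<^sup>2 \<le> L\<^sup>2 * L\<^sup>2"
    using len ab0 unfolding \<alpha>_def[symmetric] \<beta>_def[symmetric] by (intro mult_mono power_mono) auto
  also have "\<dots> = L ^ 4" by (simp flip: power_add)
  finally have "\<alpha>\<^sup>2 * \<beta>\<^sup>2 / 2 \<le> L ^ 4 / 2" by simp
  moreover have "(ratio_bound * s)\<^sup>2 = 2 * (1 - cos72) * (s * s)"
    unfolding power_mult_distrib ratio_bound_sq cos72_def by (simp add: power2_eq_square field_simps)
  ultimately show ?thesis using low D unfolding eq by linarith
qed

section \<open>Polyhedra inscribed in the unit sphere\<close>

text \<open>Finitely many balls of radius 1/2 cover the large ball, and each holds at most one point
  of a 1-separated set. Translation makes the bound independent of \<open>c\<close>.\<close>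

lemma packing:
  obtains N where "\<And>c (S :: (real^3) set). S \<subseteq> cball c R \<Longrightarrow> (\<And>x y. x \<in> S \<Longrightarrow> y \<in> S \<Longrightarrow> x \<noteq> y \<Longrightarrow> 1 \<le> dist x y) \<Longrightarrow> card S \<le> N"
proof -
  have "compact (cball (0::real^3) R)" by simp
  then have "\<forall>e>0. \<exists>k. finite k \<and> cball (0::real^3) R \<subseteq> (\<Union>x\<in>k. ball x e)"
    unfolding compact_eq_totally_bounded by blast
  then obtain k where k: "finite k" "cball (0::real^3) R \<subseteq> (\<Union>x\<in>k. ball x (1/2))" by (meson half_gt_zero_iff zero_less_one)
  show ?thesis
  proof (rule that[of "card k"])
    fix c and S :: "(real^3) set"
    assume S: "S \<subseteq> cball c R" and sep: "\<And>x y. x \<in> S \<Longrightarrow> y \<in> S \<Longrightarrow> x \<noteq> y \<Longrightarrow> 1 \<le> dist x y"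
    have "\<exists>z\<in>k. dist z (x - c) < 1 / 2" if "x \<in> S" for x
    proof -
      have "x - c \<in> cball 0 R" using S that by (auto simp: dist_norm norm_minus_commute)
      then have "x - c \<in> (\<Union>x\<in>k. ball x (1/2))" using k(2) by blast
      then show ?thesis by auto
    qed
    then obtain f where f: "\<And>x. x \<in> S \<Longrightarrow> f x \<in> k" "\<And>x. x \<in> S \<Longrightarrow> dist (f x) (x - c) < 1 / 2" by metis
    have "inj_on f S"
    proof (rule inj_onI, rule ccontr)
      fix x y assume xy: "x \<in> S" "y \<in> S" "f x = f y" "x \<noteq> y"
      have "dist (x - c) (y - c) \<le> dist (f x) (x - c) + dist (f x) (y - c)" by (rule dist_triangle3)
      also have "\<dots> < 1" using f(2)[OF xy(1)] f(2)[OF xy(2)] xy(3) by simp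
      finally have "dist x y < 1" by (simp add: dist_norm)
      then show False using sep[OF xy(1,2,4)] by simp
    qed
    then show "card S \<le> card k" using f(1) k(1) by (intro card_inj_on_le[of f]) auto
  qed
qed

definition insc :: "(real^3) set \<Rightarrow> bool" where
  "insc P \<longleftrightarrow> polytope P \<and> aff_dim P = 3 \<and> (\<forall>v. v extreme_point_of P \<longrightarrow> norm v = 1) \<and> (\<forall>F. F facet_of P \<longrightarrow> 2 simplex F)"

definition vts :: "(real^3) set \<Rightarrow> (real^3) set" where
  "vts P = {v. v extreme_point_of P}"

lemma vts:
  assumes "insc P"
  shows "finite (vts P)" "P = convex hull (vts P)" "\<And>v. v \<in> vts P \<Longrightarrow> norm v = 1" "P \<subseteq> cball 0 1" "vts P \<subseteq> P"
proof -
  have p: "polytope P" using assms by (simp add: insc_def)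
  show "finite (vts P)" unfolding vts_def by (rule finite_polyhedron_extreme_points[OF polytope_imp_polyhedron[OF p]])
  show e: "P = convex hull (vts P)"
    unfolding vts_def using polytope_imp_compact[OF p] polytope_imp_convex[OF p] by (rule Krein_Milman_Minkowski)
  show n: "norm v = 1" if "v \<in> vts P" for v using assms that by (auto simp: insc_def vts_def)
  have "convex hull (vts P) \<subseteq> cball 0 1" using n by (intro hull_minimal) auto
  then show "P \<subseteq> cball 0 1" using e by simp
  show "vts P \<subseteq> P" by (auto simp: vts_def extreme_point_of_def)
qed

lemma facet_vts:
  assumes "insc P" "F facet_of P"
  shows "card (F \<inter> vts P) = 3" "F = convex hull (F \<inter> vts P)" "\<not> affine_dependent (F \<inter> vts P)"
proof -
  have "2 simplex F" using assms by (simp add: insc_def)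
  then obtain C where C: "\<not> affine_dependent C" "int (card C) = 2 + 1" "F = convex hull C"
    unfolding simplex_def by blast
  have "F face_of P" using assms(2) by (simp add: facet_of_def)
  from extreme_point_of_face[OF this] have "F \<inter> vts P = {v. v extreme_point_of F}" by (auto simp: vts_def)
  also have "\<dots> = C" unfolding C(3) using extreme_point_of_convex_hull_affine_independent[OF C(1)] by blast
  finally have e: "F \<inter> vts P = C" .
  show "card (F \<inter> vts P) = 3" "F = convex hull (F \<inter> vts P)" "\<not> affine_dependent (F \<inter> vts P)"
    unfolding e using C by simp_all
qed

lemma segment_edge_length:
  assumes "polytope P" "closed_segment a b edge_of P"
  shows "dist a b \<in> edge_lengths P"
proof (rule edge_segment[OF assms])
  fix c d assume h: "closed_segment a b = closed_segment c d" "diameter (closed_segment a b) = dist c d"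
  then have "{a, b} = {c, d}" by simp
  then have "dist a b = dist c d" by (auto simp: doubleton_eq_iff dist_commute)
  then show ?thesis unfolding edge_lengths_def using assms(2) h(2) by (intro image_eqI[of _ _ "closed_segment a b"]) simp_all
qed

lemma facet_edge:
  assumes "insc P" "F facet_of P" "a \<in> F \<inter> vts P" "b \<in> F \<inter> vts P" "a \<noteq> b"
  shows "dist a b \<in> edge_lengths P"
proof -
  have "(convex hull {a, b}) face_of F"
    apply (subst facet_vts(2)[OF assms(1,2)])
    unfolding face_of_convex_hull_affine_independent[OF facet_vts(3)[OF assms(1,2)]]
    by (rule exI[of _ "{a, b}"]) (use assms(3,4) in simp)
  moreover have "F face_of P" using assms(2) by (simp add: facet_of_def)
  ultimately have "(convex hull {a, b}) face_of P" by (rule face_of_trans)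
  moreover have "aff_dim (convex hull {a, b}) = 1" unfolding aff_dim_convex_hull aff_dim_2 using assms(5) by simp
  ultimately have "closed_segment a b edge_of P" by (simp add: edge_of_def segment_convex_hull)
  moreover have "polytope P" using assms(1) by (simp add: insc_def)
  ultimately show ?thesis by (rule segment_edge_length[rotated])
qed

text \<open>The closest pair \<open>v, w\<close> of vertices spans an edge: on the sphere, the open half-space beyond the
  supporting plane through \<open>v\<close> and \<open>w\<close> with normal \<open>v + w\<close> only contains points whose squared distances to
  \<open>v\<close> and \<open>w\<close> add up to at most that between \<open>v\<close> and \<open>w\<close>.\<close>

lemma vts_separated:
  assumes P: "insc P" and s: "\<And>l. l \<in> edge_lengths P \<Longrightarrow> s \<le> l" and ab: "a \<in> vts P" "b \<in> vts P" "a \<noteq> b"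
  shows "s \<le> dist a b"
proof -
  define Z where "Z = {(x, y). x \<in> vts P \<and> y \<in> vts P \<and> x \<noteq> y}"
  have "Z \<subseteq> vts P \<times> vts P" by (auto simp: Z_def)
  then have "finite Z" by (rule finite_subset) (intro finite_cartesian_product vts(1)[OF P])
  moreover have "(a, b) \<in> Z" using ab by (simp add: Z_def)
  ultimately obtain z where z: "z \<in> Z" "\<And>y. y \<in> Z \<Longrightarrow> dist (fst z) (snd z) \<le> dist (fst y) (snd y)"
    using ex_min_if_finite[of "(\<lambda>y. dist (fst y) (snd y)) ` Z"] by (metis (no_types, lifting) empty_iff finite_imageI image_iff image_is_empty not_le_imp_less)
  obtain v w where zvw: "z = (v, w)" by (cases z)
  have vw: "v \<in> vts P" "w \<in> vts P" "v \<noteq> w" using z(1) zvw by (auto simp: Z_def)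
  have min: "dist v w \<le> dist x y" if "x \<in> vts P" "y \<in> vts P" "x \<noteq> y" for x y
    using z(2)[of "(x, y)"] that zvw by (simp add: Z_def)
  define m where "m = v + w"
  have d: "(dist x y)\<^sup>2 = 2 - 2 * (x \<bullet> y)" if "x \<in> vts P" "y \<in> vts P" for x y
  proof -
    have "x \<bullet> x = 1" "y \<bullet> y = 1" using vts(3)[OF P] that by (simp_all add: norm_eq_1)
    then show ?thesis unfolding dist_norm power2_norm_eq_inner
      by (simp add: inner_diff_left inner_diff_right inner_commute)
  qed
  have mv: "m \<bullet> v = 1 + v \<bullet> w" "m \<bullet> w = 1 + v \<bullet> w"
  proof -
    have "v \<bullet> v = 1" "w \<bullet> w = 1" using vts(3)[OF P] vw by (simp_all add: norm_eq_1)
    then show "m \<bullet> v = 1 + v \<bullet> w" "m \<bullet> w = 1 + v \<bullet> w"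
      unfolding m_def inner_add_left using inner_commute[of w v] by simp_all
  qed
  have top: "x = v \<or> x = w" if x: "x \<in> vts P" "m \<bullet> v \<le> m \<bullet> x" for x
  proof (rule ccontr)
    assume ne: "\<not> (x = v \<or> x = w)"
    have "(dist v w)\<^sup>2 \<le> (dist x v)\<^sup>2" "(dist v w)\<^sup>2 \<le> (dist x w)\<^sup>2"
      using min[OF x(1) vw(1)] min[OF x(1) vw(2)] ne by (auto intro!: power_mono)
    moreover have "m \<bullet> x = x \<bullet> v + x \<bullet> w" unfolding m_def inner_add_left using inner_commute[of v x] inner_commute[of w x] by simp
    moreover have "0 < (dist v w)\<^sup>2" using vw(3) by simp
    ultimately show False
      using d[OF x(1) vw(1)] d[OF x(1) vw(2)] d[OF vw(1,2)] x(2) mv by linarith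
  qed
  define F where "F = P \<inter> {x. m \<bullet> x = m \<bullet> v}"
  have "convex hull (vts P) \<subseteq> {x. m \<bullet> x \<le> m \<bullet> v}"
  proof (rule hull_minimal)
    show "vts P \<subseteq> {x. m \<bullet> x \<le> m \<bullet> v}"
    proof
      fix x assume "x \<in> vts P"
      then show "x \<in> {x. m \<bullet> x \<le> m \<bullet> v}" using top[of x] mv by (cases "m \<bullet> v \<le> m \<bullet> x") auto
    qed
  qed (rule convex_halfspace_le)
  then have le: "m \<bullet> x \<le> m \<bullet> v" if "x \<in> P" for x using that vts(2)[OF P] by blast
  have poly: "polytope P" using P by (simp add: insc_def)
  have F: "F face_of P"
    unfolding F_def using polytope_imp_convex[OF poly] le by (intro face_of_Int_supporting_hyperplane_le) auto
  then have "F face_of (convex hull (vts P))" using vts(2)[OF P] by simp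
  then obtain S where S: "S \<subseteq> vts P" "F = convex hull S"
    by (rule face_of_convex_hull_subset[OF finite_imp_compact[OF vts(1)[OF P]]]) (rule that; assumption)
  have "S \<subseteq> F" unfolding S(2) by (rule hull_subset)
  have "S \<subseteq> {v, w}"
  proof
    fix x assume x: "x \<in> S"
    then have "m \<bullet> v \<le> m \<bullet> x" using \<open>S \<subseteq> F\<close> unfolding F_def by auto
    with top[of x] x S(1) show "x \<in> {v, w}" by blast
  qed
  then have "F \<subseteq> convex hull {v, w}" unfolding S(2) by (rule hull_mono)
  moreover have "convex hull {v, w} \<subseteq> F"
  proof (rule hull_minimal)
    show "{v, w} \<subseteq> F" unfolding F_def using vw vts(5)[OF P] mv by auto
    show "convex F" using F polytope_imp_convex[OF poly] face_of_imp_convex by blast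
  qed
  ultimately have Fvw: "F = convex hull {v, w}" by blast
  have "aff_dim (convex hull {v, w}) = 1" unfolding aff_dim_convex_hull aff_dim_2 using vw(3) by simp
  then have "closed_segment v w edge_of P" using F unfolding edge_of_def segment_convex_hull Fvw by blast
  then have "s \<le> dist v w" using s segment_edge_length[OF poly] by blast
  also have "\<dots> \<le> dist a b" by (rule min[OF ab])
  finally show ?thesis .
qed

text \<open>A facet is the hull of its vertices and so is determined by a subset of
  \<open>vts P\<close>. The bound is crude, but only finiteness independent of \<open>P\<close>
  counts in the end.\<close>

lemma card_facets_le:
  assumes "insc P" shows "card {F. F facet_of P} \<le> 2 ^ card (vts P)"
proof -
  have "inj_on (\<lambda>F. F \<inter> vts P) {F. F facet_of P}"
    using facet_vts(2)[OF assms] by (intro inj_onI) (metis mem_Collect_eq)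
  then have "card {F. F facet_of P} \<le> card (Pow (vts P))"
    using vts(1)[OF assms] by (intro card_inj_on_le[of "\<lambda>F. F \<inter> vts P"]) auto
  then show ?thesis using vts(1)[OF assms] by (simp add: card_Pow)
qed

lemma finite_facets: "insc P \<Longrightarrow> finite {F. F facet_of P}"
  by (simp add: insc_def finite_polytope_facets)

lemma frontier_facet:
  assumes "insc P" "y \<in> P" "y \<notin> interior P"
  obtains F where "F facet_of P" "y \<in> F"
proof -
  have poly: "polytope P" and dim: "aff_dim P = 3" using assms(1) by (auto simp: insc_def)
  have "rel_interior P = interior P"
    using dim aff_dim_eq_full[of P] by (intro rel_interior_interior) simp
  then have "y \<in> rel_frontier P" using assms(2,3) closure_subset by (auto simp: rel_frontier_def)
  then show ?thesis
    using rel_frontier_of_polyhedron[OF polytope_imp_polyhedron[OF poly]] that by blast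
qed

text \<open>If the centre is not interior, the point \<open>y\<close> of \<open>P\<close> closest to it lies in a facet, and the vertices
  lie in the small cap around \<open>y\<close>; its squared radius is \<open>1 - \<bar>y\<bar>\<^sup>2\<close>, half a mean of squared edge lengths.\<close>

lemma vts_small_cap:
  assumes P: "insc P" and L: "\<And>l. l \<in> edge_lengths P \<Longrightarrow> l \<le> L" "0 \<le> L" and int: "0 \<notin> interior P"
  obtains y where "vts P \<subseteq> cball y L"
proof -
  have poly: "polytope P" using P by (simp add: insc_def)
  have cl: "closed P" "convex P" using poly polytope_imp_closed polytope_imp_convex by blast+
  have ne: "P \<noteq> {}" using P by (auto simp: insc_def)
  define y where "y = closest_point P 0"
  have y: "y \<in> P" "\<forall>z\<in>P. dist 0 y \<le> dist 0 z"
    unfolding y_def using closest_point_exists[OF cl(1) ne] by blast+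
  have dot: "y \<bullet> y \<le> x \<bullet> y" if "x \<in> P" for x
    using any_closest_point_dot[OF cl(2,1) y(1) that y(2)] by (simp add: inner_diff_right inner_commute)
  have "y \<notin> interior P"
  proof
    assume yi: "y \<in> interior P"
    then have "y \<noteq> 0" using int by blast
    obtain e where e: "0 < e" "cball y e \<subseteq> P" using yi mem_interior_cball by blast
    define x where "x = y - (e / norm y) *\<^sub>R y"
    have "x \<in> P" using e \<open>y \<noteq> 0\<close> by (intro subsetD[OF e(2)]) (simp add: x_def dist_norm)
    then have "y \<bullet> y \<le> x \<bullet> y" by (rule dot)
    then have "(e / norm y) * (y \<bullet> y) \<le> 0" by (simp add: x_def inner_diff_left)
    moreover have "0 < (e / norm y) * (y \<bullet> y)" using e \<open>y \<noteq> 0\<close> by simp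
    ultimately show False by simp
  qed
  then obtain F where F: "F facet_of P" "y \<in> F" by (rule frontier_facet[OF P y(1)]) (rule that; assumption)
  define t where "t = F \<inter> vts P"
  have ft: "finite t" unfolding t_def using vts(1)[OF P] by blast
  have "y \<in> convex hull t" using F(2) facet_vts(2)[OF P F(1)] by (simp add: t_def)
  then obtain u where u: "\<And>x. x \<in> t \<Longrightarrow> 0 \<le> u x" "sum u t = 1" "(\<Sum>x\<in>t. u x *\<^sub>R x) = y"
    unfolding convex_hull_finite[OF ft] by blast
  have unit: "x \<bullet> x = 1" if "x \<in> vts P" for x using vts(3)[OF P that] by (simp add: norm_eq_1)
  have tt: "2 - 2 * (x \<bullet> z) \<le> L\<^sup>2" if "x \<in> t" "z \<in> t" for x z
  proof -
    have "dist x z \<le> L"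
      using that L facet_edge[OF P F(1), of x z] by (cases "x = z") (auto simp: t_def)
    then have "(dist x z)\<^sup>2 \<le> L\<^sup>2" by (intro power_mono) auto
    moreover have "(dist x z)\<^sup>2 = 2 - 2 * (x \<bullet> z)"
      unfolding dist_norm power2_norm_eq_inner using unit that
      by (simp add: t_def inner_diff_left inner_diff_right inner_commute)
    ultimately show ?thesis by simp
  qed
  \<comment> \<open>The bound holds for pairs of vertices of the facet. Averaging with the weights
    of \<open>y\<close>, first in one argument and then in the other, replaces both vertices by
    \<open>y\<close>.\<close>
  have "2 - 2 * (y \<bullet> y) \<le> L\<^sup>2"
  proof -
    have yx: "2 - 2 * (x \<bullet> y) \<le> L\<^sup>2" if x: "x \<in> t" for x
    proof -
      have "2 - 2 * (x \<bullet> y) = (\<Sum>z\<in>t. u z * (2 - 2 * (x \<bullet> z)))"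
        unfolding u(3)[symmetric] inner_sum_right
        by (simp add: right_diff_distrib sum_subtractf u(2) sum_distrib_left mult_ac flip: sum_distrib_right)
      also have "\<dots> \<le> (\<Sum>z\<in>t. u z * L\<^sup>2)" using u(1) tt[OF x] by (intro sum_mono mult_left_mono) auto
      also have "\<dots> = L\<^sup>2" by (simp add: u(2) flip: sum_distrib_right)
      finally show ?thesis .
    qed
    have "y \<bullet> y = (\<Sum>z\<in>t. u z * (z \<bullet> y))" by (subst (1) u(3)[symmetric]) (simp add: inner_sum_left)
    then have "2 - 2 * (y \<bullet> y) = (\<Sum>z\<in>t. u z * (2 - 2 * (z \<bullet> y)))"
      by (simp add: right_diff_distrib sum_subtractf u(2) sum_distrib_left mult_ac flip: sum_distrib_right)
    also have "\<dots> \<le> (\<Sum>z\<in>t. u z * L\<^sup>2)" using u(1) yx by (intro sum_mono mult_left_mono) auto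
    also have "\<dots> = L\<^sup>2" by (simp add: u(2) flip: sum_distrib_right)
    finally show ?thesis .
  qed
  moreover have "0 \<le> L\<^sup>2" by simp
  ultimately have r: "1 - y \<bullet> y \<le> L\<^sup>2" by linarith
  show ?thesis
  proof (rule that[of y], rule subsetI)
    fix x assume x: "x \<in> vts P"
    have "(dist y x)\<^sup>2 = 1 - 2 * (x \<bullet> y) + y \<bullet> y"
      unfolding dist_norm power2_norm_eq_inner using unit[OF x]
      by (simp add: inner_diff_left inner_diff_right inner_commute)
    also have "\<dots> \<le> L\<^sup>2" using dot[OF subsetD[OF vts(5)[OF P] x]] r by linarith
    finally have "dist y x \<le> L" using L(2) by (rule power2_le_imp_le)
    then show "x \<in> cball y L" by simp
  qed
qed

text \<open>A small ball around the origin lies in \<open>P\<close>, so the supporting plane of a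
  facet has positive offset.\<close>

lemma facet_hyperplane:
  assumes "insc P" "0 \<in> interior P" "F facet_of P"
  obtains h \<beta> where "0 < \<beta>" "P \<subseteq> {x. h \<bullet> x \<le> \<beta>}" "F = P \<inter> {x. h \<bullet> x = \<beta>}"
proof -
  have poly: "polytope P" and dim: "aff_dim P = 3" using assms(1) by (auto simp: insc_def)
  have F: "F face_of P" "F \<noteq> {}" "F \<noteq> P" using assms(3) by (auto simp: facet_of_def)
  then have "F exposed_face_of P" using exposed_face_of_polyhedron[OF polytope_imp_polyhedron[OF poly]] by blast
  then obtain h \<beta> where h: "h \<noteq> 0" "P \<subseteq> {x. h \<bullet> x \<le> \<beta>}" "F = P \<inter> {x. h \<bullet> x = \<beta>}"
    using F(2,3) unfolding exposed_face_of by blast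
  obtain e where e: "0 < e" "cball 0 e \<subseteq> P" using assms(2) mem_interior_cball by blast
  have "(e / norm h) *\<^sub>R h \<in> cball 0 e" using h(1) e(1) by simp
  then have "h \<bullet> ((e / norm h) *\<^sub>R h) \<le> \<beta>" using e(2) h(2) by blast
  moreover have "0 < h \<bullet> ((e / norm h) *\<^sub>R h)" using h(1) e(1) by simp
  ultimately have "0 < \<beta>" by linarith
  then show ?thesis using h(2,3) by (rule that)
qed

text \<open>The plane of the facet misses the origin: paired with its normal \<open>h\<close>, a
  linear relation between the vertices has coefficient sum 0 and would be an affine relation. So the
  three vertices form a basis of the space, and \<open>d\<close> is the dual basis.\<close>

lemma facet_dual:
  assumes P: "insc P" "0 \<in> interior P" and F: "F facet_of P"
  shows "\<exists>d. (\<forall>a\<in>F \<inter> vts P. \<forall>b\<in>F \<inter> vts P. d a \<bullet> b = (if a = b then 1 else 0)) \<and>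
    (\<forall>x. x = (\<Sum>b\<in>F \<inter> vts P. (d b \<bullet> x) *\<^sub>R b))"
proof -
  define t where "t = F \<inter> vts P"
  have ft: "finite t" unfolding t_def using vts(1)[OF P(1)] by blast
  obtain h \<beta> where h: "0 < \<beta>" "P \<subseteq> {x. h \<bullet> x \<le> \<beta>}" "F = P \<inter> {x. h \<bullet> x = \<beta>}"
    by (rule facet_hyperplane[OF P F]) (rule that; assumption)
  have ind: "independent t"
  proof
    assume "dependent t"
    then obtain u where u: "\<exists>v\<in>t. u v \<noteq> 0" "(\<Sum>v\<in>t. u v *\<^sub>R v) = 0"
      using dependent_finite[OF ft] by blast
    have "0 = h \<bullet> (\<Sum>v\<in>t. u v *\<^sub>R v)" using u(2) by simp
    also have "\<dots> = (\<Sum>v\<in>t. u v * \<beta>)"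
      unfolding inner_sum_right inner_scaleR_right using h(3) by (intro sum.cong refl) (auto simp: t_def)
    finally have "sum u t = 0" using h(1) by (simp flip: sum_distrib_right)
    then have "affine_dependent t" using u affine_dependent_explicit_finite[OF ft] by blast
    then show False using facet_vts(3)[OF P(1) F] by (simp add: t_def)
  qed
  have "\<exists>y. \<forall>b\<in>t. y \<bullet> b = (if a = b then 1 else 0)" for a
  proof -
    obtain g where g: "linear g" "\<forall>b\<in>t. g b = (if a = b then 1 else (0::real))"
      using linear_independent_extend[OF ind, of "\<lambda>b. if a = b then 1 else (0::real)"] by blast
    have "adjoint g 1 \<bullet> b = g b" for b
      using adjoint_works[OF g(1), of b 1] by (simp add: inner_commute)
    then show ?thesis using g(2) by (intro exI[of _ "adjoint g 1"]) simp
  qed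
  then obtain d where d: "\<And>a b. b \<in> t \<Longrightarrow> d a \<bullet> b = (if a = b then 1 else 0)" by metis
  have "UNIV \<subseteq> span t"
    by (rule card_ge_dim_independent[OF subset_UNIV ind]) (simp add: t_def facet_vts(1)[OF P(1) F])
  have "x = (\<Sum>b\<in>t. (d b \<bullet> x) *\<^sub>R b)" for x
  proof -
    have "x \<in> span t" using \<open>UNIV \<subseteq> span t\<close> by blast
    then obtain u where x: "x = (\<Sum>b\<in>t. u b *\<^sub>R b)" unfolding span_finite[OF ft] by blast
    have "d b \<bullet> x = u b" if "b \<in> t" for b
    proof -
      have "d b \<bullet> x = (\<Sum>c\<in>t. u c * (d b \<bullet> c))" unfolding x inner_sum_right inner_scaleR_right ..
      also have "\<dots> = (\<Sum>c\<in>t. if b = c then u c else 0)" using d by (intro sum.cong refl) auto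
      also have "\<dots> = u b" using ft that by simp
      finally show ?thesis .
    qed
    then have "(\<Sum>b\<in>t. (d b \<bullet> x) *\<^sub>R b) = (\<Sum>b\<in>t. u b *\<^sub>R b)" by (intro sum.cong refl) simp
    then show ?thesis using x by simp
  qed
  then show ?thesis using d unfolding t_def by blast
qed

text \<open>The cones over the facets have disjoint interiors (\<open>disj\<close>) and cover the
  space (\<open>cone\<close>). The former yields a vertex \<open>v\<close> of degree at most 5 by
  \<open>fan_degree\<close>; the latter shows that the wedges at \<open>v\<close> cover everything,
  which is the hypothesis of \<open>wide_sector\<close>.\<close>

lemma wide_facet_angle:
  assumes P: "insc P" "0 \<in> interior P"
  obtains F v a b where "F facet_of P" "v \<in> F \<inter> vts P" "a \<in> F \<inter> vts P" "b \<in> F \<inter> vts P" "a \<noteq> v" "b \<noteq> v" "a \<noteq> b"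
    "(a - (a \<bullet> v) *\<^sub>R v) \<bullet> (b - (b \<bullet> v) *\<^sub>R v) \<le> cos72 * (norm (a - (a \<bullet> v) *\<^sub>R v) * norm (b - (b \<bullet> v) *\<^sub>R v))"
proof -
  have poly: "polytope P" using P(1) by (simp add: insc_def)
  define \<F> where "\<F> = {F. F facet_of P}"
  define \<T> where "\<T> = (\<lambda>F. F \<inter> vts P) ` \<F>"
  have finT: "finite \<T>" unfolding \<T>_def \<F>_def using finite_facets[OF P(1)] by (rule finite_imageI)
  have hull: "(convex hull t) facet_of P \<and> (convex hull t) \<inter> vts P = t" if "t \<in> \<T>" for t
  proof -
    obtain F where F: "F facet_of P" "t = F \<inter> vts P" using \<open>t \<in> \<T>\<close> unfolding \<T>_def \<F>_def by blast
    have "convex hull t = F" unfolding F(2) by (rule facet_vts(2)[OF P(1) F(1), symmetric])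
    then show ?thesis using F by simp
  qed
  have card3: "card t = 3" if "t \<in> \<T>" for t
    using facet_vts(1)[OF P(1) conjunct1[OF hull[OF that]]] unfolding conjunct2[OF hull[OF that]] .
  have ft: "finite t" if "t \<in> \<T>" for t by (rule card_ge_0_finite) (simp add: card3[OF that])
  define \<Phi> where "\<Phi> t d \<longleftrightarrow> (\<forall>a\<in>t. \<forall>b\<in>t. d a \<bullet> b = (if a = b then 1 else 0)) \<and> (\<forall>x. x = (\<Sum>b\<in>t. (d b \<bullet> x) *\<^sub>R b))"
    for t :: "(real^3) set" and d :: "real^3 \<Rightarrow> real^3"
  define d where "d t = (SOME d. \<Phi> t d)" for t
  have d: "\<Phi> t (d t)" if t: "t \<in> \<T>" for t
  proof -
    obtain F where F: "F facet_of P" "t = F \<inter> vts P" using t unfolding \<T>_def \<F>_def by blast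
    have "\<exists>d. \<Phi> t d" unfolding \<Phi>_def F(2) by (rule facet_dual[OF P F(1)])
    then show ?thesis unfolding d_def by (rule someI_ex)
  qed
  have dual: "d t a \<bullet> b = (if a = b then 1 else 0)" if "t \<in> \<T>" "a \<in> t" "b \<in> t" for t a b
    using conjunct1[OF d[OF that(1), unfolded \<Phi>_def], THEN bspec, OF that(2), THEN bspec, OF that(3)] .
  have rep: "(\<Sum>b\<in>t. (d t b \<bullet> x) *\<^sub>R b) = x" if "t \<in> \<T>" for t x
    using conjunct2[OF d[OF that, unfolded \<Phi>_def], THEN spec[of _ x]] by (rule sym)
  have face: "(convex hull t) face_of P" if "t \<in> \<T>" for t using hull[OF that] by (simp add: facet_of_def)
  have scale: "(1 / (\<Sum>b\<in>t. d t b \<bullet> x)) *\<^sub>R x = (\<Sum>b\<in>t. (d t b \<bullet> x / (\<Sum>b\<in>t. d t b \<bullet> x)) *\<^sub>R b)" if "t \<in> \<T>" for t x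
    by (subst (2) rep[OF that, symmetric]) (simp add: scaleR_sum_right)
  \<comment> \<open>No ray from the origin stays in \<open>P\<close> beyond a facet, as pairing with
    the normal of the facet shows.\<close>
  have above: "1 \<le> m" if t: "t \<in> \<T>" "y \<in> convex hull t" "z \<in> P" "y = m *\<^sub>R z" "0 < m" for t y z m
  proof -
    obtain h \<beta> where h: "0 < \<beta>" "P \<subseteq> {x. h \<bullet> x \<le> \<beta>}" "convex hull t = P \<inter> {x. h \<bullet> x = \<beta>}"
      by (rule facet_hyperplane[OF P conjunct1[OF hull[OF t(1)]]]) (rule that; assumption)
    have "\<beta> = m * (h \<bullet> z)" using t(2,4) h(3) by auto
    also have "\<dots> \<le> m * \<beta>" using t(3,5) h(2) by (intro mult_left_mono) auto
    finally show ?thesis using h(1) by simp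
  qed
  \<comment> \<open>By \<open>above\<close>, used in both directions, the ray of \<open>x\<close>
    meets both facets at the same point. It is in both relative interiors, so the faces
    coincide.\<close>
  have disj: "t = u" if tu: "t \<in> \<T>" "u \<in> \<T>" "\<forall>b\<in>t. 0 < d t b \<bullet> x" "\<forall>b\<in>u. 0 < d u b \<bullet> x" for t u x
  proof -
    define m n where "m = (\<Sum>b\<in>t. d t b \<bullet> x)" and "n = (\<Sum>b\<in>u. d u b \<bullet> x)"
    have in_rel: "0 < (\<Sum>b\<in>s. d s b \<bullet> x) \<and> (1 / (\<Sum>b\<in>s. d s b \<bullet> x)) *\<^sub>R x \<in> rel_interior (convex hull s)"
      if s: "s \<in> \<T>" "\<forall>b\<in>s. 0 < d s b \<bullet> x" for s
    proof
      define k where "k = (\<Sum>b\<in>s. d s b \<bullet> x)"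
      have "s \<noteq> {}" using card3[OF s(1)] by auto
      then have k: "0 < k" unfolding k_def using s(2) ft[OF s(1)] by (intro sum_pos) auto
      then show "0 < (\<Sum>b\<in>s. d s b \<bullet> x)" by (simp add: k_def)
      have na: "\<not> affine_dependent s"
        using facet_vts(3)[OF P(1) conjunct1[OF hull[OF s(1)]]] unfolding conjunct2[OF hull[OF s(1)]] .
      have "(\<Sum>b\<in>s. d s b \<bullet> x / k) = 1" using k by (simp add: k_def flip: sum_divide_distrib)
      then show "(1 / (\<Sum>b\<in>s. d s b \<bullet> x)) *\<^sub>R x \<in> rel_interior (convex hull s)"
        unfolding k_def[symmetric] scale[OF s(1), of x, folded k_def] rel_interior_convex_hull_explicit[OF na] using s(2) k
        by (intro CollectI exI[of _ "\<lambda>b. d s b \<bullet> x / k"]) simp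
    qed
    have m: "0 < m" "(1 / m) *\<^sub>R x \<in> rel_interior (convex hull t)" using in_rel[OF tu(1,3)] by (auto simp: m_def)
    have n: "0 < n" "(1 / n) *\<^sub>R x \<in> rel_interior (convex hull u)" using in_rel[OF tu(2,4)] by (auto simp: n_def)
    have mh: "(1 / m) *\<^sub>R x \<in> convex hull t" "(1 / n) *\<^sub>R x \<in> convex hull u"
      using m(2) n(2) rel_interior_subset by blast+
    have sub: "convex hull t \<subseteq> P" "convex hull u \<subseteq> P" using face tu(1,2) face_of_imp_subset by blast+
    have "1 \<le> n / m"
      by (rule above[OF tu(1) mh(1) subsetD[OF sub(2) mh(2)]]) (use m(1) n(1) in simp_all)
    moreover have "1 \<le> m / n"
      by (rule above[OF tu(2) mh(2) subsetD[OF sub(1) mh(1)]]) (use m(1) n(1) in simp_all)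
    ultimately have "m = n" using m(1) n(1) by simp
    have "rel_interior (convex hull t) \<inter> rel_interior (convex hull u) \<noteq> {}"
      using IntI[OF m(2) n(2)[folded \<open>m = n\<close>]] by (rule ex_in_conv[THEN iffD1, OF exI])
    then have eq: "convex hull t = convex hull u" by (rule face_of_eq[OF face[OF tu(1)] face[OF tu(2)]])
    have "t = convex hull u \<inter> vts P" unfolding eq[symmetric] by (rule conjunct2[OF hull[OF tu(1)], symmetric])
    then show ?thesis unfolding conjunct2[OF hull[OF tu(2)]] .
  qed
  have cone: "\<exists>t\<in>\<T>. \<forall>b\<in>t. 0 \<le> d t b \<bullet> x" if x: "x \<noteq> 0" for x
  proof -
    obtain l where l: "0 < l" "0 + l *\<^sub>R x \<in> frontier P"
      by (rule ray_to_frontier[OF polytope_imp_bounded[OF poly] P(2) x]) (rule that; assumption)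
    have "closed P" using poly polytope_imp_closed by blast
    then have "l *\<^sub>R x \<in> P" "l *\<^sub>R x \<notin> interior P" using l(2) by (auto simp: frontier_def)
    then obtain F where F: "F facet_of P" "l *\<^sub>R x \<in> F" by (rule frontier_facet[OF P(1)]) (rule that; assumption)
    define t where "t = F \<inter> vts P"
    have t: "t \<in> \<T>" using F(1) by (auto simp: \<T>_def \<F>_def t_def)
    have "l *\<^sub>R x \<in> convex hull t" using F(2) unfolding t_def facet_vts(2)[OF P(1) F(1), symmetric] .
    then obtain u where u: "\<And>b. b \<in> t \<Longrightarrow> 0 \<le> u b" "(\<Sum>b\<in>t. u b *\<^sub>R b) = l *\<^sub>R x"
      unfolding convex_hull_finite[OF ft[OF t]] by blast
    have "0 \<le> d t b \<bullet> x" if b: "b \<in> t" for b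
    proof -
      have "l * (d t b \<bullet> x) = d t b \<bullet> (\<Sum>c\<in>t. u c *\<^sub>R c)" by (simp add: u(2))
      also have "\<dots> = (\<Sum>c\<in>t. u c * (d t b \<bullet> c))" by (simp add: inner_sum_right)
      also have "\<dots> = (\<Sum>c\<in>t. if b = c then u c else 0)" using dual[OF t b] by (intro sum.cong refl) auto
      also have "\<dots> = u b" using ft[OF t] b by simp
      finally show ?thesis using u(1)[OF b] l(1) by (metis mult_le_cancel_left_pos mult_zero_right)
    qed
    then show ?thesis using t by blast
  qed
  have neT: "\<T> \<noteq> {}" using cone[of "axis 1 1"] by auto
  obtain v where v: "v \<in> \<Union>\<T>" "card {t \<in> \<T>. v \<in> t} \<le> 5"
  proof (rule fan_degree[where \<T> = \<T> and d = d])
    show "finite \<T>" "\<T> \<noteq> {}" by fact+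
  qed (rule card3 dual disj that; assumption)+
  have vV: "v \<in> vts P" using v(1) unfolding \<T>_def by blast
  have nv: "norm v = 1" using vts(3)[OF P(1) vV] .
  define I where "I = {t \<in> \<T>. v \<in> t}"
  have finI: "finite I" "card I \<le> 5" using finT v(2) by (auto simp: I_def)
  \<comment> \<open>The points \<open>v + e j *\<^sub>R x\<close> approach \<open>v\<close>, and by
    pigeonhole one cone contains infinitely many of them. In the limit it contains \<open>v\<close>,
    which is then one of its vertices, and the other coordinates of these points come from
    \<open>x\<close> alone.\<close>
  have cover: "\<exists>t\<in>I. \<forall>b\<in>t - {v}. 0 \<le> d t b \<bullet> x" for x
  proof -
    define e where "e j = 1 / (real j + 2 + norm x)" for j :: nat
    have e: "0 < e j" for j by (simp add: e_def add_pos_nonneg)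
    have nz: "v + e j *\<^sub>R x \<noteq> 0" for j
    proof
      assume "v + e j *\<^sub>R x = 0"
      then have "norm v = norm (e j *\<^sub>R x)" by (metis add_eq_0_iff norm_minus_cancel)
      then have "1 = e j * norm x" using nv e[of j] by simp
      moreover have "e j * norm x < 1" by (simp add: e_def divide_less_eq add_pos_nonneg)
      ultimately show False by simp
    qed
    have "\<forall>j. \<exists>t. t \<in> \<T> \<and> (\<forall>b\<in>t. 0 \<le> d t b \<bullet> (v + e j *\<^sub>R x))" using cone[OF nz] by blast
    from choice[OF this] obtain f where f': "\<forall>j. f j \<in> \<T> \<and> (\<forall>b\<in>f j. 0 \<le> d (f j) b \<bullet> (v + e j *\<^sub>R x))" ..
    have f: "\<And>j. f j \<in> \<T>" "\<And>j b. b \<in> f j \<Longrightarrow> 0 \<le> d (f j) b \<bullet> (v + e j *\<^sub>R x)" using f' by simp_all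
    have "finite (range f)" using f(1) finT by (intro finite_subset[of "range f" \<T>]) auto
    then obtain j0 where inf: "infinite {j. f j = f j0}"
      using pigeonhole_infinite[of UNIV f] by auto
    define t where "t = f j0"
    have t: "t \<in> \<T>" using f(1) by (simp add: t_def)
    have e0: "e \<longlonglongrightarrow> 0"
    proof (rule tendsto_sandwich[of "\<lambda>_. 0" _ _ "\<lambda>j. 1 / real (Suc j)"])
      show "\<forall>\<^sub>F j in sequentially. 0 \<le> e j" using e less_imp_le by (intro always_eventually) blast
      show "\<forall>\<^sub>F j in sequentially. e j \<le> 1 / real (Suc j)"
        unfolding e_def by (intro always_eventually allI divide_left_mono) (auto simp: add_pos_nonneg)
      show "(\<lambda>j. 1 / real (Suc j)) \<longlonglongrightarrow> 0" using LIMSEQ_inverse_real_of_nat by (simp add: inverse_eq_divide)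
    qed simp
    have dv: "0 \<le> d t b \<bullet> v" if b: "b \<in> t" for b
    proof (rule ccontr)
      assume "\<not> 0 \<le> d t b \<bullet> v"
      then have neg: "d t b \<bullet> v < 0" by simp
      have "(\<lambda>j. d t b \<bullet> (v + e j *\<^sub>R x)) \<longlonglongrightarrow> d t b \<bullet> (v + 0 *\<^sub>R x)" by (intro tendsto_intros e0)
      then have "\<forall>\<^sub>F j in sequentially. d t b \<bullet> (v + e j *\<^sub>R x) < 0" using neg by (intro order_tendstoD(2)) auto
      then obtain M where M: "\<And>j. M \<le> j \<Longrightarrow> d t b \<bullet> (v + e j *\<^sub>R x) < 0" unfolding eventually_sequentially by blast
      obtain j where j: "M \<le> j" "f j = t" using inf unfolding infinite_nat_iff_unbounded_le t_def by blast
      show False using M[OF j(1)] f(2)[of b j] j(2) b by simp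
    qed
    \<comment> \<open>Dividing \<open>v\<close> by \<open>s\<close> lands in the facet. As
      \<open>P\<close> is in the unit ball, \<open>s \<ge> 1\<close>; as \<open>v\<close> itself is
      in \<open>P\<close>, \<open>above\<close> gives \<open>1 / s \<ge> 1\<close>.\<close>
    define s where "s = (\<Sum>b\<in>t. d t b \<bullet> v)"
    have s0: "0 \<le> s" unfolding s_def using dv by (intro sum_nonneg) auto
    have "s \<noteq> 0"
    proof
      assume "s = 0"
      then have "\<forall>b\<in>t. d t b \<bullet> v = 0" unfolding s_def using dv ft[OF t] by (simp add: sum_nonneg_eq_0_iff)
      then have "v = 0" using rep[OF t, of v] by simp
      then show False using nv by simp
    qed
    then have s: "0 < s" using s0 by simp
    have "(\<Sum>b\<in>t. d t b \<bullet> v / s) = 1" using s by (simp add: s_def flip: sum_divide_distrib)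
    then have inh: "(1 / s) *\<^sub>R v \<in> convex hull t"
      unfolding scale[OF t, of v, folded s_def] convex_hull_finite[OF ft[OF t]] using dv s
      by (intro CollectI exI[of _ "\<lambda>b. d t b \<bullet> v / s"]) simp
    then have "(1 / s) *\<^sub>R v \<in> P" using face_of_imp_subset[OF face[OF t]] by blast
    then have "norm ((1 / s) *\<^sub>R v) \<le> 1" using vts(4)[OF P(1)] by (auto simp: subset_iff)
    then have "1 \<le> s" using s nv by simp
    moreover have "1 \<le> 1 / s"
      by (rule above[OF t inh subsetD[OF vts(5)[OF P(1)] vV]]) (use s in simp_all)
    ultimately have "s = 1" using s by simp
    then have "v \<in> (convex hull t) \<inter> vts P" using inh vV by simp
    then have "v \<in> t" unfolding conjunct2[OF hull[OF t]] .
    moreover have "0 \<le> d t b \<bullet> x" if b: "b \<in> t - {v}" for b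
    proof -
      have "d t b \<bullet> v = 0" using dual[OF t _ \<open>v \<in> t\<close>, of b] b by auto
      moreover have "0 \<le> d t b \<bullet> (v + e j0 *\<^sub>R x)" using f(2)[of b j0] b by (simp add: t_def)
      ultimately have "0 \<le> e j0 * (d t b \<bullet> x)" by (simp add: inner_add_right)
      then show ?thesis using e[of j0] by (simp add: zero_le_mult_iff)
    qed
    ultimately show ?thesis using t unfolding I_def by blast
  qed
  define \<Psi> where "\<Psi> t g \<longleftrightarrow> t = {v, fst g, snd g} \<and> fst g \<noteq> v \<and> snd g \<noteq> v \<and> fst g \<noteq> snd g"
    for t and g :: "(real^3) \<times> (real^3)"
  define g where "g t = (SOME g. \<Psi> t g)" for t
  have "\<Psi> t (g t)" if t: "t \<in> I" for t
  proof -
    have t': "t \<in> \<T>" "v \<in> t" using t by (simp_all add: I_def)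
    have "card (t - {v}) = 2" using card3[OF t'(1)] t'(2) by (simp add: ft[OF t'(1)])
    then obtain a b where ab: "t - {v} = {a, b}" "a \<noteq> b" by (auto simp: card_2_iff)
    have "a \<in> t - {v}" "b \<in> t - {v}" unfolding ab(1) by simp_all
    then have "a \<noteq> v" "b \<noteq> v" by simp_all
    moreover have "insert v (t - {v}) = t" using t'(2) by (rule insert_Diff)
    ultimately have "\<Psi> t (a, b)" unfolding \<Psi>_def ab(1) using ab(2) by auto
    then show ?thesis unfolding g_def by (rule someI)
  qed
  then have g: "\<And>t. t \<in> I \<Longrightarrow> t = {v, fst (g t), snd (g t)}" "\<And>t. t \<in> I \<Longrightarrow> fst (g t) \<noteq> v"
    "\<And>t. t \<in> I \<Longrightarrow> snd (g t) \<noteq> v" "\<And>t. t \<in> I \<Longrightarrow> fst (g t) \<noteq> snd (g t)" unfolding \<Psi>_def by blast+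
  define A B where "A t = d t (fst (g t))" and "B t = d t (snd (g t))" for t
  have cov: "\<exists>t\<in>I. 0 \<le> A t \<bullet> x \<and> 0 \<le> B t \<bullet> x" for x
  proof -
    obtain t where t: "t \<in> I" "\<forall>b\<in>t - {v}. 0 \<le> d t b \<bullet> x" using cover by blast
    have "fst (g t) \<in> {v, fst (g t), snd (g t)}" "snd (g t) \<in> {v, fst (g t), snd (g t)}" by simp_all
    then have "fst (g t) \<in> t - {v}" "snd (g t) \<in> t - {v}"
      unfolding g(1)[OF t(1), symmetric] using g(2,3)[OF t(1)] by simp_all
    then show ?thesis using t unfolding A_def B_def by blast
  qed
  have rp: "\<exists>r. x = r *\<^sub>R v + (A t \<bullet> x) *\<^sub>R fst (g t) + (B t \<bullet> x) *\<^sub>R snd (g t)" if t: "t \<in> I" for t x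
  proof -
    have "x = (\<Sum>b\<in>t. (d t b \<bullet> x) *\<^sub>R b)" using rep[of t x] t by (simp add: I_def)
    also have "\<dots> = (\<Sum>b\<in>{v, fst (g t), snd (g t)}. (d t b \<bullet> x) *\<^sub>R b)" by (rule sum.cong[OF g(1)[OF t] refl])
    also have "\<dots> = (d t v \<bullet> x) *\<^sub>R v + (A t \<bullet> x) *\<^sub>R fst (g t) + (B t \<bullet> x) *\<^sub>R snd (g t)"
      using g(2-4)[OF t] by (simp add: A_def B_def add.assoc)
    finally show ?thesis by blast
  qed
  show ?thesis
  proof (rule wide_sector[OF nv finI cov rp])
    fix t assume t: "t \<in> I"
      and ang: "(fst (g t) - (fst (g t) \<bullet> v) *\<^sub>R v) \<bullet> (snd (g t) - (snd (g t) \<bullet> v) *\<^sub>R v)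
         \<le> cos72 * (norm (fst (g t) - (fst (g t) \<bullet> v) *\<^sub>R v) * norm (snd (g t) - (snd (g t) \<bullet> v) *\<^sub>R v))"
    have "t \<in> \<T>" using t by (simp add: I_def)
    from hull[OF this] have h: "(convex hull t) facet_of P" "(convex hull t) \<inter> vts P = t" by auto
    have "v \<in> {v, fst (g t), snd (g t)}" "fst (g t) \<in> {v, fst (g t), snd (g t)}" "snd (g t) \<in> {v, fst (g t), snd (g t)}"
      by simp_all
    then have mem: "v \<in> t" "fst (g t) \<in> t" "snd (g t) \<in> t" unfolding g(1)[OF t, symmetric] .
    show ?thesis
      by (rule that[OF h(1), of v "fst (g t)" "snd (g t)"]) (use h(2) mem g(2-4)[OF t] ang in simp_all)
  qed
qed

section \<open>Moving the centre of the sphere to the origin\<close>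

lemma face_of_translation_iff:
  fixes S :: "'a::euclidean_space set"
  shows "G face_of (+) a ` S \<longleftrightarrow> (\<exists>F. F face_of S \<and> G = (+) a ` F)"
proof
  assume G: "G face_of (+) a ` S"
  have eq: "G = (+) a ` ((+) (- a) ` G)" by (simp add: image_image)
  show "\<exists>F. F face_of S \<and> G = (+) a ` F"
  proof (intro exI conjI)
    show "G = (+) a ` ((+) (- a) ` G)" by (rule eq)
    show "((+) (- a) ` G) face_of S" using G by (subst (asm) eq) (simp only: face_of_translation_eq)
  qed
qed (auto simp only: face_of_translation_eq)

lemma inj_image_translation: "inj_on ((`) ((+) a)) X" for a :: "'a::group_add"
  by (intro inj_onI) (simp add: inj_image_eq_iff)

lemma translation_facets:
  fixes S :: "'a::euclidean_space set"
  shows "{F. F facet_of (+) a ` S} = (`) ((+) a) ` {F. F facet_of S}"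
  unfolding facet_of_def face_of_translation_iff by (auto simp: aff_dim_translation_eq)

lemma translation_edges:
  fixes S :: "'a::euclidean_space set"
  shows "{e. e edge_of (+) a ` S} = (`) ((+) a) ` {e. e edge_of S}"
  unfolding edge_of_def face_of_translation_iff by (auto simp: aff_dim_translation_eq)

lemma diameter_translation: "diameter ((+) a ` S) = diameter S" for a :: "'a::real_normed_vector"
proof -
  have "(\<lambda>(x, y). dist x y) ` ((+) a ` S \<times> (+) a ` S) = (\<lambda>(x, y). dist x y) ` (S \<times> S)"
    by (force simp: image_iff)
  then show ?thesis unfolding diameter_def by simp
qed

lemma simplex_translation:
  fixes S :: "'a::euclidean_space set"
  assumes "n simplex S" shows "n simplex ((+) a ` S)"
proof -
  obtain C where C: "\<not> affine_dependent C" "int (card C) = n + 1" "S = convex hull C"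
    using assms unfolding simplex_def by blast
  have "\<not> affine_dependent ((+) a ` C)" using C(1) affine_dependent_translation_eq[of C a] by simp
  moreover have "int (card ((+) a ` C)) = n + 1" using C(2) by (simp add: card_image)
  moreover have "(+) a ` S = convex hull ((+) a ` C)" unfolding C(3) by (rule convex_hull_translation[symmetric])
  ultimately show ?thesis unfolding simplex_def by blast
qed

lemma centre_at_origin:
  assumes "convex_polyhedron P" "inscribed_in_unit_sphere P" "has_triangular_faces m P"
  obtains Q where "insc Q" "card {F. F facet_of Q} = m" "edge_lengths Q = edge_lengths P"
proof -
  obtain c where c: "{v. v extreme_point_of P} \<subseteq> sphere c 1"
    using assms(2) unfolding inscribed_in_unit_sphere_def by blast
  define Q where "Q = (+) (- c) ` P"
  have "norm v = 1" if v: "v extreme_point_of Q" for v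
  proof -
    have "- c + (c + v) extreme_point_of (\<lambda>x. - c + x) ` P" using v by (simp add: Q_def)
    then have "c + v \<in> sphere c 1" using c unfolding extreme_point_of_translation_eq by blast
    then show ?thesis by (simp add: dist_norm)
  qed
  moreover have "polytope Q" "aff_dim Q = 3"
    using assms(1) unfolding convex_polyhedron_def Q_def polytope_translation_eq aff_dim_translation_eq by blast+
  moreover have "2 simplex F" if F: "F facet_of Q" for F
  proof -
    have "F \<in> (`) ((+) (- c)) ` {F. F facet_of P}" using F translation_facets[of "- c" P] unfolding Q_def by blast
    then obtain G where "G facet_of P" "F = (+) (- c) ` G" by blast
    then show ?thesis using assms(3) simplex_translation unfolding has_triangular_faces_def by blast
  qed
  ultimately have "insc Q" unfolding insc_def by blast
  moreover have "card {F. F facet_of Q} = m"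
    using assms(3) unfolding Q_def translation_facets has_triangular_faces_def card_image[OF inj_image_translation] ..
  moreover have "edge_lengths Q = edge_lengths P"
    unfolding edge_lengths_def Q_def translation_edges image_image diameter_translation ..
  ultimately show ?thesis by (rule that)
qed

section \<open>Bounding the number of faces, and the limit inferior\<close>

lemma edge_lengths:
  assumes "insc P"
  shows "finite (edge_lengths P)" "edge_lengths P \<noteq> {}" "\<And>l. l \<in> edge_lengths P \<Longrightarrow> 0 < l"
proof -
  have poly: "polytope P" and dim: "aff_dim P = 3" using assms by (simp_all add: insc_def)
  have "{e. e edge_of P} \<subseteq> {e. e face_of P}" by (auto simp: edge_of_def)
  then have "finite {e. e edge_of P}" using finite_polytope_faces[OF poly] by (rule finite_subset)
  then show "finite (edge_lengths P)" unfolding edge_lengths_def by (rule finite_imageI)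
  show "edge_lengths P \<noteq> {}"
  proof -
    obtain F where F: "F facet_of P" using polytope_facet_exists[OF poly] dim by auto
    obtain a b where "a \<in> F \<inter> vts P" "b \<in> F \<inter> vts P" "a \<noteq> b"
      using facet_vts(1)[OF assms F] by (auto simp: card_3_iff)
    then show ?thesis using facet_edge[OF assms F] by blast
  qed
  show "0 < l" if l: "l \<in> edge_lengths P" for l
  proof -
    obtain e where e: "e edge_of P" "l = diameter e" using l unfolding edge_lengths_def by blast
    show ?thesis
    proof (rule edge_segment[OF poly e(1)])
      fix a b :: "real^3" assume "a \<noteq> b" "diameter e = dist a b"
      then show ?thesis using e(2) by simp
    qed
  qed
qed

lemma packing_scaled:
  obtains N where "\<And>c s (S :: (real^3) set). 0 < s \<Longrightarrow> S \<subseteq> cball c (R * s) \<Longrightarrow>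
    (\<And>x y. x \<in> S \<Longrightarrow> y \<in> S \<Longrightarrow> x \<noteq> y \<Longrightarrow> s \<le> dist x y) \<Longrightarrow> card S \<le> N"
proof (rule packing[of R])
  fix N assume N: "\<And>c (S :: (real^3) set). S \<subseteq> cball c R \<Longrightarrow>
    (\<And>x y. x \<in> S \<Longrightarrow> y \<in> S \<Longrightarrow> x \<noteq> y \<Longrightarrow> 1 \<le> dist x y) \<Longrightarrow> card S \<le> N"
  show ?thesis
  proof (rule that)
    fix c s and S :: "(real^3) set"
    assume s: "0 < s" and S: "S \<subseteq> cball c (R * s)"
      and sep: "\<And>x y. x \<in> S \<Longrightarrow> y \<in> S \<Longrightarrow> x \<noteq> y \<Longrightarrow> s \<le> dist x y"
    define f where "f x = (1 / s) *\<^sub>R x" for x :: "real^3"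
    have d: "dist (f x) (f y) = dist x y / s" for x y
      using s by (simp add: f_def dist_norm flip: scaleR_diff_right)
    have inj: "inj_on f S" using s by (intro inj_onI) (simp add: f_def)
    have "card (f ` S) \<le> N"
    proof (rule N[of _ "f c"])
      show "f ` S \<subseteq> cball (f c) R"
      proof
        fix z assume "z \<in> f ` S"
        then obtain x where x: "x \<in> S" "z = f x" by blast
        then have "dist c x \<le> R * s" using S by auto
        then show "z \<in> cball (f c) R" unfolding mem_cball x(2) d using s by (simp add: pos_divide_le_eq)
      qed
      fix z w assume "z \<in> f ` S" "w \<in> f ` S" "z \<noteq> w"
      then obtain x y where "x \<in> S" "y \<in> S" "z = f x" "w = f y" "x \<noteq> y" by blast
      then show "1 \<le> dist z w" using sep[of x y] s by (simp add: d le_divide_eq_1)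
    qed
    then show "card S \<le> N" by (simp add: card_image inj)
  qed
qed

text \<open>Measured in units of the shortest edge, the vertices lie in a ball of bounded radius:
  \<open>\<rho>\<close> for the cap when the centre is not interior, and \<open>1 / \<delta>\<close>
  for the unit ball otherwise. Separation then bounds their number.\<close>

lemma few_facets:
  assumes \<rho>: "0 < \<rho>" "\<rho> < ratio_bound"
  obtains M where "\<And>P. insc P \<Longrightarrow> edge_ratio P \<le> \<rho> \<Longrightarrow> card {F. F facet_of P} \<le> M"
proof -
  \<comment> \<open>For \<open>s < \<delta>\<close> the error \<open>\<rho> ^ 4 * s ^ 4 / 2\<close>
    from \<open>chord_bound\<close> is less than the gap
    \<open>s\<^sup>2 * (ratio_bound\<^sup>2 - \<rho>\<^sup>2)\<close>.\<close>
  define \<delta> where "\<delta> = sqrt ((ratio_bound\<^sup>2 - \<rho>\<^sup>2) / \<rho> ^ 4)"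
  have gap: "0 < ratio_bound\<^sup>2 - \<rho>\<^sup>2" using \<rho> by (simp add: power_strict_mono)
  have \<delta>: "0 < \<delta>" unfolding \<delta>_def using gap \<rho>(1) by simp
  have \<delta>2: "\<rho> ^ 4 * \<delta>\<^sup>2 = ratio_bound\<^sup>2 - \<rho>\<^sup>2" unfolding \<delta>_def using gap \<rho>(1) by simp
  obtain N1 where N1: "\<And>c s (S :: (real^3) set). 0 < s \<Longrightarrow> S \<subseteq> cball c (\<rho> * s) \<Longrightarrow>
    (\<And>x y. x \<in> S \<Longrightarrow> y \<in> S \<Longrightarrow> x \<noteq> y \<Longrightarrow> s \<le> dist x y) \<Longrightarrow> card S \<le> N1"
    using packing_scaled[of \<rho>] by blast
  obtain N2 where N2: "\<And>c s (S :: (real^3) set). 0 < s \<Longrightarrow> S \<subseteq> cball c ((1 / \<delta>) * s) \<Longrightarrow>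
    (\<And>x y. x \<in> S \<Longrightarrow> y \<in> S \<Longrightarrow> x \<noteq> y \<Longrightarrow> s \<le> dist x y) \<Longrightarrow> card S \<le> N2"
    using packing_scaled[of "1 / \<delta>"] by blast
  show ?thesis
  proof (rule that)
    fix P assume P: "insc P" and ratio: "edge_ratio P \<le> \<rho>"
    note E = edge_lengths[OF P]
    define s L where "s = Min (edge_lengths P)" and "L = Max (edge_lengths P)"
    have sE: "s \<in> edge_lengths P" and LE: "L \<in> edge_lengths P"
      unfolding s_def L_def using E(1,2) by simp_all
    have s: "0 < s" and L: "0 < L" using E(3) sE LE by simp_all
    have sl: "s \<le> l" and lL: "l \<le> L" if "l \<in> edge_lengths P" for l
      unfolding s_def L_def using that E(1) by simp_all
    have Ls: "L \<le> \<rho> * s"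
      using ratio s unfolding edge_ratio_def L_def[symmetric] s_def[symmetric] by (simp add: pos_divide_le_eq)
    have sep: "s \<le> dist x y" if "x \<in> vts P" "y \<in> vts P" "x \<noteq> y" for x y
      by (rule vts_separated[OF P sl that])
    have "card (vts P) \<le> N1 + N2"
    proof (cases "0 \<in> interior P")
      case False
      obtain y where y: "vts P \<subseteq> cball y L"
        by (rule vts_small_cap[OF P lL less_imp_le[OF L] False])
      have "cball y L \<subseteq> cball y (\<rho> * s)" using Ls by (rule subset_cball)
      then have "card (vts P) \<le> N1" using y by (intro N1[OF s _ sep]) auto
      then show ?thesis by simp
    next
      case int: True
      have "\<not> s < \<delta>"
      proof
        assume lt: "s < \<delta>"
        show False
        proof (rule wide_facet_angle[OF P int])
          fix F v a b
          assume F: "F facet_of P" and v: "v \<in> F \<inter> vts P" and a: "a \<in> F \<inter> vts P" and b: "b \<in> F \<inter> vts P"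
            and ne: "a \<noteq> v" "b \<noteq> v" "a \<noteq> b"
            and ang: "(a - (a \<bullet> v) *\<^sub>R v) \<bullet> (b - (b \<bullet> v) *\<^sub>R v)
              \<le> cos72 * (norm (a - (a \<bullet> v) *\<^sub>R v) * norm (b - (b \<bullet> v) *\<^sub>R v))"
          have unit: "norm v = 1" "norm a = 1" "norm b = 1" using vts(3)[OF P] v a b by auto
          note edges = facet_edge[OF P F a v ne(1)] facet_edge[OF P F b v ne(2)] facet_edge[OF P F a b ne(3)]
          have "(ratio_bound * s)\<^sup>2 - L ^ 4 / 2 \<le> (dist a b)\<^sup>2"
            by (rule chord_bound[OF unit ang sl[OF edges(1)] sl[OF edges(2)] lL[OF edges(1)] lL[OF edges(2)] less_imp_le[OF s]])
          also have "\<dots> \<le> L\<^sup>2" using lL[OF edges(3)] by (intro power_mono) auto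
          also have "\<dots> \<le> (\<rho> * s)\<^sup>2" using Ls L by (intro power_mono) auto
          finally have "(ratio_bound * s)\<^sup>2 \<le> (\<rho> * s)\<^sup>2 + L ^ 4 / 2" by simp
          also have "L ^ 4 \<le> (\<rho> * s) ^ 4" using Ls L by (intro power_mono) auto
          finally have "s\<^sup>2 * (ratio_bound\<^sup>2 - \<rho>\<^sup>2) \<le> s\<^sup>2 * (\<rho> ^ 4 * s\<^sup>2 / 2)"
            by (simp add: power_mult_distrib algebra_simps flip: power_add)
          then have "ratio_bound\<^sup>2 - \<rho>\<^sup>2 \<le> \<rho> ^ 4 * s\<^sup>2 / 2" using s by simp
          moreover have "\<rho> ^ 4 * s\<^sup>2 \<le> \<rho> ^ 4 * \<delta>\<^sup>2"
            using lt s \<rho>(1) by (intro mult_left_mono power_mono) auto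
          ultimately show False using \<delta>2 gap by linarith
        qed
      qed
      then have "1 \<le> (1 / \<delta>) * s" using \<delta> by (simp add: field_simps)
      then have "cball (0::real^3) 1 \<subseteq> cball 0 ((1 / \<delta>) * s)" by (rule subset_cball)
      moreover have "vts P \<subseteq> cball 0 1" using vts(4,5)[OF P] by blast
      ultimately have "card (vts P) \<le> N2" by (intro N2[OF s _ sep]) auto
      then show ?thesis by simp
    qed
    then have "(2::nat) ^ card (vts P) \<le> 2 ^ (N1 + N2)" by (rule power_increasing) simp
    with card_facets_le[OF P] show "card {F. F facet_of P} \<le> 2 ^ (N1 + N2)" by (rule order_trans)
  qed
qed

lemma liminf_lower: "ereal ratio_bound \<le> liminf inf_edge_ratio"
  unfolding le_Liminf_iff
proof (intro allI impI)
  fix y assume "y < ereal ratio_bound"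
  \<comment> \<open>\<open>few_facets\<close> asks for a positive \<open>\<rho>\<close>, whereas
    \<open>y\<close> may be negative or minus infinity.\<close>
  then have "max y 0 < ereal ratio_bound" using ratio_bound_pos by simp
  then obtain \<rho> where \<rho>: "max y 0 < ereal \<rho>" "ereal \<rho> < ereal ratio_bound" using ereal_dense2 by blast
  then have r: "0 < \<rho>" "\<rho> < ratio_bound" by auto
  show "\<forall>\<^sub>F m in sequentially. y < inf_edge_ratio m"
  proof (rule few_facets[OF r])
    fix M assume M: "\<And>P. insc P \<Longrightarrow> edge_ratio P \<le> \<rho> \<Longrightarrow> card {F. F facet_of P} \<le> M"
    have "y < inf_edge_ratio m" if m: "M < m" for m
    proof -
      have "ereal \<rho> \<le> inf_edge_ratio m"
        unfolding inf_edge_ratio_def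
      proof (rule INF_greatest)
        fix P assume "P \<in> {P. convex_polyhedron P \<and> inscribed_in_unit_sphere P \<and> has_triangular_faces m P}"
        then have P: "convex_polyhedron P" "inscribed_in_unit_sphere P" "has_triangular_faces m P" by auto
        show "ereal \<rho> \<le> ereal (edge_ratio P)"
        proof (rule centre_at_origin[OF P])
          fix Q assume Q: "insc Q" "card {F. F facet_of Q} = m" "edge_lengths Q = edge_lengths P"
          have "\<not> edge_ratio Q \<le> \<rho>" using M[OF Q(1)] Q(2) m by auto
          then show ?thesis using Q(3) by (simp add: edge_ratio_def)
        qed
      qed
      then show ?thesis using \<rho>(1) by (auto intro: less_le_trans)
    qed
    then show ?thesis by (rule eventually_mono[OF eventually_gt_at_top[of M]])
  qed
qed

lemma ratio_bound_approx: "\<bar>ratio_bound - 1.1756\<bar> < 0.00005"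
proof -
  have "2.23606 < sqrt (5::real)" by (rule real_less_rsqrt) (simp add: power2_eq_square)
  moreover have "sqrt (5::real) < 2.23607" by (rule real_less_lsqrt) (simp_all add: power2_eq_square)
  ultimately have "(1.17556::real)\<^sup>2 < ratio_bound\<^sup>2" "ratio_bound\<^sup>2 < (1.17564::real)\<^sup>2"
    unfolding ratio_bound_sq by (simp_all add: power2_eq_square)
  then have "1.17556 < ratio_bound" "ratio_bound < 1.17564"
    using ratio_bound_pos by (rule_tac[!] power2_less_imp_less) simp_all
  then show ?thesis unfolding abs_less_iff by simp
qed

theorem mainTheorem1:
  "liminf inf_edge_ratio = ereal (2 * sin (pi / 5))
   \<and> \<bar>2 * sin (pi / 5) - (1.1756::real)\<bar> < 0.00005"
  using liminf_upper liminf_lower ratio_bound_approx unfolding ratio_bound_def by (blast intro: antisym)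

end
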